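(* Let $T=\mathrm{conv}\{(0,1),(0,0),(1,0)\}$, with $p_0=(0,1)$, $p_1=(0,0)$, $p_2=(1,0)$, and let $\Gamma\subset T$ be the special parabola arc in $T$. Let $X_n$ be a sample of $n$ independent uniform random points of $T$, and let $\mathcal{C}(X_n)$ be the collection of all longest convex chains in $X_n$ (from $p_0$ to $p_2$). Let $\gamma\ge 1$ and define $\varepsilon=\frac32\,\gamma^{1/2}\,n^{-1/12}(\log n)^{1/4}$. Then there exists $N>0$, depending on $\gamma$, such that for every $n>N$, $$\mathbb{P}\big(\mathrm{dist}(C(Y),\Gamma)>\varepsilon\ \text{for some }Y\in\mathcal{C}(X_n)\big)<2n^{-\gamma^2/14}.$$
   Context: A subset $Y$ of a finite set $X\subset T$ is a convex chain in $T$ (from $p_0$ to $p_2$) if the convex hull of $Y\cup\{p_0,p_2\}$ is a convex polygon with exactly $|Y|+2$ vertices; its length is $|Y|$. $C(Y)$ is the polygonal path which is the boundary of this convex polygon minus the edge between $p_0$ and $p_2$. $\mathcal{C}(X_n)$ is the set of convex chains $Y\subset X_n$ of maximum length. The special parabola $\Gamma$ is the unique parabola arc in $T$ tangent to the side $p_0p_1$ at $p_0$ and to the side $p_1p_2$ at $p_2$; for this $T$ it is $\{(x,y): x,y\ge 0,\ \sqrt x+\sqrt y=1\}$. $\mathrm{dist}(\cdot,\cdot)$ is the Hausdorff distance, and $\log$ is the natural logarithm. *)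

theory Defs
  imports "HOL-Probability.Probability"
begin

definition p0 :: "real \<times> real" where "p0 = (0, 1)"
definition p1 :: "real \<times> real" where "p1 = (0, 0)"
definition p2 :: "real \<times> real" where "p2 = (1, 0)"

definition T :: "(real \<times> real) set" where
  "T = convex hull {p0, p1, p2}"

definition special_parabola :: "(real \<times> real) set" where
  "special_parabola = {(x, y). x \<ge> 0 \<and> y \<ge> 0 \<and> sqrt x + sqrt y = 1}"

definition chain_hull :: "(real \<times> real) set \<Rightarrow> (real \<times> real) set" where
  "chain_hull Y = convex hull (Y \<union> {p0, p2})"

(* The vertices of the convex polygon are its extreme points. For Y = {} the hull is the
   segment from p0 to p2, which counts as a degenerate polygon with two vertices, so the
   empty set is a convex chain of length 0. *)
definition convex_chain :: "(real \<times> real) set \<Rightarrow> bool" where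
  "convex_chain Y \<longleftrightarrow>
     finite Y \<and> Y \<subseteq> T \<and> card {v. v extreme_point_of chain_hull Y} = card Y + 2"

(* The polygonal path C(Y): only the relative interior of the edge between p0 and p2 is
   removed, so the path contains its endpoints p0 and p2. *)
definition chain_path :: "(real \<times> real) set \<Rightarrow> (real \<times> real) set" where
  "chain_path Y = frontier (chain_hull Y) - open_segment p0 p2"

definition longest_chains :: "(real \<times> real) set \<Rightarrow> (real \<times> real) set set" where
  "longest_chains X = {Y. Y \<subseteq> X \<and> convex_chain Y \<and>
     (\<forall>Z. Z \<subseteq> X \<and> convex_chain Z \<longrightarrow> card Z \<le> card Y)}"

(* Hausdorff distance; the suprema are meaningful for nonempty bounded sets. *)
definition hausdorff_dist :: "'a::metric_space set \<Rightarrow> 'a set \<Rightarrow> real" where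
  "hausdorff_dist A B = max (SUP a\<in>A. infdist a B) (SUP b\<in>B. infdist b A)"

(* Law of n independent uniform points of T, as functions on {..<n}; the random set X_n is
   the image x ` {..<n} of a sample point x. *)
definition sample_space :: "nat \<Rightarrow> (nat \<Rightarrow> real \<times> real) measure" where
  "sample_space n = PiM {..<n} (\<lambda>_. uniform_measure lborel T)"

lemma T_eq: "T = {(x, y). x \<ge> 0 \<and> y \<ge> 0 \<and> x + y \<le> 1}"
proof (rule set_eqI, rule iffI)
  fix z assume "z \<in> T"
  then show "z \<in> {(x, y). x \<ge> 0 \<and> y \<ge> 0 \<and> x + y \<le> 1}"
    unfolding T_def p0_def p1_def p2_def convex_hull_3 by auto
next
  fix z :: "real \<times> real"
  assume z: "z \<in> {(x, y). x \<ge> 0 \<and> y \<ge> 0 \<and> x + y \<le> 1}"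
  have "z = snd z *\<^sub>R (0, 1) + (1 - fst z - snd z) *\<^sub>R (0, 0) + fst z *\<^sub>R (1, 0)"
    by (simp add: prod_eq_iff)
  moreover have "0 \<le> snd z" "0 \<le> 1 - fst z - snd z" "0 \<le> fst z"
      "snd z + (1 - fst z - snd z) + fst z = 1"
    using z by auto
  ultimately show "z \<in> T"
    unfolding T_def p0_def p1_def p2_def convex_hull_3 by blast
qed

lemma prob_space_uniform_T: "prob_space (uniform_measure lborel T)"
proof (rule prob_space_uniform_measure)
  have "compact T"
    unfolding T_def by (intro finite_imp_compact_convex_hull) simp
  then show "emeasure lborel T \<noteq> \<infinity>"
    using emeasure_bounded_finite[OF compact_imp_bounded, of T] by simp
  have sub: "cbox (0, 0) (1/2, 1/2) \<subseteq> T"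
    by (auto simp: T_eq cbox_Pair_eq)
  have "emeasure lborel (cbox (0::real, 0::real) (1/2, 1/2)) \<noteq> 0"
    by (subst emeasure_lborel_cbox) (auto simp: Basis_prod_def algebra_simps)
  moreover have "T \<in> sets lborel"
    using \<open>compact T\<close> by (simp add: borel_compact)
  ultimately show "emeasure lborel T \<noteq> 0"
    using emeasure_mono[OF sub, of lborel] by auto
qed

lemma prob_space_sample_space: "prob_space (sample_space n)"
  unfolding sample_space_def by (intro prob_space_PiM prob_space_uniform_T)

(* The arc of the parabola (x - y)^2 - 2 (x + y) + 1 = 0, traced from p0 to p2 by the quadratic
   curve with control points p0, p1, p2; hence its tangents at p0 and p2 are the sides
   through p1. *)
lemma special_parabola_bezier:
  "special_parabola =
     (\<lambda>t. (1 - t)\<^sup>2 *\<^sub>R p0 + (2 * t * (1 - t)) *\<^sub>R p1 + t\<^sup>2 *\<^sub>R p2) ` {0..1}"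
proof -
  have "(x, y) \<in> (\<lambda>t. (t\<^sup>2, (1 - t)\<^sup>2)) ` {0..1}"
    if "x \<ge> 0" "y \<ge> 0" "sqrt x + sqrt y = 1" for x y :: real
  proof (rule image_eqI)
    have "1 - sqrt x = sqrt y" using that by simp
    then show "(x, y) = ((sqrt x)\<^sup>2, (1 - sqrt x)\<^sup>2)"
      using that by (metis real_sqrt_pow2)
    show "sqrt x \<in> {0..1}"
      using that real_sqrt_ge_zero[of x] real_sqrt_ge_zero[of y] unfolding atLeastAtMost_iff by linarith
  qed
  then show ?thesis
    unfolding special_parabola_def p0_def p1_def p2_def by (auto simp: image_iff)
qed

lemma special_parabola_conic:
  "special_parabola = {(x, y) \<in> T. (x - y)\<^sup>2 - 2 * (x + y) + 1 = 0}"
proof -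
  have "sqrt x + sqrt y = 1 \<longleftrightarrow> x + y \<le> 1 \<and> (x - y)\<^sup>2 - 2 * (x + y) + 1 = 0"
    if xy: "x \<ge> 0" "y \<ge> 0" for x y :: real
  proof -
    define a b where "a = sqrt x" and "b = sqrt y"
    have ab: "a \<ge> 0" "b \<ge> 0" and eq: "x = a\<^sup>2" "y = b\<^sup>2"
      using xy by (auto simp: a_def b_def)
    have fac: "(x - y)\<^sup>2 - 2 * (x + y) + 1
        = ((a + b)\<^sup>2 - 1) * ((a - b)\<^sup>2 - 1)"
      unfolding eq by (simp add: power2_eq_square algebra_simps)
    have "a + b = 1" if h: "a\<^sup>2 + b\<^sup>2 \<le> 1" "(a - b)\<^sup>2 = 1"
    proof -
      have "a * b \<le> 0" using h by (simp add: power2_eq_square algebra_simps)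
      then have "a * b = 0" using ab by (meson antisym mult_nonneg_nonneg)
      then have "(a + b)\<^sup>2 = 1" using h(2) by (auto simp: power2_eq_square algebra_simps)
      then show ?thesis using ab by (simp add: power2_eq_1_iff)
    qed
    moreover have "a + b = 1" if "(a + b)\<^sup>2 = 1"
      using that ab by (simp add: power2_eq_1_iff)
    moreover have "a\<^sup>2 + b\<^sup>2 \<le> 1" if "a + b = 1"
    proof -
      have "a\<^sup>2 + b\<^sup>2 + 2 * (a * b) = 1"
        using arg_cong[OF that, of power2] by (simp add: power2_sum)
      then show ?thesis using mult_nonneg_nonneg[OF ab] by linarith
    qed
    ultimately have "a + b = 1 \<longleftrightarrow> a\<^sup>2 + b\<^sup>2 \<le> 1 \<and> ((a + b)\<^sup>2 = 1 \<or> (a - b)\<^sup>2 = 1)"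
      by (metis power_one)
    then show ?thesis
      unfolding fac by (simp only: a_def[symmetric] b_def[symmetric] eq[symmetric]
          mult_eq_0_iff right_minus_eq)
  qed
  then show ?thesis
    unfolding special_parabola_def T_eq by auto
qed

end

theory Submission
  imports Defs "HOL-Real_Asymp.Real_Asymp"
begin

text \<open>Normalise the area of \<open>T\<close> to 1 and let \<open>L(n)\<close> be the mean length of the longest chain. If the path
  of a longest chain is farther than \<open>\<epsilon>\<close> from the parabola, then in some direction the two support
  functions differ by more than \<open>\<epsilon>\<close>, so a line that is far from being tangent to the parabola touches
  the chain from below at a point \<open>r\<close>. This line cuts two triangles off \<open>T\<close> that contain the chain, and the
  cube roots of their areas add up to at most \<open>1 - 8/3 \<epsilon>\<^sup>2\<close>. Chains in two triangles with a common
  vertex on the parabola can be joined, so the mean length is superadditive as a function of the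
  cube root of the area. Hence the two triangles fall short of \<open>L(n)\<close> by at least the mean length in a triangle
  whose area has cube root \<open>8/3 \<epsilon>\<^sup>2\<close>, which is about \<open>6 \<alpha> \<gamma> n\<^sup>1\<^sup>/\<^sup>6 (log n)\<^sup>1\<^sup>/\<^sup>2\<close>, where
  \<open>\<alpha> \<ge> 3/5\<close> is the limit superior of \<open>L(n) / n\<^sup>1\<^sup>/\<^sup>3\<close>; it is finite by a first moment computation. Since the
  gap is itself a mean length, no rate of convergence to \<open>\<alpha>\<close> is needed. The lengths
  involved satisfy a Bernstein inequality with variance \<open>\<Sum>k\<le>n. L(k)/k\<close>, about \<open>3 \<alpha> n\<^sup>1\<^sup>/\<^sup>3\<close>, and a
  union bound over the sample points \<open>r\<close> and over \<open>n\<close> pairs of rounded triangles costs only a factor of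
  order \<open>n\<^sup>2\<close>.\<close>

section \<open>Concentration for hereditary properties of random point sets\<close>

text \<open>The direction in which a chain is far from the parabola depends on the whole sample. A
  union bound is possible because the contact point \<open>r\<close> is a sample point or one of
  \<open>p0\<close>, \<open>p2\<close>: given \<open>r\<close> and two rounded intercepts, the other
  points are still independent and uniform, and the longest pair of partial chains in the two
  triangles is a hereditary length of its own, to which the same concentration argument applies. The
  constants fit because of how \<alpha> enters. With variance about
  \<open>3 * \<alpha> * n^(1/3)\<close>, a deviation
  \<open>x * sqrt \<alpha> * \<gamma> * n^(1/6) * (log n)^(1/2)\<close> has probability about
  \<open>n^(- x^2 * \<gamma>^2 / 6)\<close>. Deviations thus scale with the square root of \<alpha>,
  while the gap between the means is linear in \<alpha>; hence a lower bound for \<alpha> is enough,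
  and even a crude one, with one point in each of many small triangles, leaves room.\<close>

definition maxlen :: "('a set \<Rightarrow> bool) \<Rightarrow> 'a set \<Rightarrow> nat" where
  "maxlen C X = Max (card ` {S. S \<subseteq> X \<and> C S})"

text \<open>The two instances are \<open>cchain\<close> and \<open>parts r a b\<close>. Heredity
  implies that deleting a point lowers the maximal size by at most one.\<close>

locale hereditary =
  fixes C :: "'a set \<Rightarrow> bool"
  assumes C_empty: "C {}"
    and C_subset: "C S \<Longrightarrow> R \<subseteq> S \<Longrightarrow> C R"
begin

lemma maxlen_ge:
  assumes "finite X" "S \<subseteq> X" "C S"
  shows "card S \<le> maxlen C X"
  unfolding maxlen_def using assms by (intro Max_ge) auto

lemma maxlen_attained:
  assumes "finite X"
  obtains S where "S \<subseteq> X" "C S" "card S = maxlen C X"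
proof -
  have "finite {S. S \<subseteq> X \<and> C S}" using assms by auto
  moreover have "{} \<in> {S. S \<subseteq> X \<and> C S}" using C_empty by auto
  ultimately have "maxlen C X \<in> card ` {S. S \<subseteq> X \<and> C S}"
    unfolding maxlen_def by (intro Max_in) auto
  then show ?thesis using that by auto
qed

lemma maxlen_le_iff:
  assumes "finite X"
  shows "maxlen C X \<le> k \<longleftrightarrow> (\<forall>S\<subseteq>X. C S \<longrightarrow> card S \<le> k)"
  using maxlen_ge[OF assms] maxlen_attained[OF assms] by (metis le_trans)

lemma maxlen_mono:
  assumes "finite Y" "X \<subseteq> Y"
  shows "maxlen C X \<le> maxlen C Y"
  using maxlen_ge[OF assms(1)] assms by (subst maxlen_le_iff) (auto intro: finite_subset)

lemma maxlen_insert_le: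
  assumes "finite X"
  shows "maxlen C (insert z X) \<le> Suc (maxlen C X)"
proof -
  have "card S \<le> Suc (maxlen C X)" if S: "S \<subseteq> insert z X" "C S" for S
  proof -
    have "card (S - {z}) \<le> maxlen C X"
      using S by (intro maxlen_ge[OF assms]) (auto intro: C_subset)
    moreover have "card S \<le> Suc (card (S - {z}))"
      using card_Suc_Diff1[of S z] finite_subset[OF S(1)] assms by (cases "z \<in> S") auto
    ultimately show ?thesis by linarith
  qed
  then show ?thesis using assms by (subst maxlen_le_iff) auto
qed

lemma maxlen_empty [simp]: "maxlen C {} = 0"
proof -
  have "maxlen C {} \<le> 0" by (subst maxlen_le_iff) auto
  then show ?thesis by simp
qed

lemma maxlen_le_card: "finite X \<Longrightarrow> maxlen C X \<le> card X"
  by (subst maxlen_le_iff) (auto intro: card_mono)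

text \<open>An index contributes to the left-hand side only if its point belongs to every optimal set.\<close>

lemma sum_decrements_le:
  assumes "finite B" "finite J"
  shows "(\<Sum>j\<in>J. real (maxlen C (B \<union> y ` J)) - real (maxlen C (B \<union> y ` (J - {j}))))
    \<le> real (maxlen C (y ` J))"
proof -
  obtain S where S: "S \<subseteq> B \<union> y ` J" "C S" "card S = maxlen C (B \<union> y ` J)"
    using maxlen_attained[of "B \<union> y ` J"] assms by auto
  have fS: "finite S" using S(1) assms finite_subset by blast
  define D where "D = {j\<in>J. \<not> S \<subseteq> B \<union> y ` (J - {j})}"
  have le: "real (maxlen C (B \<union> y ` J)) - real (maxlen C (B \<union> y ` (J - {j})))
      \<le> (if j \<in> D then 1 else 0)" if "j \<in> J" for j
  proof (cases "j \<in> D")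
    case True
    have "B \<union> y ` J = insert (y j) (B \<union> y ` (J - {j}))" using that by auto
    then show ?thesis using maxlen_insert_le[of "B \<union> y ` (J - {j})" "y j"] assms True by auto
  next
    case False
    then have "S \<subseteq> B \<union> y ` (J - {j})" using that by (auto simp: D_def)
    then have "card S \<le> maxlen C (B \<union> y ` (J - {j}))"
      using assms S(2) by (intro maxlen_ge) auto
    then show ?thesis using False S(3) by auto
  qed
  have yD: "y j \<in> S" "\<forall>i\<in>J. i \<noteq> j \<longrightarrow> y i \<noteq> y j" if jD: "j \<in> D" for j
  proof -
    obtain s where s: "s \<in> S" "s \<notin> B" "s \<notin> y ` (J - {j})" using jD by (auto simp: D_def)
    then have sj: "s = y j" using S(1) by (auto simp: image_iff)
    show "y j \<in> S" using s sj by simp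
    show "\<forall>i\<in>J. i \<noteq> j \<longrightarrow> y i \<noteq> y j"
      using s(3) unfolding sj image_iff by (metis Diff_iff singletonD)
  qed
  have DJ: "D \<subseteq> J" by (auto simp: D_def)
  have "inj_on y D" using yD DJ by (auto simp: inj_on_def)
  then have "card D = card (y ` D)" by (simp add: card_image)
  also have "\<dots> \<le> maxlen C (y ` J)"
    using yD DJ assms S(2) by (intro maxlen_ge) (auto intro!: C_subset[OF S(2)])
  finally have "card D \<le> maxlen C (y ` J)" .
  moreover have "(\<Sum>j\<in>J. real (maxlen C (B \<union> y ` J)) - real (maxlen C (B \<union> y ` (J - {j}))))
      \<le> (\<Sum>j\<in>J. if j \<in> D then 1 else 0)"
    by (intro sum_mono le)
  moreover have "(\<Sum>j\<in>J. if j \<in> D then 1 else (0::real)) = card D"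
    using assms DJ by (simp add: sum.If_cases Int_absorb1)
  ultimately show ?thesis by linarith
qed

end

text \<open>\<open>B\<close> stands for points already revealed and held fixed, \<open>J\<close> for
  the indices of those still random. Measurability is demanded for every \<open>B\<close> because
  the moment bound conditions on one point at a time.\<close>

locale hereditary_sample = hereditary C + prob_space M
  for C :: "'a set \<Rightarrow> bool" and M :: "'a measure" +
  assumes measurable_maxlen [measurable]:
    "finite B \<Longrightarrow> finite J \<Longrightarrow>
      (\<lambda>x. real (maxlen C (B \<union> x ` J))) \<in> borel_measurable (PiM (J :: nat set) (\<lambda>_. M))"
begin

sublocale product_sigma_finite "\<lambda>_ :: nat. M" by standard

lemma prob_space_PiM_nat: "prob_space (PiM (J :: nat set) (\<lambda>_. M))"
  by (intro prob_space_PiM prob_space_axioms)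

definition mean :: "'a set \<Rightarrow> nat set \<Rightarrow> real" where
  "mean B J = (\<integral>x. real (maxlen C (B \<union> x ` J)) \<partial>PiM J (\<lambda>_. M))"

text \<open>A product of equal factors projects along every injection of index sets. Bijections give
  exchangeability in \<open>mean_card\<close>, inclusions give marginals in
  \<open>integral_subset\<close>.\<close>

lemma integral_reindex:
  fixes f :: "nat \<Rightarrow> nat"
  assumes "finite B" "finite K" "inj_on f K" "f ` K \<subseteq> I"
  shows "(\<integral>x. real (maxlen C (B \<union> x ` f ` K)) \<partial>PiM I (\<lambda>_. M)) = mean B K"
proof -
  have P: "prob_space M" by (rule prob_space_axioms)
  have "PiM K (\<lambda>_. M) = distr (PiM I (\<lambda>_. M)) (PiM K (\<lambda>_. M)) (\<lambda>\<omega>. \<lambda>n\<in>K. \<omega> (f n))"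
    using assms by (subst distr_PiM_reindex) (auto simp: P)
  then have "mean B K = (\<integral>x. real (maxlen C (B \<union> x ` K))
      \<partial>distr (PiM I (\<lambda>_. M)) (PiM K (\<lambda>_. M)) (\<lambda>\<omega>. \<lambda>n\<in>K. \<omega> (f n)))"
    by (simp add: mean_def)
  also have "\<dots> = (\<integral>x. real (maxlen C (B \<union> (\<lambda>n\<in>K. x (f n)) ` K)) \<partial>PiM I (\<lambda>_. M))"
    using assms by (intro integral_distr) (auto intro!: measurable_restrict measurable_component_singleton)
  also have "\<dots> = (\<integral>x. real (maxlen C (B \<union> x ` f ` K)) \<partial>PiM I (\<lambda>_. M))"
    by (intro Bochner_Integration.integral_cong refl arg_cong[where f="\<lambda>X. real (maxlen C (B \<union> X))"]) (auto simp: image_image)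
  finally show ?thesis by simp
qed

lemma mean_card: "finite B \<Longrightarrow> finite J \<Longrightarrow> mean B J = mean B {..<card J}"
proof -
  assume fin: "finite B" "finite J"
  obtain f where f: "bij_betw f {..<card J} J"
    using fin by (metis ex_bij_betw_nat_finite lessThan_atLeast0)
  then show ?thesis
    using integral_reindex[of B "{..<card J}" f J] fin by (simp add: bij_betw_def mean_def)
qed

lemma integral_subset:
  assumes "finite B" "finite I" "J \<subseteq> I"
  shows "(\<integral>x. real (maxlen C (B \<union> x ` J)) \<partial>PiM I (\<lambda>_. M)) = mean B J"
  using integral_reindex[of B J id I] assms by (auto intro: finite_subset)

lemma integrable_maxlen:
  fixes I J :: "nat set"
  assumes "finite B" "finite I" "J \<subseteq> I"
  shows "integrable (PiM I (\<lambda>_. M)) (\<lambda>x. real (maxlen C (B \<union> x ` J)))"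
proof -
  interpret P: prob_space "PiM I (\<lambda>_. M)" by (rule prob_space_PiM_nat)
  have fJ: "finite J" using assms finite_subset by blast
  have "(\<lambda>x. restrict x J) \<in> measurable (PiM I (\<lambda>_. M)) (PiM J (\<lambda>_. M))"
    using assms by (intro measurable_restrict_subset)
  from measurable_compose[OF this measurable_maxlen[OF assms(1) fJ]]
  have m: "(\<lambda>x. real (maxlen C (B \<union> x ` J))) \<in> borel_measurable (PiM I (\<lambda>_. M))"
    by simp
  have "maxlen C (B \<union> x ` J) \<le> card B + card J" for x
    using maxlen_le_card[of "B \<union> x ` J"] card_Un_le[of B "x ` J"] card_image_le[OF fJ, of x] assms fJ
    by fastforce
  then show ?thesis
    using m by (intro P.integrable_const_bound[where B="real (card B + card J)"] AE_I2) (auto simp flip: of_nat_add)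
qed

text \<open>By exchangeability all \<open>Suc (card J)\<close> indices have the same mean decrement,
  so each equals their average. The sum of the decrements is at most the longest length among the
  random points alone, which removes \<open>B\<close> from the bound; this uniformity drives the
  induction in \<open>exp_moment_le\<close>.\<close>

lemma mean_diff_le:
  assumes "finite B" "finite J" "j \<notin> J"
  shows "mean B (insert j J) - mean B J \<le> mean {} (insert j J) / real (Suc (card J))"
proof -
  let ?J = "insert j J" and ?P = "PiM (insert j J) (\<lambda>_. M)"
  have fin: "finite ?J" using assms by auto
  have eq: "(\<integral>x. real (maxlen C (B \<union> x ` (?J - {i}))) \<partial>?P) = mean B J" if "i \<in> ?J" for i
  proof -
    have "card (?J - {i}) = card J" using that assms by (subst card_Diff_singleton) auto
    then show ?thesis
      using assms by (subst integral_subset) (auto simp: mean_card[of B J] mean_card[of B "insert j J - {i}"])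
  qed
  have "real (Suc (card J)) * (mean B ?J - mean B J) = (\<Sum>i\<in>?J. mean B ?J - mean B J)"
    using assms by simp
  also have "\<dots> = (\<Sum>i\<in>?J. \<integral>x. real (maxlen C (B \<union> x ` ?J)) - real (maxlen C (B \<union> x ` (?J - {i}))) \<partial>?P)"
  proof (intro sum.cong refl)
    fix i assume i: "i \<in> ?J"
    show "mean B ?J - mean B J =
      (\<integral>x. real (maxlen C (B \<union> x ` ?J)) - real (maxlen C (B \<union> x ` (?J - {i}))) \<partial>?P)"
      using assms(1) fin eq[OF i]
      by (subst Bochner_Integration.integral_diff[OF integrable_maxlen integrable_maxlen]) (auto simp: mean_def)
  qed
  also have "\<dots> = (\<integral>x. (\<Sum>i\<in>?J. real (maxlen C (B \<union> x ` ?J)) - real (maxlen C (B \<union> x ` (?J - {i})))) \<partial>?P)"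
    using assms(1) fin
    by (intro Bochner_Integration.integral_sum[symmetric] Bochner_Integration.integrable_diff integrable_maxlen) auto
  also have "\<dots> \<le> mean {} ?J"
    unfolding mean_def
    using sum_decrements_le[OF assms(1) fin] integrable_maxlen[of "{}" ?J ?J] assms(1) fin
    by (intro integral_mono Bochner_Integration.integrable_sum Bochner_Integration.integrable_diff integrable_maxlen) auto
  finally show ?thesis
    by (simp add: field_simps)
qed

lemma fun_upd_image_insert: "j \<notin> J \<Longrightarrow> B \<union> (x(j := z)) ` insert j J = insert z B \<union> x ` J"
  by (auto simp: image_def)

lemma ennreal_mean:
  assumes "finite B" "finite J"
  shows "ennreal (mean B J) = (\<integral>\<^sup>+x. ennreal (real (maxlen C (B \<union> x ` J))) \<partial>PiM J (\<lambda>_. M))"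
  unfolding mean_def using integrable_maxlen[OF assms subset_refl]
  by (intro nn_integral_eq_integral[symmetric]) auto

lemma mean_nonneg: "0 \<le> mean B J"
  unfolding mean_def by (intro Bochner_Integration.integral_nonneg) simp

lemma
  assumes "finite B" "finite J" "j \<notin> J"
  shows mean_insert: "mean B (insert j J) = (\<integral>z. mean (insert z B) J \<partial>M)"
    and integrable_mean_insert: "integrable M (\<lambda>z. mean (insert z B) J)"
proof -
  let ?f = "\<lambda>x. ennreal (real (maxlen C (B \<union> x ` insert j J)))"
  have f [measurable]: "?f \<in> borel_measurable (PiM (insert j J) (\<lambda>_. M))"
    using assms by (intro measurable_compose[OF measurable_maxlen measurable_ennreal]) auto
  have eq: "(\<integral>\<^sup>+x. ?f (x(j := z)) \<partial>PiM J (\<lambda>_. M)) = ennreal (mean (insert z B) J)" for z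
    using assms by (simp only: fun_upd_image_insert[OF assms(3)] ennreal_mean finite_insert)
  interpret J: prob_space "PiM J (\<lambda>_. M)" by (rule prob_space_PiM_nat)
  have "(\<lambda>(z, x). x(j := z)) \<in> measurable (M \<Otimes>\<^sub>M PiM J (\<lambda>_. M)) (PiM (insert j J) (\<lambda>_. M))"
    by measurable
  from measurable_compose[OF this f]
  have "(\<lambda>z. \<integral>\<^sup>+x. ?f (x(j := z)) \<partial>PiM J (\<lambda>_. M)) \<in> borel_measurable M"
    by (intro J.borel_measurable_nn_integral) (simp add: case_prod_unfold)
  then have "(\<lambda>z. enn2real (\<integral>\<^sup>+x. ?f (x(j := z)) \<partial>PiM J (\<lambda>_. M))) \<in> borel_measurable M"
    by measurable
  \<comment> \<open>Measurability in \<open>z\<close> is inherited from the nonnegative integral, of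
    which \<open>mean\<close> is the real value.\<close>
  then have m: "(\<lambda>z. mean (insert z B) J) \<in> borel_measurable M"
    by (simp only: eq enn2real_ennreal mean_nonneg)
  have "ennreal (mean B (insert j J)) = (\<integral>\<^sup>+x. ?f x \<partial>PiM (insert j J) (\<lambda>_. M))"
    using assms by (intro ennreal_mean) auto
  also have "\<dots> = (\<integral>\<^sup>+z. \<integral>\<^sup>+x. ?f (x(j := z)) \<partial>PiM J (\<lambda>_. M) \<partial>M)"
    by (intro product_nn_integral_insert_rev assms f)
  finally have *: "ennreal (mean B (insert j J)) = (\<integral>\<^sup>+z. ennreal (mean (insert z B) J) \<partial>M)"
    by (simp only: eq)
  show "mean B (insert j J) = (\<integral>z. mean (insert z B) J \<partial>M)"
    using m by (subst integral_eq_nn_integral) (auto simp: mean_nonneg *[symmetric])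
  show "integrable M (\<lambda>z. mean (insert z B) J)"
    using m by (intro integrableI_nonneg) (auto simp: mean_nonneg *[symmetric])
qed

lemma mean_insert_point_bounds:
  assumes "finite B" "finite J"
  shows "mean B J \<le> mean (insert z B) J" "mean (insert z B) J \<le> mean B J + 1"
proof -
  interpret P: prob_space "PiM J (\<lambda>_. M)" by (rule prob_space_PiM_nat)
  have "finite (x ` J)" for x :: "nat \<Rightarrow> 'a" using assms by simp
  then have le: "maxlen C (B \<union> x ` J) \<le> maxlen C (insert z B \<union> x ` J)"
      "maxlen C (insert z B \<union> x ` J) \<le> Suc (maxlen C (B \<union> x ` J))" for x :: "nat \<Rightarrow> 'a"
    using assms by (auto intro!: maxlen_mono maxlen_insert_le)
  show "mean B J \<le> mean (insert z B) J"
    unfolding mean_def using assms le(1)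
    by (intro integral_mono integrable_maxlen) auto
  have "mean (insert z B) J \<le> (\<integral>x. real (maxlen C (B \<union> x ` J)) + 1 \<partial>PiM J (\<lambda>_. M))"
    unfolding mean_def using assms le(2)
    by (intro integral_mono integrable_maxlen Bochner_Integration.integrable_add)
       (auto simp flip: of_nat_Suc simp: add.commute[of _ "1::real"])
  also have "\<dots> = mean B J + 1"
    unfolding mean_def using assms
    by (subst Bochner_Integration.integral_add) (auto intro!: integrable_maxlen simp: P.prob_space)
  finally show "mean (insert z B) J \<le> mean B J + 1" .
qed

section \<open>Exponential moments and tail bounds\<close>

lemma exp_mult_le_chord:
  fixes D l :: real
  assumes "0 \<le> D" "D \<le> 1"
  shows "exp (l * D) \<le> 1 + D * (exp l - 1)"
proof -
  have "exp ((1 - D) *\<^sub>R 0 + D *\<^sub>R l) \<le> (1 - D) * exp 0 + D * exp l"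
    using assms by (intro convex_onD[OF exp_convex]) auto
  then show ?thesis by (simp add: algebra_simps)
qed

text \<open>The points are revealed one at a time. Revealing one of them when \<open>k - 1\<close> others are still
  hidden raises the conditional mean by a quantity in \<open>[0, 1]\<close>, whose expectation is at most
  \<open>mean {} {..<k} / k\<close> whatever has been revealed before, by exchangeability.\<close>

lemma exp_moment_le:
  fixes l :: real
  assumes e: "\<And>m. m > 0 \<Longrightarrow> mean {} {..<m} \<le> e m" and "finite J" "finite B"
  shows "(\<integral>\<^sup>+x. ennreal (exp (l * real (maxlen C (B \<union> x ` J)))) \<partial>PiM J (\<lambda>_. M))
    \<le> ennreal (exp (l * mean B J + (exp l - 1 - l) * (\<Sum>k=1..card J. e k / real k)))"
  using assms(2,3)
proof (induction J arbitrary: B rule: finite_induct)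
  case empty
  interpret P: prob_space "PiM ({} :: nat set) (\<lambda>_. M)" by (rule prob_space_PiM_nat)
  show ?case using P.emeasure_space_1 P.prob_space by (simp add: mean_def)
next
  case (insert j J)
  let ?V = "\<lambda>n. (exp l - 1 - l) * (\<Sum>k=1..n. e k / real k)"
  let ?f = "\<lambda>x. ennreal (exp (l * real (maxlen C (B \<union> x ` insert j J))))"
  define D where "D z = mean (insert z B) J - mean B J" for z
  define d where "d = mean B (insert j J) - mean B J"
  have phi: "0 \<le> exp l - 1 - l" using exp_ge_add_one_self[of l] by linarith
  have D: "0 \<le> D z" "D z \<le> 1" for z
    using mean_insert_point_bounds[of B J z] insert by (auto simp: D_def)
  have iD: "integrable M D"
    unfolding D_def using insert by (intro Bochner_Integration.integrable_diff integrable_mean_insert) auto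
  have ED: "(\<integral>z. D z \<partial>M) = d"
    unfolding D_def d_def using insert integrable_mean_insert[of B J j]
    by (subst Bochner_Integration.integral_diff) (auto simp: mean_insert prob_space)
  have "d \<le> mean {} (insert j J) / real (Suc (card J))"
    unfolding d_def using insert by (intro mean_diff_le) auto
  also have "\<dots> \<le> e (Suc (card J)) / real (Suc (card J))"
    using insert e[of "Suc (card J)"] by (intro divide_right_mono) (auto simp: mean_card[of "{}" "insert j J"])
  finally have d: "(exp l - 1 - l) * d \<le> (exp l - 1 - l) * (e (Suc (card J)) / real (Suc (card J)))"
    using phi by (intro mult_left_mono)
  have m [measurable]: "?f \<in> borel_measurable (PiM (insert j J) (\<lambda>_. M))"
  proof -
    have [measurable]: "(\<lambda>x. real (maxlen C (B \<union> x ` insert j J))) \<in> borel_measurable (PiM (insert j J) (\<lambda>_. M))"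
      using insert by (intro measurable_maxlen) auto
    show ?thesis by measurable
  qed
  have "(\<integral>\<^sup>+x. ?f x \<partial>PiM (insert j J) (\<lambda>_. M)) = (\<integral>\<^sup>+z. \<integral>\<^sup>+x. ?f (x(j := z)) \<partial>PiM J (\<lambda>_. M) \<partial>M)"
    by (intro product_nn_integral_insert_rev m insert)
  also have "\<dots> \<le> (\<integral>\<^sup>+z. ennreal (exp (l * mean (insert z B) J + ?V (card J))) \<partial>M)"
    using insert by (intro nn_integral_mono) (simp only: fun_upd_image_insert[OF insert(2)] finite_insert)
  also have "\<dots> \<le> (\<integral>\<^sup>+z. ennreal (exp (l * mean B J + ?V (card J)) * (1 + D z * (exp l - 1))) \<partial>M)"
  proof (intro nn_integral_mono ennreal_leI)
    fix z
    have "exp (l * mean (insert z B) J + ?V (card J)) = exp (l * mean B J + ?V (card J)) * exp (l * D z)"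
      by (simp add: D_def algebra_simps flip: exp_add)
    also have "\<dots> \<le> exp (l * mean B J + ?V (card J)) * (1 + D z * (exp l - 1))"
      using D by (intro mult_left_mono exp_mult_le_chord) auto
    finally show "exp (l * mean (insert z B) J + ?V (card J))
      \<le> exp (l * mean B J + ?V (card J)) * (1 + D z * (exp l - 1))" .
  qed
  also have "\<dots> = ennreal (\<integral>z. exp (l * mean B J + ?V (card J)) * (1 + D z * (exp l - 1)) \<partial>M)"
  proof (intro nn_integral_eq_integral AE_I2)
    show "integrable M (\<lambda>z. exp (l * mean B J + ?V (card J)) * (1 + D z * (exp l - 1)))"
      using iD by auto
    show "0 \<le> exp (l * mean B J + ?V (card J)) * (1 + D z * (exp l - 1))" for z
      using D exp_mult_le_chord[of "D z" l] by (intro mult_nonneg_nonneg) (auto intro: order_trans[OF exp_ge_zero])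
  qed
  also have "(\<integral>z. exp (l * mean B J + ?V (card J)) * (1 + D z * (exp l - 1)) \<partial>M)
      = exp (l * mean B J + ?V (card J)) * (1 + d * (exp l - 1))"
    using iD by (simp add: ED prob_space)
  \<comment> \<open>The exponent splits as
    \<open>d * (exp l - 1) = l * d + (exp l - 1 - l) * d\<close>. The first term completes
    \<open>mean B J\<close> to the new mean, the second is the share of this point in the
    variance.\<close>
  also have "\<dots> \<le> exp (l * mean B J + ?V (card J)) * exp (d * (exp l - 1))"
    using exp_ge_add_one_self by (intro mult_left_mono) auto
  also have "\<dots> = exp (l * mean B (insert j J) + ?V (card J) + (exp l - 1 - l) * d)"
    by (simp add: d_def algebra_simps flip: exp_add)
  also have "\<dots> \<le> exp (l * mean B (insert j J) + ?V (Suc (card J)))"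
    using d by (simp add: algebra_simps)
  finally show ?case using insert by (simp add: ennreal_leI)
qed

text \<open>Markov's inequality for the exponential moment. The sign of \<open>l\<close> is left
  open so that both tails follow; the event is first enlarged to the measurable set
  \<open>?S\<close>.\<close>

lemma prob_exp_le:
  fixes l c V :: real
  assumes e: "\<And>m. m > 0 \<Longrightarrow> mean {} {..<m} \<le> e m" and J: "finite J"
    and V: "(\<Sum>k=1..card J. e k / real k) \<le> V"
    and P: "\<And>x. P x \<Longrightarrow> l * c \<le> l * real (maxlen C (x ` J))"
  shows "emeasure (PiM J (\<lambda>_. M)) {x \<in> space (PiM J (\<lambda>_. M)). P x}
    \<le> ennreal (exp (l * mean {} J - l * c + (exp l - 1 - l) * V))"
proof -
  let ?f = "\<lambda>x. ennreal (exp (l * real (maxlen C (x ` J))))"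
  let ?S = "{x \<in> space (PiM J (\<lambda>_. M)). ennreal (exp (l * c)) \<le> ?f x}"
  have [measurable]: "(\<lambda>x. real (maxlen C (x ` J))) \<in> borel_measurable (PiM J (\<lambda>_. M))"
    using measurable_maxlen[of "{}" J] J by simp
  have phi: "0 \<le> exp l - 1 - l" using exp_ge_add_one_self[of l] by linarith
  have "emeasure (PiM J (\<lambda>_. M)) {x \<in> space (PiM J (\<lambda>_. M)). P x} \<le> emeasure (PiM J (\<lambda>_. M)) ?S"
    using P by (intro emeasure_mono) auto
  also have "\<dots> = (\<integral>\<^sup>+x. indicator ?S x \<partial>PiM J (\<lambda>_. M))" by simp
  also have "\<dots> \<le> (\<integral>\<^sup>+x. ennreal (exp (- l * c)) * ?f x \<partial>PiM J (\<lambda>_. M))"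
    by (intro nn_integral_mono)
       (auto simp: indicator_def simp flip: ennreal_mult exp_add)
  also have "\<dots> = ennreal (exp (- l * c)) * (\<integral>\<^sup>+x. ?f x \<partial>PiM J (\<lambda>_. M))"
    by (intro nn_integral_cmult) measurable
  also have "\<dots> \<le> ennreal (exp (- l * c)) *
      ennreal (exp (l * mean {} J + (exp l - 1 - l) * (\<Sum>k=1..card J. e k / real k)))"
    using exp_moment_le[OF e J, of "{}" l] by (intro mult_left_mono) auto
  also have "\<dots> = ennreal (exp (l * mean {} J - l * c + (exp l - 1 - l) * (\<Sum>k=1..card J. e k / real k)))"
    by (simp add: algebra_simps flip: ennreal_mult exp_add)
  also have "\<dots> \<le> ennreal (exp (l * mean {} J - l * c + (exp l - 1 - l) * V))"
    using mult_left_mono[OF V phi] by (intro ennreal_leI) simp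
  finally show ?thesis .
qed

end

lemma exp_le_cubic:
  fixes l :: real
  assumes "0 \<le> l" "l \<le> 1"
  shows "exp l - 1 - l \<le> l\<^sup>2 / 2 * (1 + l)"
proof -
  obtain t where t: "\<bar>t\<bar> \<le> \<bar>l\<bar>" "exp l = (\<Sum>m<3. l ^ m / fact m) + exp t / fact 3 * l ^ 3"
    using Maclaurin_exp_le[of l 3] by auto
  have "exp t \<le> exp 1" using t(1) assms by simp
  then have "exp t \<le> 3" using exp_le by linarith
  then have "exp t / fact 3 * l ^ 3 \<le> 3 / 6 * l ^ 3"
    using assms by (intro mult_right_mono) (auto simp: fact_numeral)
  then show ?thesis using t(2) by (simp add: eval_nat_numeral algebra_simps)
qed

lemma exp_neg_le_quadratic:
  fixes l :: real
  assumes "0 \<le> l"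
  shows "exp (- l) - 1 + l \<le> l\<^sup>2 / 2"
proof -
  obtain t where "exp (- l) = (\<Sum>m<3. (- l) ^ m / fact m) + exp t / fact 3 * (- l) ^ 3"
    using Maclaurin_exp_le[of "- l" 3] by auto
  moreover have "exp t * l ^ 3 \<ge> 0" using assms by simp
  ultimately show ?thesis by (simp add: eval_nat_numeral algebra_simps)
qed

context hereditary_sample
begin

lemma lower_tail:
  assumes e: "\<And>m. m > 0 \<Longrightarrow> mean {} {..<m} \<le> e m" and J: "finite J"
    and V: "(\<Sum>k=1..card J. e k / real k) \<le> V" and t: "0 \<le> t" "0 < V"
    and P: "\<And>x. P x \<Longrightarrow> real (maxlen C (x ` J)) \<le> mean {} J - t"
  shows "emeasure (PiM J (\<lambda>_. M)) {x \<in> space (PiM J (\<lambda>_. M)). P x}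
    \<le> ennreal (exp (- t\<^sup>2 / (2 * V)))"
proof -
  \<comment> \<open>The minimiser of \<open>- l * t + l^2 * V / 2\<close>, the exponent left by the
    quadratic bound.\<close>
  define l where "l = t / V"
  have l: "0 \<le> l" "l * V = t" using t by (auto simp: l_def)
  have "emeasure (PiM J (\<lambda>_. M)) {x \<in> space (PiM J (\<lambda>_. M)). P x}
    \<le> ennreal (exp (- l * mean {} J - - l * (mean {} J - t) + (exp (- l) - 1 - - l) * V))"
    using P l by (intro prob_exp_le[OF e J V]) (auto intro!: mult_left_mono)
  also have "\<dots> \<le> ennreal (exp (- t\<^sup>2 / (2 * V)))"
  proof -
    have "(exp (- l) - 1 + l) * V \<le> l\<^sup>2 / 2 * V"
      using exp_neg_le_quadratic[OF l(1)] t by (intro mult_right_mono) auto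
    also have "\<dots> = l * t / 2" using l(2) by (simp add: power2_eq_square flip: mult.assoc)
    finally have "- l * mean {} J - - l * (mean {} J - t) + (exp (- l) - 1 - - l) * V \<le> - (l * t / 2)"
      by (simp add: algebra_simps)
    also have "- (l * t / 2) = - t\<^sup>2 / (2 * V)" by (simp add: l_def power2_eq_square)
    finally show ?thesis by (intro ennreal_leI) simp
  qed
  finally show ?thesis .
qed

lemma upper_tail:
  assumes e: "\<And>m. m > 0 \<Longrightarrow> mean {} {..<m} \<le> e m" and J: "finite J"
    and V: "(\<Sum>k=1..card J. e k / real k) \<le> V" and t: "0 \<le> t" "t \<le> V" "0 < V"
    and P: "\<And>x. P x \<Longrightarrow> real (maxlen C (x ` J)) \<ge> c" and c: "mean {} J + t \<le> c"
  shows "emeasure (PiM J (\<lambda>_. M)) {x \<in> space (PiM J (\<lambda>_. M)). P x}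
    \<le> ennreal (exp (- t\<^sup>2 / (2 * V) * (1 - t / V)))"
proof -
  \<comment> \<open>The same choice as for the lower tail. The cubic term of the exponential costs
    the factor \<open>1 - t / V\<close> in the exponent; \<open>t \<le> V\<close> ensures
    \<open>l \<le> 1\<close>.\<close>
  define l where "l = t / V"
  have l: "0 \<le> l" "l \<le> 1" "l * V = t" using t by (auto simp: l_def)
  have "emeasure (PiM J (\<lambda>_. M)) {x \<in> space (PiM J (\<lambda>_. M)). P x}
    \<le> ennreal (exp (l * mean {} J - l * c + (exp l - 1 - l) * V))"
    using P l by (intro prob_exp_le[OF e J V]) (auto intro!: mult_left_mono)
  also have "\<dots> \<le> ennreal (exp (- t\<^sup>2 / (2 * V) * (1 - t / V)))"
  proof -
    have "(exp l - 1 - l) * V \<le> l\<^sup>2 / 2 * (1 + l) * V"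
      using exp_le_cubic[OF l(1,2)] t by (intro mult_right_mono) auto
    also have "\<dots> = l * t / 2 * (1 + l)" using l(3) by (simp add: power2_eq_square ac_simps)
    finally have "l * mean {} J - l * c + (exp l - 1 - l) * V \<le> l * (mean {} J - c) + l * t / 2 * (1 + l)"
      unfolding right_diff_distrib by linarith
    also have "l * (mean {} J - c) \<le> l * (- t)" using c l by (intro mult_left_mono) auto
    also have "l * (- t) + l * t / 2 * (1 + l) = - t\<^sup>2 / (2 * V) * (1 - t / V)"
      unfolding l_def using t(3) by (simp add: power2_eq_square divide_simps) (simp add: algebra_simps)
    finally show ?thesis by (intro ennreal_leI) simp
  qed
  finally show ?thesis .
qed

end

section \<open>Convex chains in dual form\<close>

text \<open>The level lines have slope \<open>- q\<close>. The values at \<open>p0\<close> and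
  \<open>p2\<close> are 1 and \<open>q\<close>, which explains the two bounds in
  \<open>cchain\<close>.\<close>

definition lin :: "real \<Rightarrow> real \<times> real \<Rightarrow> real" where
  "lin q z = q * fst z + snd z"

text \<open>The dual form of \<open>convex_chain\<close>: every point of \<open>S\<close> is strictly separated from the other
  points and from \<open>p0\<close>, \<open>p2\<close> by a line with negative slope.\<close>

definition cchain :: "(real \<times> real) set \<Rightarrow> bool" where
  "cchain S \<longleftrightarrow> S \<subseteq> T \<and>
     (\<forall>z\<in>S. \<exists>q>0. lin q z < 1 \<and> lin q z < q \<and> (\<forall>w\<in>S. w \<noteq> z \<longrightarrow> lin q z < lin q w))"

lemma cchain_empty: "cchain {}" by (simp add: cchain_def)

lemma cchain_subset: "cchain S \<Longrightarrow> R \<subseteq> S \<Longrightarrow> cchain R"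
  unfolding cchain_def by (meson subset_iff)

lemma cchainD:
  assumes "cchain S" "z \<in> S"
  shows "z \<in> T"
    and "\<exists>q>0. lin q z < 1 \<and> lin q z < q \<and> (\<forall>w\<in>S. w \<noteq> z \<longrightarrow> lin q z < lin q w)"
  using assms unfolding cchain_def by auto

lemma T_iff: "z \<in> T \<longleftrightarrow> 0 \<le> fst z \<and> 0 \<le> snd z \<and> fst z + snd z \<le> 1"
  by (cases z) (auto simp: T_eq)

text \<open>The functional is smaller at \<open>(x, y)\<close> than at \<open>p0\<close> and
  \<open>p2\<close>. If \<open>c \<le> 0\<close>, then \<open>d < 0\<close> too, and replacing
  \<open>1 - y\<close> by \<open>x\<close> and \<open>1 - x\<close> by \<open>y\<close> turns the
  two inequalities into \<open>c * x < d * x\<close> and \<open>d * y < c * y\<close>, which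
  contradict each other.\<close>

lemma separating_positive:
  fixes c d x y :: real
  assumes "c * x + d * y < d" "c * x + d * y < c" "0 \<le> x" "0 \<le> y" "x + y \<le> 1"
  shows "0 < c" "0 < d"
proof -
  have "c * x < d * (1 - y)" "d * y < c * (1 - x)" using assms by (auto simp: algebra_simps)
  show "0 < c"
  proof (rule ccontr)
    assume "\<not> 0 < c"
    then have c: "c \<le> 0" by simp
    have "c * (1 - x) \<le> 0" using c assms by (intro mult_nonpos_nonneg) auto
    then have "d * y < 0" using \<open>d * y < c * (1 - x)\<close> by linarith
    then have d: "d < 0" using assms by (meson mult_nonneg_nonneg not_le)
    have "d * (1 - y) \<le> d * x" "c * (1 - x) \<le> c * y"
      using c d assms by (auto intro!: mult_left_mono_neg)
    then have "c * x < d * x" "d * y < c * y"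
      using \<open>c * x < d * (1 - y)\<close> \<open>d * y < c * (1 - x)\<close> by linarith+
    then show False using assms by (auto simp: mult_less_cancel_right)
  qed
  show "0 < d"
  proof (rule ccontr)
    assume "\<not> 0 < d"
    then have "d * (1 - y) \<le> 0" using assms by (intro mult_nonpos_nonneg) auto
    moreover have "0 \<le> c * x" using \<open>0 < c\<close> assms by simp
    ultimately show False using \<open>c * x < d * (1 - y)\<close> by linarith
  qed
qed

lemma cchain_image_swap: "cchain (prod.swap ` S) \<longleftrightarrow> cchain S"
proof -
  have *: "cchain (prod.swap ` S)" if S: "cchain S" for S
    unfolding cchain_def
  proof (intro conjI ballI subsetI)
    fix z assume "z \<in> prod.swap ` S"
    then show "z \<in> T" using cchainD(1)[OF S] by (auto simp: T_iff add.commute)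
  next
    fix z assume "z \<in> prod.swap ` S"
    then obtain v where v: "v \<in> S" "z = prod.swap v" by auto
    obtain q where q: "q > 0" "lin q v < 1" "lin q v < q"
      "\<And>w. w \<in> S \<Longrightarrow> w \<noteq> v \<Longrightarrow> lin q v < lin q w"
      using cchainD(2)[OF S v(1)] by blast
    have eq: "lin (1 / q) (prod.swap w) = lin q w / q" for w
      using q(1) by (auto simp: lin_def field_simps)
    show "\<exists>q>0. lin q z < 1 \<and> lin q z < q \<and> (\<forall>w\<in>prod.swap ` S. w \<noteq> z \<longrightarrow> lin q z < lin q w)"
    proof (intro exI[of _ "1 / q"] conjI ballI impI)
      fix w assume "w \<in> prod.swap ` S" "w \<noteq> z"
      then obtain w' where "w = prod.swap w'" "w' \<in> S" "w' \<noteq> v" using v by auto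
      then have "lin q v / q < lin q w' / q" using q by (intro divide_strict_right_mono) auto
      then show "lin (1 / q) z < lin (1 / q) w"
        by (simp only: eq v(2) \<open>w = prod.swap w'\<close>)
    qed (use q v(2) in \<open>auto simp only: eq divide_less_eq_1 zero_less_divide_1_iff intro!: divide_strict_right_mono\<close>)
  qed
  have "prod.swap ` prod.swap ` S = S" by (auto simp: image_image)
  then show ?thesis using *[of S] *[of "prod.swap ` S"] by auto
qed

text \<open>An extreme point is strictly separated from the hull of the other points. Separation
  from \<open>p0\<close> and \<open>p2\<close> forces positive coefficients, so the functional can
  be normalised to some \<open>lin q\<close>. Conversely, an open half-plane that contains all other
  points but not \<open>v\<close> keeps \<open>v\<close> out of their hull.\<close>

lemma convex_chain_iff: "convex_chain Y \<longleftrightarrow> finite Y \<and> cchain Y"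
proof (cases "finite Y \<and> Y \<subseteq> T")
  case False
  then show ?thesis by (auto simp: convex_chain_def cchain_def)
next
  case True
  then have fin: "finite Y" and YT: "Y \<subseteq> T" by auto
  define S where "S = Y \<union> {p0, p2}"
  have fS: "finite S" using fin by (simp add: S_def)
  have ST: "S \<subseteq> T" using YT by (auto simp: S_def p0_def p2_def T_iff)
  have ex_sub: "{v. v extreme_point_of chain_hull Y} \<subseteq> S"
    using extreme_points_of_convex_hull[of S] by (auto simp: chain_hull_def S_def)
  have p02: "p0 \<noteq> p2" by (simp add: p0_def p2_def)
  show ?thesis
  proof
    assume Y: "convex_chain Y"
    then have card: "card {v. v extreme_point_of chain_hull Y} = card Y + 2"
      by (simp add: convex_chain_def)
    have "card S \<le> card Y + 2"
      using card_Un_le[of Y "{p0, p2}"] p02 by (simp add: S_def)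
    \<comment> \<open>There are at most \<open>card Y + 2\<close> candidates, so all of them are
      extreme; the count also forces \<open>p0\<close> and \<open>p2\<close> to lie outside
      \<open>Y\<close>.\<close>
    then have ex: "{v. v extreme_point_of chain_hull Y} = S"
      using ex_sub fS card card_seteq by metis
    then have cS: "card S = card Y + 2" using card by simp
    have notin: "p0 \<notin> Y" "p2 \<notin> Y"
    proof -
      show "p0 \<notin> Y"
      proof
        assume "p0 \<in> Y"
        then have "S = insert p2 Y" by (auto simp: S_def)
        then show False using cS fin by (simp add: card_insert_if split: if_splits)
      qed
      show "p2 \<notin> Y"
      proof
        assume "p2 \<in> Y"
        then have "S = insert p0 Y" by (auto simp: S_def)
        then show False using cS fin by (simp add: card_insert_if split: if_splits)
      qed
    qed
    have "\<exists>q>0. lin q z < 1 \<and> lin q z < q \<and> (\<forall>w\<in>Y. w \<noteq> z \<longrightarrow> lin q z < lin q w)" if z: "z \<in> Y" for z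
    proof -
      have zT: "z \<in> T" using z YT by auto
      have "z \<notin> convex hull (S - {z})"
      proof
        assume "z \<in> convex hull (S - {z})"
        then have "convex hull (insert z (S - {z})) = convex hull (S - {z})"
          by (rule hull_redundant)
        then have "chain_hull Y = convex hull (S - {z})"
          using z by (simp add: chain_hull_def S_def insert_absorb)
        moreover have "z extreme_point_of chain_hull Y" using ex z by (auto simp: S_def)
        ultimately show False using extreme_points_of_convex_hull[of "S - {z}"] by auto
      qed
      then obtain c b where c: "c \<bullet> z < b" "\<forall>w\<in>convex hull (S - {z}). c \<bullet> w > b"
        using separating_hyperplane_closed_point[of "convex hull (S - {z})" z] fS
        by (meson compact_convex_hull compact_imp_closed convex_convex_hull finite_Diff finite_imp_compact)
      have lt: "c \<bullet> z < c \<bullet> w" if "w \<in> S" "w \<noteq> z" for w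
        using c that hull_inc[of w "S - {z}"] by force
      obtain c1 c2 where c12: "c = (c1, c2)" by (cases c)
      have p: "c1 * fst z + c2 * snd z < c2" "c1 * fst z + c2 * snd z < c1"
        using lt[of p0] lt[of p2] notin z by (auto simp: S_def p0_def p2_def c12 inner_prod_def)
      have pos: "0 < c1" "0 < c2"
        using separating_positive[OF p] zT by (auto simp: T_iff)
      have eq: "lin (c1 / c2) w = (c \<bullet> w) / c2" for w
        using pos by (simp add: lin_def c12 inner_prod_def field_simps)
      show ?thesis
        using pos p lt
        by (intro exI[of _ "c1 / c2"])
           (auto simp: eq S_def c12 inner_prod_def divide_less_eq_1 intro!: divide_strict_right_mono)
    qed
    then show "finite Y \<and> cchain Y" using fin YT by (auto simp: cchain_def)
  next
    assume Y: "finite Y \<and> cchain Y"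
    have notin: "p0 \<notin> Y" "p2 \<notin> Y"
      using cchainD(2)[of Y p0] cchainD(2)[of Y p2] Y by (auto simp: p0_def p2_def lin_def)
    have "v extreme_point_of chain_hull Y" if v: "v \<in> S" for v
    proof -
      have "v \<notin> convex hull (S - {v})"
      proof -
        consider "v = p0" | "v = p2" | "v \<in> Y" using v by (auto simp: S_def)
        then show ?thesis
        proof cases
          case 1
          have "S - {v} \<subseteq> {w. (0, 1) \<bullet> w < 1}"
            using ST 1 by (fastforce simp: T_iff p0_def inner_prod_def)
          then have "convex hull (S - {v}) \<subseteq> {w. (0, 1) \<bullet> w < 1}"
            by (intro hull_minimal convex_halfspace_lt)
          then show ?thesis using 1 by (auto simp: p0_def)
        next
          case 2
          have "S - {v} \<subseteq> {w. (1, 0) \<bullet> w < 1}"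
            using ST 2 by (fastforce simp: T_iff p2_def inner_prod_def)
          then have "convex hull (S - {v}) \<subseteq> {w. (1, 0) \<bullet> w < 1}"
            by (intro hull_minimal convex_halfspace_lt)
          then show ?thesis using 2 by (auto simp: p2_def)
        next
          case 3
          obtain q where q: "q > 0" "lin q v < 1" "lin q v < q"
            "\<And>w. w \<in> Y \<Longrightarrow> w \<noteq> v \<Longrightarrow> lin q v < lin q w"
            using cchainD(2)[of Y v] Y 3 by blast
          have lin: "lin q w = (q, 1) \<bullet> w" for w by (simp add: lin_def inner_prod_def)
          have "S - {v} \<subseteq> {w. (q, 1) \<bullet> w > lin q v}"
            using q by (auto simp: S_def lin[symmetric]) (auto simp: p0_def p2_def lin_def)
          then have "convex hull (S - {v}) \<subseteq> {w. (q, 1) \<bullet> w > lin q v}"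
            by (intro hull_minimal convex_halfspace_gt)
          then show ?thesis by (auto simp: lin)
        qed
      qed
      then have "v extreme_point_of convex hull (insert v (S - {v}))"
        using fS by (intro extreme_point_of_convex_hull_insert) auto
      then show ?thesis using v by (simp add: chain_hull_def S_def insert_absorb)
    qed
    then have "{v. v extreme_point_of chain_hull Y} = S" using ex_sub by auto
    moreover have "card S = card Y + 2"
      using notin fin p02 by (simp add: S_def)
    ultimately show "convex_chain Y" using fin YT by (simp add: convex_chain_def)
  qed
qed

text \<open>The inverse of the affine map that sends \<open>p0, p1, p2\<close> to \<open>p0, (0, a), r\<close>; if that triangle is
  degenerate, a constant map that avoids \<open>T\<close>.\<close>

definition lower :: "real \<Rightarrow> real \<times> real \<Rightarrow> real \<times> real \<Rightarrow> real \<times> real" where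
  "lower a r z = (if fst r = 0 then (2, 2)
     else (fst z / fst r, (snd z - a - fst z / fst r * (snd r - a)) / (1 - a)))"

definition upper :: "real \<Rightarrow> real \<times> real \<Rightarrow> real \<times> real \<Rightarrow> real \<times> real" where
  "upper b r z = prod.swap (lower b (prod.swap r) (prod.swap z))"

text \<open>Shifted to vanish at the corner \<open>(0, a)\<close> and scaled to equal 1 at
  \<open>p0\<close>, the functional is again some \<open>lin\<close> in the new coordinates, and its
  new slope parameter is its value at the corner \<open>r\<close>.\<close>

lemma lin_lower:
  assumes "fst r \<noteq> 0" "a \<noteq> 1"
  shows "lin ((lin q r - a) / (1 - a)) (lower a r z) = (lin q z - a) / (1 - a)"
proof -
  define c where "c = fst z / fst r"
  have "fst z = c * fst r" using assms by (simp add: c_def)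
  then have "(lin q r - a) * c + (snd z - a - c * (snd r - a)) = lin q z - a"
    by (simp add: lin_def algebra_simps)
  then show ?thesis
    using assms by (simp add: lin_def lower_def flip: c_def add_divide_distrib)
qed

lemma inj_lower: "fst r \<noteq> 0 \<Longrightarrow> a \<noteq> 1 \<Longrightarrow> inj (lower a r)"
  by (rule injI) (auto simp: lower_def prod_eq_iff)

lemma cchain_upper_image:
  "cchain (upper b r ` S) \<longleftrightarrow> cchain (lower b (prod.swap r) ` prod.swap ` S)"
proof -
  have "upper b r ` S = prod.swap ` lower b (prod.swap r) ` prod.swap ` S"
    by (simp add: upper_def image_image)
  then show ?thesis by (simp only: cchain_image_swap)
qed

text \<open>The tangent of the parabola at \<open>(s^2, (1 - s)^2)\<close> meets the axes in
  \<open>(0, 1 - s)\<close> and \<open>(s, 0)\<close>. A functional that separates in the left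
  triangle pulls back to one whose minimum over the right triangle is attained at the common corner,
  and \<open>z\<close> lies strictly below that value. Admitting \<open>w = z\<close> for
  \<open>z \<in> S2\<close> makes the lemma yield disjointness as well.\<close>

lemma join_aux:
  assumes s: "0 < s" "s < 1"
    and S1: "cchain (lower (1 - s) (s\<^sup>2, (1 - s)\<^sup>2) ` S1)" and z: "z \<in> S1"
    and S2: "\<And>w. w \<in> S2 \<Longrightarrow> lower s ((1 - s)\<^sup>2, s\<^sup>2) (prod.swap w) \<in> T"
  shows "z \<in> T" "\<exists>q>0. lin q z < 1 \<and> lin q z < q \<and> (\<forall>w\<in>S1 \<union> S2. w \<noteq> z \<or> w \<in> S2 \<longrightarrow> lin q z < lin q w)"
proof -
  let ?L = "lower (1 - s) (s\<^sup>2, (1 - s)\<^sup>2)"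
  have inj: "inj ?L" using s by (intro inj_lower) auto
  have zT: "?L z \<in> T" using cchainD(1)[OF S1] z by auto
  obtain x y where hat: "?L z = (x, y)" by (cases "?L z")
  have "x = fst z / s\<^sup>2" "y = (snd z - (1 - s) - x * ((1 - s)\<^sup>2 - (1 - s))) / s"
    using hat s by (auto simp: lower_def)
  then have zx: "fst z = s\<^sup>2 * x" and zy: "snd z = (1 - s) * (1 - s * x) + s * y"
    using s by (auto simp: field_simps power2_eq_square)
  have xy: "0 \<le> x" "0 \<le> y" "x + y \<le> 1" using zT hat by (auto simp: T_iff)
  have sx: "s * x \<le> 1" using s xy by (simp add: mult_le_one)
  show "z \<in> T"
  proof -
    have "fst z + snd z = 1 - s * (1 - y - (2 * s - 1) * x)"
      by (simp add: zx zy power2_eq_square algebra_simps)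
    moreover have "(2 * s - 1) * x \<le> 1 * x" using s xy by (intro mult_right_mono) auto
    then have "0 \<le> s * (1 - y - (2 * s - 1) * x)" using s xy by (intro mult_nonneg_nonneg) auto
    ultimately show ?thesis using s xy sx by (auto simp: T_iff zx zy)
  qed
  obtain q' where q': "q' > 0" "lin q' (?L z) < 1" "lin q' (?L z) < q'"
    "\<And>w. w \<in> ?L ` S1 \<Longrightarrow> w \<noteq> ?L z \<Longrightarrow> lin q' (?L z) < lin q' w"
    using cchainD(2)[OF S1, of "?L z"] z by blast
  \<comment> \<open>Solves \<open>q' = (lin q r - (1 - s)) / s\<close> at
    \<open>r = (s^2, (1 - s)^2)\<close>, the change of slope in \<open>lin_lower\<close>.\<close>
  define q where "q = (q' + (1 - s)) / s"
  have q: "q > 0" using q' s by (simp add: q_def)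
  have lin: "lin q w = s * lin q' (?L w) + (1 - s)" for w
    using s by (simp add: lin_def lower_def q_def power2_eq_square field_simps)
  have z_lt: "lin q z < s * q' + (1 - s)" using q'(3) s by (simp add: lin)
  have "s * s * q' \<le> 1 * q'" "s * (1 - s) \<le> 1 * (1 - s)"
    using s q'(1) by (intro mult_right_mono mult_le_one; simp)+
  then have "s * (s * q' + (1 - s)) \<le> q' + (1 - s)" by (simp add: distrib_left mult.assoc)
  then have "s * q' + (1 - s) \<le> q" using s by (simp add: q_def field_simps)
  then have z_lt_q: "lin q z < q" using z_lt by linarith
  have z_lt_1: "lin q z < 1"
    using mult_strict_left_mono[OF q'(2) s(1)] by (simp add: lin)
  have z_lt_S2: "lin q z < lin q w" if w: "w \<in> S2" for w
  proof -
    obtain a b where ab: "w = (a, b)" by (cases w)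
    have "b \<ge> 0" and T: "0 \<le> (a - s - b / (1 - s)\<^sup>2 * (s\<^sup>2 - s)) / (1 - s)"
        "b / (1 - s)\<^sup>2 + (a - s - b / (1 - s)\<^sup>2 * (s\<^sup>2 - s)) / (1 - s) \<le> 1"
      using S2[OF w] s by (auto simp: T_iff lower_def ab zero_le_divide_iff)
    have e: "b / (1 - s)\<^sup>2 * (s\<^sup>2 - s) = - (b * s / (1 - s))"
      using s by (simp add: divide_simps power2_eq_square) (simp add: algebra_simps)
    have a: "a \<ge> s - b * s / (1 - s)"
      using T(1) s unfolding e by (simp add: zero_le_divide_iff)
    have "b / (1 - s)\<^sup>2 \<le> 1" using T by linarith
    then have b: "b \<le> (1 - s)\<^sup>2" using s by (simp add: field_simps)
    \<comment> \<open>The left side is the value of \<open>lin q\<close> at the common corner. Along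
      the tangent the functional decreases with the height \<open>b\<close>, so among heights up to
      \<open>(1 - s)^2\<close> the corner has the least value.\<close>
    have "s * q' + (1 - s) = q' + (1 - s) - q' / (1 - s) * (1 - s)\<^sup>2"
    proof -
      have "q' / (1 - s) * (1 - s)\<^sup>2 = q' * (1 - s)" using s by (simp add: power2_eq_square)
      then show ?thesis by (simp add: algebra_simps)
    qed
    also have "\<dots> \<le> q' + (1 - s) - q' / (1 - s) * b"
      using b q'(1) s by (intro diff_left_mono mult_left_mono) auto
    also have "\<dots> = q * (s - b * s / (1 - s)) + b"
    proof -
      define t where "t = b / (1 - s)"
      have t: "b = t * (1 - s)" "b * s / (1 - s) = s * t" "q' / (1 - s) * b = q' * t" "q * s = q' + (1 - s)"
        using s by (auto simp: t_def q_def)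
      have "q * (s - s * t) = (q * s) * (1 - t)" by (simp add: right_diff_distrib)
      also have "\<dots> = (q' + (1 - s)) * (1 - t)" by (simp only: t(4))
      finally show ?thesis unfolding t(2,3) using t(1) by (simp add: algebra_simps)
    qed
    also have "\<dots> \<le> q * a + b" using a q by (intro add_right_mono mult_left_mono) auto
    also have "\<dots> = lin q w" by (simp add: lin_def ab)
    finally show ?thesis using z_lt by linarith
  qed
  have z_lt_S1: "lin q z < lin q w" if w: "w \<in> S1" "w \<noteq> z" for w
    using q'(4)[of "?L w"] w inj s by (auto simp: lin inj_eq)
  show "\<exists>q>0. lin q z < 1 \<and> lin q z < q \<and> (\<forall>w\<in>S1 \<union> S2. w \<noteq> z \<or> w \<in> S2 \<longrightarrow> lin q z < lin q w)"
    using q z_lt_1 z_lt_q z_lt_S1 z_lt_S2 by blast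
qed

text \<open>The points of \<open>S2\<close> are treated by exchanging the coordinates, which swaps
  the two triangles and replaces \<open>s\<close> by \<open>1 - s\<close>.\<close>

lemma join:
  assumes s: "0 < s" "s < 1"
    and S1: "cchain (lower (1 - s) (s\<^sup>2, (1 - s)\<^sup>2) ` S1)"
    and S2: "cchain (upper s (s\<^sup>2, (1 - s)\<^sup>2) ` S2)"
  shows "cchain (S1 \<union> S2)" "S1 \<inter> S2 = {}"
proof -
  have S2': "cchain (lower s ((1 - s)\<^sup>2, s\<^sup>2) ` prod.swap ` S2)"
    using S2 by (simp add: cchain_upper_image)
  have T2: "lower s ((1 - s)\<^sup>2, s\<^sup>2) (prod.swap w) \<in> T" if "w \<in> S2" for w
    using cchainD(1)[OF S2'] that by auto
  have T1: "lower (1 - s) (s\<^sup>2, (1 - s)\<^sup>2) w \<in> T" if "w \<in> S1" for w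
    using cchainD(1)[OF S1] that by auto
  show "S1 \<inter> S2 = {}"
  proof (rule ccontr)
    assume "S1 \<inter> S2 \<noteq> {}"
    then obtain z where z: "z \<in> S1" "z \<in> S2" by blast
    from join_aux(2)[OF s S1 z(1) T2] z have "\<exists>q. lin q z < lin q z" by blast
    then show False by simp
  qed
  have 1: "z \<in> T" "\<exists>q>0. lin q z < 1 \<and> lin q z < q \<and> (\<forall>w\<in>S1 \<union> S2. w \<noteq> z \<longrightarrow> lin q z < lin q w)"
    if zS: "z \<in> S1" for z
  proof -
    show "z \<in> T" by (rule join_aux(1)[OF s S1 zS T2])
    obtain q where "q > 0" "lin q z < 1" "lin q z < q"
      "\<forall>w\<in>S1 \<union> S2. w \<noteq> z \<or> w \<in> S2 \<longrightarrow> lin q z < lin q w"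
      using join_aux(2)[OF s S1 zS T2] by blast
    then show "\<exists>q>0. lin q z < 1 \<and> lin q z < q \<and> (\<forall>w\<in>S1 \<union> S2. w \<noteq> z \<longrightarrow> lin q z < lin q w)"
      by (intro exI[of _ q]) simp
  qed
  have s': "0 < 1 - s" "1 - s < 1" using s by auto
  have 2: "prod.swap z \<in> T" "\<exists>q>0. lin q (prod.swap z) < 1 \<and> lin q (prod.swap z) < q \<and>
      (\<forall>w\<in>prod.swap ` S2 \<union> prod.swap ` S1. w \<noteq> prod.swap z \<longrightarrow> lin q (prod.swap z) < lin q w)"
    if "z \<in> S2" for z
  proof -
    have A: "cchain (lower (1 - (1 - s)) ((1 - s)\<^sup>2, (1 - (1 - s))\<^sup>2) ` prod.swap ` S2)"
      using S2' by simp
    have B: "prod.swap z \<in> prod.swap ` S2" using that by simp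
    have C: "lower (1 - s) ((1 - (1 - s))\<^sup>2, (1 - s)\<^sup>2) (prod.swap w) \<in> T" if "w \<in> prod.swap ` S1" for w
      using T1 that by auto
    show "prod.swap z \<in> T" by (rule join_aux(1)[OF s' A B C])
    obtain q where "q > 0" "lin q (prod.swap z) < 1" "lin q (prod.swap z) < q"
      "\<forall>w\<in>prod.swap ` S2 \<union> prod.swap ` S1. w \<noteq> prod.swap z \<or> w \<in> prod.swap ` S1 \<longrightarrow>
        lin q (prod.swap z) < lin q w"
      using join_aux(2)[OF s' A B C] by blast
    then show "\<exists>q>0. lin q (prod.swap z) < 1 \<and> lin q (prod.swap z) < q \<and>
      (\<forall>w\<in>prod.swap ` S2 \<union> prod.swap ` S1. w \<noteq> prod.swap z \<longrightarrow> lin q (prod.swap z) < lin q w)"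
      by (intro exI[of _ q]) simp
  qed
  have 3: "\<exists>q>0. lin q z < 1 \<and> lin q z < q \<and> (\<forall>w\<in>S1 \<union> S2. w \<noteq> z \<longrightarrow> lin q z < lin q w)"
    if z: "z \<in> S2" for z
  proof -
    obtain q where q: "q > 0" "lin q (prod.swap z) < 1" "lin q (prod.swap z) < q"
      "\<And>w. w \<in> S1 \<union> S2 \<Longrightarrow> w \<noteq> z \<Longrightarrow> lin q (prod.swap z) < lin q (prod.swap w)"
    proof -
      from 2(2)[OF z] obtain q where q: "q > 0" "lin q (prod.swap z) < 1" "lin q (prod.swap z) < q"
        "\<forall>w\<in>prod.swap ` S2 \<union> prod.swap ` S1. w \<noteq> prod.swap z \<longrightarrow> lin q (prod.swap z) < lin q w"
        by blast
      have "lin q (prod.swap z) < lin q (prod.swap w)" if "w \<in> S1 \<union> S2" "w \<noteq> z" for w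
        using q(4) that by (metis Un_iff image_eqI swap_swap)
      then show ?thesis using that q by blast
    qed
    have eq: "lin (1 / q) w = lin q (prod.swap w) / q" for w
      using q(1) by (auto simp: lin_def field_simps)
    show ?thesis
      using q by (intro exI[of _ "1 / q"])
        (auto simp only: eq divide_less_eq_1 zero_less_divide_1_iff intro!: divide_strict_right_mono)
  qed
  have "prod.swap z \<in> T \<longleftrightarrow> z \<in> T" for z by (auto simp: T_iff add.commute)
  then show "cchain (S1 \<union> S2)"
    using 1 2(1) 3 unfolding cchain_def by (intro conjI subsetI ballI) (elim UnE; simp)+
qed

text \<open>The line \<open>u * x + v * y = m\<close> supports the chain from below and touches it
  at \<open>r\<close>. Its intercept is \<open>m / v\<close>; a smaller \<open>a\<close> is allowed
  because intercepts will be rounded down. The functionals that separate the points of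
  \<open>Y\<close> keep doing so in the new coordinates, with \<open>lin q z < lin q r\<close> as
  the condition at the corner that becomes \<open>p2\<close>.\<close>

lemma cchain_lower_part:
  assumes Y: "cchain Y" and uv: "0 < u" "0 < v"
    and r: "r \<in> Y \<union> {p0, p2}" "m = u * fst r + v * snd r"
    and m: "\<And>z. z \<in> Y \<Longrightarrow> m \<le> u * fst z + v * snd z"
    and a: "a \<le> m / v" "a < 1"
  shows "cchain (lower a r ` {z \<in> Y - {r}. fst z \<le> fst r})"
proof -
  let ?S = "{z \<in> Y - {r}. fst z \<le> fst r}"
  have "p0 \<in> T" "p2 \<in> T" by (auto simp: T_iff p0_def p2_def)
  then have rT: "r \<in> T" using r(1) cchainD(1)[OF Y] by blast
  have sep: "\<exists>q>0. lin q z < 1 \<and> lin q z < lin q r \<and> (\<forall>w\<in>Y. w \<noteq> z \<longrightarrow> lin q z < lin q w)"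
    if z: "z \<in> ?S" for z
  proof -
    obtain q where q: "q > 0" "lin q z < 1" "lin q z < q" "\<And>w. w \<in> Y \<Longrightarrow> w \<noteq> z \<Longrightarrow> lin q z < lin q w"
      using cchainD(2)[OF Y] z by blast
    have "lin q z < lin q r" using r(1) q z by (auto simp: lin_def p0_def p2_def)
    then show ?thesis using q by blast
  qed
  have above: "m / v - u / v * fst z \<le> snd z" if "z \<in> ?S" for z
    using m[of z] that uv by (simp add: field_simps)
  have r_on: "snd r = m / v - u / v * fst r" using r(2) uv by (simp add: field_simps)
  show ?thesis
  proof (cases "fst r = 0")
    case True
    \<comment> \<open>A chain point below \<open>r\<close> on the axis would lie below the
      supporting line.\<close>
    have "?S = {}"
    proof (rule ccontr)
      assume "?S \<noteq> {}"
      then obtain z where z: "z \<in> ?S" by blast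
      have "fst z = 0" using z True cchainD(1)[OF Y, of z] by (auto simp: T_iff)
      moreover obtain q where "lin q z < lin q r" using sep[OF z] by blast
      ultimately show False using above[OF z] r_on True by (simp add: lin_def)
    qed
    then show ?thesis by (simp only: image_empty cchain_empty)
  next
    case False
    then have x: "fst r > 0" using rT by (auto simp: T_iff)
    have *: "lower a r z \<in> T \<and> (\<exists>q>0. lin q (lower a r z) < 1 \<and> lin q (lower a r z) < q \<and>
      (\<forall>w\<in>lower a r ` ?S. w \<noteq> lower a r z \<longrightarrow> lin q (lower a r z) < lin q w))" if z: "z \<in> ?S" for z
    proof -
      obtain q where q: "q > 0" "lin q z < 1" "lin q z < lin q r" "\<And>w. w \<in> Y \<Longrightarrow> w \<noteq> z \<Longrightarrow> lin q z < lin q w"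
        using sep[OF z] by blast
      define c where "c = fst z / fst r"
      define d where "d = (snd z - a - c * (snd r - a)) / (1 - a)"
      have hat: "lower a r z = (c, d)" using False by (simp add: lower_def c_def d_def)
      have c: "0 \<le> c" "c \<le> 1" using z x cchainD(1)[OF Y, of z] by (auto simp: c_def T_iff)
      have "c * snd r + (1 - c) * a \<le> c * snd r + (1 - c) * (m / v)"
        using a c by (intro add_left_mono mult_left_mono) auto
      also have "\<dots> = m / v - u / v * fst z"
        using x uv by (simp add: c_def r_on field_simps)
      also have "\<dots> \<le> snd z" by (rule above[OF z])
      finally have d: "0 \<le> d" using a by (simp add: d_def algebra_simps)
      \<comment> \<open>\<open>c\<close> and \<open>d\<close> are the barycentric weights of
        \<open>z\<close> at the corners \<open>r\<close> and \<open>p0\<close>; the values of the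
        functional at \<open>r\<close>, \<open>p0\<close> and \<open>(0, a)\<close> are
        \<open>lin q r\<close>, 1 and \<open>a\<close>.\<close>
      have linz: "lin q z = a + c * (lin q r - a) + d * (1 - a)"
        using x a by (simp add: lin_def c_def d_def field_simps)
      \<comment> \<open>Otherwise \<open>r\<close> has the least value of the three corners, and
        \<open>c \<le> 1\<close>, \<open>0 \<le> d\<close> give
        \<open>lin q r \<le> lin q z\<close>.\<close>
      have P: "0 < lin q r - a"
      proof (rule ccontr)
        define X where "X = c * (lin q r - a)"
        assume "\<not> ?thesis"
        then have "lin q r - a \<le> X"
          using mult_right_mono_neg[of c 1 "lin q r - a"] c by (simp add: X_def)
        moreover have "0 \<le> d * (1 - a)" using d a by simp
        moreover have "lin q z = a + X + d * (1 - a)" using linz by (simp add: X_def)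
        ultimately show False using q(3) by linarith
      qed
      \<comment> \<open>Beyond the edge from \<open>p0\<close> to \<open>r\<close> the functional is
        at least the average of 1 and \<open>lin q r\<close> with weights \<open>1 - c\<close> and
        \<open>c\<close>, but both of these exceed \<open>lin q z\<close>.\<close>
      have "c + d \<le> 1"
      proof (rule ccontr)
        assume "\<not> ?thesis"
        then have "(1 - c) * (1 - a) \<le> d * (1 - a)" using a by (intro mult_right_mono) auto
        then have "lin q z \<ge> c * lin q r + (1 - c) * 1"
          unfolding linz by (simp add: algebra_simps)
        moreover have "c * lin q z + (1 - c) * lin q z < c * lin q r + (1 - c) * 1"
        proof (cases "c = 0")
          case False
          then show ?thesis using q c by (intro add_less_le_mono mult_strict_left_mono mult_left_mono) auto
        qed (use q in auto)
        ultimately show False by (simp add: algebra_simps)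
      qed
      then have hatT: "lower a r z \<in> T" using c d by (simp add: hat T_iff)
      have lt: "(lin q z - a) / (1 - a) < (t - a) / (1 - a)" if "lin q z < t" for t
        using that a by (intro divide_strict_right_mono) auto
      have "lin q z < lin q w" if "w \<in> ?S" "lower a r w \<noteq> lower a r z" for w
        using q(4)[of w] that by auto
      moreover have "(1 - a) / (1 - a) = 1" using a by simp
      ultimately show ?thesis
        using P a q hatT lt[of 1] lt[of "lin q r"] False
        by (intro conjI exI[of _ "(lin q r - a) / (1 - a)"])
           (auto simp: lin_lower intro!: lt simp del: divide_self_if)
    qed
    then show ?thesis unfolding cchain_def by blast
  qed
qed

lemma cchain_upper_part:
  assumes Y: "cchain Y" and uv: "0 < u" "0 < v"
    and r: "r \<in> Y \<union> {p0, p2}" "m = u * fst r + v * snd r"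
    and m: "\<And>z. z \<in> Y \<Longrightarrow> m \<le> u * fst z + v * snd z"
    and b: "b \<le> m / u" "b < 1"
  shows "cchain (upper b r ` {z \<in> Y - {r}. \<not> fst z \<le> fst r})"
proof -
  have "cchain (lower b (prod.swap r) ` {z \<in> prod.swap ` Y - {prod.swap r}. fst z \<le> fst (prod.swap r)})"
    using r m uv b Y
    by (intro cchain_lower_part[of _ v u _ m]) (auto simp: cchain_image_swap p0_def p2_def algebra_simps image_iff)
  \<comment> \<open>A chain point to the right of \<open>r\<close> is not higher than
    \<open>r\<close>, so the mirrored lemma covers all of them.\<close>
  moreover have "snd z \<le> snd r" if z: "z \<in> Y - {r}" "\<not> fst z \<le> fst r" for z
  proof -
    obtain q where q: "q > 0" "lin q z < 1" "lin q z < q" "\<And>w. w \<in> Y \<Longrightarrow> w \<noteq> z \<Longrightarrow> lin q z < lin q w"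
      using cchainD(2)[OF Y] z by blast
    have "lin q z < lin q r" using r(1) q z by (auto simp: lin_def p0_def p2_def)
    moreover have "q * fst r \<le> q * fst z" using z q(1) by (intro mult_left_mono) auto
    ultimately show ?thesis by (simp add: lin_def)
  qed
  then have "prod.swap ` {z \<in> Y - {r}. \<not> fst z \<le> fst r} \<subseteq>
      {z \<in> prod.swap ` Y - {prod.swap r}. fst z \<le> fst (prod.swap r)}"
    by (fastforce simp: prod_eq_iff)
  ultimately show ?thesis
    unfolding cchain_upper_image by (rule cchain_subset[OF _ image_mono])
qed

section \<open>Measurability and affine maps\<close>

text \<open>Reaching length \<open>k\<close> is a finite union over index sets of size
  \<open>k\<close>; heredity permits exactly \<open>k\<close> points in place of at least
  \<open>k\<close>. The property may vary with \<open>\<omega>\<close> because the contact point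
  will be a random point of the sample.\<close>

lemma measurable_maxlen_general:
  fixes f :: "'i \<Rightarrow> 'w \<Rightarrow> 'a::{second_countable_topology, t2_space}"
  assumes her: "\<And>\<omega>. hereditary (C \<omega>)" and fin: "finite I"
    and f: "\<And>i. i \<in> I \<Longrightarrow> f i \<in> borel_measurable N"
    and C: "\<And>K. K \<subseteq> I \<Longrightarrow> Measurable.pred N (\<lambda>\<omega>. C \<omega> ((\<lambda>i. f i \<omega>) ` K))"
  shows "(\<lambda>\<omega>. real (maxlen (C \<omega>) ((\<lambda>i. f i \<omega>) ` I))) \<in> borel_measurable N"
proof -
  have ge: "k \<le> maxlen (C \<omega>) ((\<lambda>i. f i \<omega>) ` I) \<longleftrightarrow>
      (\<exists>K\<in>{K. K \<subseteq> I \<and> card K = k}. inj_on (\<lambda>i. f i \<omega>) K \<and> C \<omega> ((\<lambda>i. f i \<omega>) ` K))" for k \<omega>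
  proof -
    interpret hereditary "C \<omega>" by (rule her)
    let ?X = "(\<lambda>i. f i \<omega>) ` I"
    have fX: "finite ?X" using fin by simp
    show ?thesis
    proof
      assume k: "k \<le> maxlen (C \<omega>) ?X"
      obtain S where S: "S \<subseteq> ?X" "C \<omega> S" "card S = maxlen (C \<omega>) ?X"
        using maxlen_attained[OF fX] by blast
      obtain S' where S': "S' \<subseteq> S" "card S' = k"
        using k S(3) obtain_subset_with_card_n by metis
      obtain K where "K \<subseteq> I" "inj_on (\<lambda>i. f i \<omega>) K" "S' = (\<lambda>i. f i \<omega>) ` K"
        using S' S(1) subset_image_inj[of S' "\<lambda>i. f i \<omega>" I] by blast
      then show "\<exists>K\<in>{K. K \<subseteq> I \<and> card K = k}. inj_on (\<lambda>i. f i \<omega>) K \<and> C \<omega> ((\<lambda>i. f i \<omega>) ` K)"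
        using S' S(2) C_subset by (intro bexI[of _ K]) (auto simp: card_image)
    next
      assume "\<exists>K\<in>{K. K \<subseteq> I \<and> card K = k}. inj_on (\<lambda>i. f i \<omega>) K \<and> C \<omega> ((\<lambda>i. f i \<omega>) ` K)"
      then obtain K where K: "K \<subseteq> I" "card K = k" "inj_on (\<lambda>i. f i \<omega>) K" "C \<omega> ((\<lambda>i. f i \<omega>) ` K)" by blast
      then have "card ((\<lambda>i. f i \<omega>) ` K) \<le> maxlen (C \<omega>) ?X"
        by (intro maxlen_ge[OF fX] image_mono)
      then show "k \<le> maxlen (C \<omega>) ?X" using K by (simp add: card_image)
    qed
  qed
  have P: "Measurable.pred N (\<lambda>\<omega>. k \<le> maxlen (C \<omega>) ((\<lambda>i. f i \<omega>) ` I))" for k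
    unfolding ge
  proof (intro pred_intros_finite pred_intros_logic)
    show "finite {K. K \<subseteq> I \<and> card K = k}" using fin by simp
    fix K assume "K \<in> {K. K \<subseteq> I \<and> card K = k}"
    then have K: "K \<subseteq> I" "finite K" using fin finite_subset by auto
    show "Measurable.pred N (\<lambda>\<omega>. C \<omega> ((\<lambda>i. f i \<omega>) ` K))" by (rule C[OF K(1)])
    have [measurable]: "f i \<in> borel_measurable N" if "i \<in> K" for i using f K that by auto
    show "Measurable.pred N (\<lambda>\<omega>. inj_on (\<lambda>i. f i \<omega>) K)"
      unfolding inj_on_def using K(2) by (intro pred_intros_finite pred_intros_logic) auto
  qed
  show ?thesis
    unfolding borel_measurable_iff_ge
  proof
    fix a :: real
    have "{\<omega> \<in> space N. a \<le> real (maxlen (C \<omega>) ((\<lambda>i. f i \<omega>) ` I))} =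
        {\<omega> \<in> space N. nat \<lceil>a\<rceil> \<le> maxlen (C \<omega>) ((\<lambda>i. f i \<omega>) ` I)}"
      by (auto simp: nat_le_iff ceiling_le_iff)
    then show "{\<omega> \<in> space N. a \<le> real (maxlen (C \<omega>) ((\<lambda>i. f i \<omega>) ` I))} \<in> sets N"
      using P[of "nat \<lceil>a\<rceil>"] by (simp add: pred_def)
  qed
qed

text \<open>In a finite set the admissible slopes of a point form an open set, so a rational one
  exists; the quantifier becomes countable and hence measurable.\<close>

lemma cchain_rat:
  assumes "finite S"
  shows "cchain S \<longleftrightarrow> (\<forall>z\<in>S. z \<in> T \<and> (\<exists>q::rat. 0 < q \<and> lin (of_rat q) z < 1 \<and> lin (of_rat q) z < of_rat q \<and>
    (\<forall>w\<in>S. w \<noteq> z \<longrightarrow> lin (of_rat q) z < lin (of_rat q) w)))"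
    (is "_ \<longleftrightarrow> (\<forall>z\<in>S. z \<in> T \<and> ?R z)")
proof -
  have 1: "?R z" if "q > 0" "lin q z < 1" "lin q z < q" "\<forall>w\<in>S. w \<noteq> z \<longrightarrow> lin q z < lin q w" for q z
  proof -
    define U where "U = {q. 0 < q} \<inter> {q. lin q z < 1} \<inter> {q. lin q z < q} \<inter> (\<Inter>w\<in>S - {z}. {q. lin q z < lin q w})"
    have "open U"
      unfolding U_def lin_def using assms
      by (intro open_Int open_INT open_Collect_less ballI finite_Diff continuous_intros) auto
    moreover have "q \<in> U" using that by (auto simp: U_def)
    ultimately obtain e where e: "e > 0" "ball q e \<subseteq> U" using openE by blast
    obtain p :: rat where p: "q < of_rat p" "of_rat p < q + e"
      using of_rat_dense[of q "q + e"] e by auto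
    then have "of_rat p \<in> U" using e by (auto simp: dist_real_def subset_iff)
    then show ?thesis by (intro exI[of _ p]) (auto simp: U_def)
  qed
  have 2: "?R z \<longleftrightarrow> (\<exists>q>0. lin q z < 1 \<and> lin q z < q \<and> (\<forall>w\<in>S. w \<noteq> z \<longrightarrow> lin q z < lin q w))" for z
  proof
    assume "?R z"
    then obtain q :: rat where "0 < q" "lin (of_rat q) z < 1" "lin (of_rat q) z < of_rat q"
      "\<forall>w\<in>S. w \<noteq> z \<longrightarrow> lin (of_rat q) z < lin (of_rat q) w" by blast
    then show "\<exists>q>0. lin q z < 1 \<and> lin q z < q \<and> (\<forall>w\<in>S. w \<noteq> z \<longrightarrow> lin q z < lin q w)"
      by (intro exI[of _ "of_rat q"]) simp
  qed (use 1 in blast)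
  show ?thesis unfolding cchain_def subset_iff 2 by blast
qed

lemma T_borel [measurable]: "T \<in> sets borel"
  unfolding T_def by (intro borel_compact finite_imp_compact_convex_hull) simp

lemma lin_measurable: "lin q \<in> borel_measurable borel"
  unfolding lin_def[abs_def] by (intro borel_measurable_continuous_onI continuous_intros)

lemma pred_cchain:
  fixes g :: "'i \<Rightarrow> 'w \<Rightarrow> real \<times> real"
  assumes "finite K" and g: "\<And>i. i \<in> K \<Longrightarrow> g i \<in> borel_measurable N"
    and p: "\<And>i. i \<in> K \<Longrightarrow> Measurable.pred N (p i)"
  shows "Measurable.pred N (\<lambda>\<omega>. cchain ((\<lambda>i. g i \<omega>) ` {i \<in> K. p i \<omega>}))"
proof -
  have eq: "cchain ((\<lambda>i. g i \<omega>) ` {i \<in> K. p i \<omega>}) \<longleftrightarrow>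
    (\<forall>i\<in>K. p i \<omega> \<longrightarrow> g i \<omega> \<in> T \<and> (\<exists>q::rat. 0 < q \<and> lin (of_rat q) (g i \<omega>) < 1 \<and>
      lin (of_rat q) (g i \<omega>) < of_rat q \<and>
      (\<forall>j\<in>K. p j \<omega> \<longrightarrow> g j \<omega> \<noteq> g i \<omega> \<longrightarrow> lin (of_rat q) (g i \<omega>) < lin (of_rat q) (g j \<omega>))))" for \<omega>
  proof -
    have ball: "(\<forall>z\<in>(\<lambda>i. g i \<omega>) ` {i \<in> K. p i \<omega>}. P z) \<longleftrightarrow> (\<forall>i\<in>K. p i \<omega> \<longrightarrow> P (g i \<omega>))" for P
      by auto
    have "finite ((\<lambda>i. g i \<omega>) ` {i \<in> K. p i \<omega>})" using assms(1) by simp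
    then show ?thesis by (simp only: cchain_rat ball)
  qed
  have [measurable]: "(\<lambda>\<omega>. lin q (g i \<omega>)) \<in> borel_measurable N" if "i \<in> K" for i q
    using measurable_compose[OF g[OF that] lin_measurable] .
  note [measurable] = p g
  show ?thesis
    unfolding eq using assms(1)
    by (intro pred_intros_finite pred_intros_logic pred_intros_countable) measurable
qed

lemma hereditary_cchain_image: "hereditary (\<lambda>S. cchain (f ` S))"
  by standard (auto simp: cchain_empty intro: cchain_subset)

lemma hereditary_cchain: "hereditary cchain"
  using hereditary_cchain_image[of id] by simp

lemma hereditary_cchain_parts:
  "hereditary (\<lambda>S. cchain (f ` {z \<in> S. P z}) \<and> cchain (g ` {z \<in> S. \<not> P z}))"
proof
  fix S R
  assume "cchain (f ` {z \<in> S. P z}) \<and> cchain (g ` {z \<in> S. \<not> P z})" "R \<subseteq> S"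
  then show "cchain (f ` {z \<in> R. P z}) \<and> cchain (g ` {z \<in> R. \<not> P z})"
    by (blast intro: cchain_subset[OF _ image_mono])
qed (auto simp: cchain_empty)

section \<open>The uniform law on the triangle and its images under affine maps\<close>

definition \<mu> :: "(real \<times> real) measure" where "\<mu> = uniform_measure lborel T"

lemma sets_\<mu> [simp, measurable_cong]: "sets \<mu> = sets borel" by (simp add: \<mu>_def)

lemma space_\<mu> [simp]: "space \<mu> = UNIV" by (simp add: \<mu>_def)

lemma hereditary_sampleI:
  fixes C :: "(real \<times> real) set \<Rightarrow> bool"
  assumes "prob_space \<nu>" "sets \<nu> = sets borel" "hereditary C"
    and pred: "\<And>(N :: (nat \<Rightarrow> real \<times> real) measure) (f :: (real \<times> real) + nat \<Rightarrow> _) K. finite K \<Longrightarrow>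
      (\<And>i. i \<in> K \<Longrightarrow> f i \<in> borel_measurable N) \<Longrightarrow> Measurable.pred N (\<lambda>\<omega>. C ((\<lambda>i. f i \<omega>) ` K))"
  shows "hereditary_sample C \<nu>"
proof -
  interpret prob_space \<nu> by fact
  interpret hereditary C by fact
  show ?thesis
  proof
    fix B :: "(real \<times> real) set" and J :: "nat set"
    assume fin: "finite B" "finite J"
    \<comment> \<open>Fixed and random points are merged into one family, indexed by a disjoint
      sum.\<close>
    define f :: "(real \<times> real) + nat \<Rightarrow> (nat \<Rightarrow> real \<times> real) \<Rightarrow> real \<times> real"
      where "f i x = (case i of Inl b \<Rightarrow> b | Inr j \<Rightarrow> x j)" for i x
    have eq: "B \<union> x ` J = (\<lambda>i. f i x) ` (B <+> J)" for x
      by (auto simp: f_def image_Un Plus_def image_image)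
    have m: "f i \<in> borel_measurable (PiM J (\<lambda>_. \<nu>))" if "i \<in> B <+> J" for i
    proof (cases i)
      case (Inr j)
      have "(\<lambda>x. x j) \<in> measurable (PiM J (\<lambda>_. \<nu>)) \<nu>"
        using that Inr by (intro measurable_component_singleton) auto
      then show ?thesis
        using Inr by (simp add: f_def[abs_def] measurable_cong_sets[OF refl assms(2)])
    qed (simp add: f_def[abs_def])
    have fin2: "finite (B <+> J)" using fin by (intro finite_Plus)
    have "(\<lambda>x. real (maxlen C ((\<lambda>i. f i x) ` (B <+> J)))) \<in> borel_measurable (PiM J (\<lambda>_. \<nu>))"
    proof (rule measurable_maxlen_general[where C="\<lambda>_. C", OF assms(3) fin2 m])
      fix K assume K: "K \<subseteq> B <+> J"
      show "Measurable.pred (PiM J (\<lambda>_. \<nu>)) (\<lambda>\<omega>. C ((\<lambda>i. f i \<omega>) ` K))"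
      proof (rule pred)
        show "finite K" by (rule finite_subset[OF K fin2])
        fix i assume "i \<in> K"
        then show "f i \<in> borel_measurable (PiM J (\<lambda>_. \<nu>))" using K by (intro m) blast
      qed
    qed
    then show "(\<lambda>x. real (maxlen C (B \<union> x ` J))) \<in> borel_measurable (PiM J (\<lambda>_. \<nu>))"
      by (simp only: eq)
  qed
qed

lemma hereditary_sample_cchain:
  assumes "prob_space \<nu>" "sets \<nu> = sets borel"
  shows "hereditary_sample cchain \<nu>"
proof (rule hereditary_sampleI[OF assms hereditary_cchain])
  fix N :: "(nat \<Rightarrow> real \<times> real) measure" and f :: "(real \<times> real) + nat \<Rightarrow> (nat \<Rightarrow> real \<times> real) \<Rightarrow> real \<times> real" and K
  assume "finite K" "\<And>i. i \<in> K \<Longrightarrow> f i \<in> borel_measurable N"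
  then have "Measurable.pred N (\<lambda>\<omega>. cchain ((\<lambda>i. f i \<omega>) ` {i \<in> K. True}))"
    by (intro pred_cchain) auto
  then show "Measurable.pred N (\<lambda>\<omega>. cchain ((\<lambda>i. f i \<omega>) ` K))" by simp
qed

lemma prob_space_\<mu>: "prob_space \<mu>"
  by (simp add: \<mu>_def prob_space_uniform_T)

interpretation \<mu>: prob_space \<mu> by (rule prob_space_\<mu>)

lemma emeasure_T: "emeasure lborel T \<noteq> 0" "emeasure lborel T \<noteq> \<infinity>"
proof -
  show "emeasure lborel T \<noteq> 0"
  proof
    assume 0: "emeasure lborel T = 0"
    have "emeasure \<mu> UNIV = 0" by (simp add: \<mu>_def 0)
    then show False using \<mu>.emeasure_space_1 by simp
  qed
  have "bounded T"
    unfolding T_def by (intro compact_imp_bounded finite_imp_compact_convex_hull) simp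
  then show "emeasure lborel T \<noteq> \<infinity>"
    using emeasure_bounded_finite[of T] by simp
qed

lemma emeasure_\<mu>: "E \<in> sets borel \<Longrightarrow> E \<subseteq> T \<Longrightarrow> emeasure \<mu> E = emeasure lborel E / emeasure lborel T"
  by (simp add: \<mu>_def Int_absorb1)

lemma emeasure_\<mu>_T: "emeasure \<mu> T = 1"
  using emeasure_T by (simp add: emeasure_\<mu> ennreal_divide_self less_top)

text \<open>The inverse of an affine map of \<open>T\<close> into itself is an example, with \<open>t\<close> its determinant.\<close>

definition scaling :: "real \<Rightarrow> (real \<times> real \<Rightarrow> real \<times> real) \<Rightarrow> bool" where
  "scaling t f \<longleftrightarrow> f \<in> borel_measurable borel \<and> f -` T \<subseteq> T \<and>
     (\<forall>E\<in>sets borel. E \<subseteq> T \<longrightarrow> emeasure \<mu> (f -` E) = ennreal t * emeasure \<mu> E)"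

lemma scaling_measurable: "scaling t f \<Longrightarrow> f \<in> borel_measurable borel"
  by (simp add: scaling_def)

lemma scaling_comp:
  assumes "scaling t f" "scaling s g" "0 \<le> t" "0 \<le> s"
  shows "scaling (t * s) (\<lambda>z. g (f z))"
proof -
  have "emeasure \<mu> ((\<lambda>z. g (f z)) -` E) = ennreal (t * s) * emeasure \<mu> E" if E: "E \<in> sets borel" "E \<subseteq> T" for E
  proof -
    have "g -` E \<in> sets borel"
      using measurable_sets[OF scaling_measurable[OF assms(2)] E(1)] by simp
    moreover have "g -` E \<subseteq> T" using E assms(2) by (auto simp: scaling_def)
    ultimately have "emeasure \<mu> (f -` (g -` E)) = ennreal t * (ennreal s * emeasure \<mu> E)"
      using assms(1,2) E unfolding scaling_def by metis
    moreover have "(\<lambda>z. g (f z)) -` E = f -` (g -` E)" by auto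
    ultimately show ?thesis using assms(3,4) by (simp add: ennreal_mult mult.assoc)
  qed
  moreover have "f -` T \<subseteq> T" "g -` T \<subseteq> T" using assms by (simp_all add: scaling_def)
  then have "(\<lambda>z. g (f z)) -` T \<subseteq> T" by blast
  ultimately show ?thesis
    using measurable_compose[OF scaling_measurable[OF assms(1)] scaling_measurable[OF assms(2)]]
    by (simp add: scaling_def)
qed

lemma affine_measurable:
  fixes x d :: real
  assumes "x \<noteq> 0" "d \<noteq> 0"
  shows "(\<lambda>z :: real \<times> real. (fst z / x, (snd z - a - fst z / x * c) / d)) \<in> borel_measurable borel"
  using assms by (intro borel_measurable_continuous_onI continuous_intros) auto

text \<open>Fubini and one linear substitution in each variable: \<open>x\<close> is the factor of
  the first coordinate, \<open>d\<close> that of the second after a shear.\<close>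

lemma lborel_affine_preimage:
  fixes E :: "(real \<times> real) set"
  assumes E [measurable]: "E \<in> sets borel" and x: "x > 0" and d: "d > 0"
  shows "emeasure lborel {z. (fst z / x, (snd z - a - fst z / x * c) / d) \<in> E}
    = ennreal (x * d) * emeasure lborel E"
proof -
  let ?F = "{z. (fst z / x, (snd z - a - fst z / x * c) / d) \<in> E}"
  have [measurable]: "(\<lambda>z. indicator E z :: ennreal) \<in> borel_measurable (borel :: (real \<times> real) measure)"
    using E by simp
  have E2 [measurable]: "(\<lambda>z. indicator E z :: ennreal) \<in> borel_measurable (borel \<Otimes>\<^sub>M borel)"
    using E by (simp add: borel_prod)
  have F: "?F \<in> sets borel"
    using measurable_sets[OF affine_measurable[of x d a c] E] x d by (simp add: vimage_def)
  have "emeasure lborel ?F = (\<integral>\<^sup>+z. indicator ?F z \<partial>(lborel \<Otimes>\<^sub>M lborel))"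
    using F by (simp add: lborel_prod)
  also have "\<dots> = (\<integral>\<^sup>+u. \<integral>\<^sup>+v. indicator ?F (u, v) \<partial>lborel \<partial>lborel)"
    using F by (subst lborel.nn_integral_fst[symmetric]) (auto simp: lborel_prod)
  also have "\<dots> = (\<integral>\<^sup>+u. \<integral>\<^sup>+v. indicator E (u / x, (v - a - u / x * c) / d) \<partial>lborel \<partial>lborel)"
    by (intro nn_integral_cong) (auto simp: indicator_def)
  also have "\<dots> = (\<integral>\<^sup>+u. ennreal d * (\<integral>\<^sup>+v. indicator E (u / x, v) \<partial>lborel) \<partial>lborel)"
  proof (intro nn_integral_cong)
    fix u
    have "(\<integral>\<^sup>+v. indicator E (u / x, (v - a - u / x * c) / d) \<partial>lborel) =
      ennreal \<bar>d\<bar> * (\<integral>\<^sup>+v. indicator E (u / x, ((a + u / x * c) + d * v - a - u / x * c) / d) \<partial>lborel)"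
    proof (intro nn_integral_real_affine)
      have "(\<lambda>v. (u / x, (v - a - u / x * c) / d)) \<in> borel_measurable borel"
        using d by (intro borel_measurable_continuous_onI continuous_intros) auto
      from measurable_compose[OF this, of "indicator E"]
      show "(\<lambda>v. indicator E (u / x, (v - a - u / x * c) / d) :: ennreal) \<in> borel_measurable borel"
        by simp
    qed (use d in auto)
    then show "(\<integral>\<^sup>+v. indicator E (u / x, (v - a - u / x * c) / d) \<partial>lborel) =
        ennreal d * (\<integral>\<^sup>+v. indicator E (u / x, v) \<partial>lborel)"
      using d by simp
  qed
  also have "\<dots> = ennreal \<bar>x\<bar> * (\<integral>\<^sup>+u. ennreal d * (\<integral>\<^sup>+v. indicator E ((0 + x * u) / x, v) \<partial>lborel) \<partial>lborel)"
    by (intro nn_integral_real_affine) (use x in auto)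
  also have "\<dots> = ennreal (x * d) * (\<integral>\<^sup>+u. \<integral>\<^sup>+v. indicator E (u, v) \<partial>lborel \<partial>lborel)"
    using x d by (simp add: nn_integral_cmult ennreal_mult mult.assoc)
  also have "(\<integral>\<^sup>+u. \<integral>\<^sup>+v. indicator E (u, v) \<partial>lborel \<partial>lborel) = emeasure lborel E"
    using E by (subst lborel.nn_integral_fst) (auto simp: lborel_prod)
  finally show ?thesis .
qed

lemma lower_measurable: "a \<noteq> 1 \<Longrightarrow> lower a r \<in> borel_measurable borel"
  using affine_measurable[of "fst r" "1 - a" a "snd r - a"]
  by (cases "fst r = 0") (simp_all add: lower_def[abs_def])

lemma scaling_lower:
  assumes r: "r \<in> T" and a: "0 \<le> a" "a < 1"
  shows "scaling (fst r * (1 - a)) (lower a r)"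
proof (cases "fst r = 0")
  case True
  \<comment> \<open>The default value \<open>(2, 2)\<close> lies outside \<open>T\<close>, so the
    preimage is empty, in agreement with the factor 0.\<close>
  then have "lower a r -` E = {}" if "E \<subseteq> T" for E
  proof -
    have "(2, 2) \<notin> E" using that by (auto simp: T_iff)
    then show ?thesis using True by (auto simp: lower_def)
  qed
  then show ?thesis using True lower_measurable[of a] a by (simp add: scaling_def)
next
  case False
  then have x: "fst r > 0" using r by (auto simp: T_iff)
  have sub: "lower a r -` T \<subseteq> T"
  proof
    fix z assume "z \<in> lower a r -` T"
    then obtain c d where cd: "lower a r z = (c, d)" "0 \<le> c" "0 \<le> d" "c + d \<le> 1"
      by (cases "lower a r z") (auto simp: T_iff)
    have c: "c = fst z / fst r" and "d = (snd z - a - c * (snd r - a)) / (1 - a)"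
      using cd(1) False by (auto simp: lower_def)
    then have "d * (1 - a) = snd z - a - c * (snd r - a)" using a by simp
    then have "snd z = a * (1 - c) + c * snd r + d * (1 - a)" by (simp add: algebra_simps)
    moreover have "fst z = c * fst r" using c x by simp
    ultimately have z: "fst z = c * fst r" "snd z = a * (1 - c) + c * snd r + d * (1 - a)" by auto
    have "fst z + snd z = c * (fst r + snd r) + a * (1 - c) + d * (1 - a)"
      by (simp add: z algebra_simps)
    also have "\<dots> \<le> c * 1 + a * (1 - c) + (1 - c) * (1 - a)"
      using cd r a by (intro add_mono mult_left_mono mult_right_mono) (auto simp: T_iff)
    also have "\<dots> = 1" by (simp add: algebra_simps)
    finally show "z \<in> T" using cd r a x by (auto simp: T_iff z)
  qed
  have "emeasure \<mu> (lower a r -` E) = ennreal (fst r * (1 - a)) * emeasure \<mu> E"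
    if E: "E \<in> sets borel" "E \<subseteq> T" for E
  proof -
    have "lower a r -` E = {z. (fst z / fst r, (snd z - a - fst z / fst r * (snd r - a)) / (1 - a)) \<in> E}"
      using x by (auto simp: lower_def)
    then have "emeasure lborel (lower a r -` E) = ennreal (fst r * (1 - a)) * emeasure lborel E"
      using lborel_affine_preimage[OF E(1) x, of "1 - a" a "snd r - a"] a by simp
    moreover have "lower a r -` E \<in> sets borel"
      using measurable_sets[OF lower_measurable E(1)] a by simp
    moreover have "lower a r -` E \<subseteq> T" using sub E by auto
    ultimately show ?thesis
      using E by (simp add: emeasure_\<mu> ennreal_times_divide)
  qed
  then show ?thesis using sub lower_measurable[of a] a by (simp add: scaling_def)
qed

lemma swap_measurable: "prod.swap \<in> borel_measurable (borel :: (real \<times> real) measure)"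
proof -
  have "(\<lambda>z :: real \<times> real. (snd z, fst z)) \<in> borel_measurable borel"
    by (intro borel_measurable_continuous_onI continuous_intros)
  then show ?thesis by (simp add: prod.swap_def[abs_def])
qed

lemma scaling_swap: "scaling 1 prod.swap"
proof -
  have T: "prod.swap z \<in> T \<longleftrightarrow> z \<in> T" for z by (auto simp: T_iff add.commute)
  have "emeasure \<mu> (prod.swap -` E) = emeasure \<mu> E" if E: "E \<in> sets borel" "E \<subseteq> T" for E
  proof -
    have m: "prod.swap -` E \<in> sets borel"
      using measurable_sets[OF swap_measurable E(1)] by simp
    have sub: "prod.swap -` E \<subseteq> T" using E(2) T by auto
    have "emeasure lborel (prod.swap -` E) = (\<integral>\<^sup>+u. \<integral>\<^sup>+v. indicator (prod.swap -` E) (u, v) \<partial>lborel \<partial>lborel)"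
      using m by (subst lborel.nn_integral_fst) (auto simp: lborel_prod)
    also have "\<dots> = (\<integral>\<^sup>+u. \<integral>\<^sup>+v. indicator E (v, u) \<partial>lborel \<partial>lborel)"
      by (intro nn_integral_cong) (auto simp: indicator_def)
    also have "\<dots> = (\<integral>\<^sup>+v. \<integral>\<^sup>+u. indicator E (v, u) \<partial>lborel \<partial>lborel)"
      using E(1) by (intro lborel_pair.Fubini') (auto simp: lborel_prod case_prod_unfold)
    also have "\<dots> = emeasure lborel E"
      using E by (subst lborel.nn_integral_fst) (auto simp: lborel_prod)
    finally show ?thesis using m sub E by (simp add: emeasure_\<mu>)
  qed
  then show ?thesis using T swap_measurable by (auto simp: scaling_def)
qed

lemma scaling_upper:
  assumes "r \<in> T" "0 \<le> b" "b < 1"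
  shows "scaling (snd r * (1 - b)) (upper b r)"
proof -
  have r: "prod.swap r \<in> T" "0 \<le> snd r" using assms by (auto simp: T_iff add.commute)
  have "scaling (1 * (snd r * (1 - b))) (\<lambda>z. lower b (prod.swap r) (prod.swap z))"
    using scaling_lower[OF r(1) assms(2,3)] r assms by (intro scaling_comp[OF scaling_swap]) auto
  from scaling_comp[OF this scaling_swap]
  show ?thesis using r assms by (simp add: upper_def[abs_def])
qed

section \<open>Superadditivity of the mean length\<close>

lemma maxlen_cchain_insert_outside:
  assumes "z \<notin> T"
  shows "maxlen cchain (insert z X) = maxlen cchain X"
proof -
  have "{S. S \<subseteq> insert z X \<and> cchain S} = {S. S \<subseteq> X \<and> cchain S}"
    using assms by (auto simp: cchain_def)
  then show ?thesis by (simp add: maxlen_def)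
qed

text \<open>\<open>avg t m B\<close> is the mean length of the longest chain in \<open>B\<close> and \<open>m\<close> independent random points
  each of which is uniform in \<open>T\<close> with probability \<open>t\<close> and absent otherwise.\<close>

primrec avg :: "real \<Rightarrow> nat \<Rightarrow> (real \<times> real) set \<Rightarrow> real" where
  "avg t 0 B = real (maxlen cchain B)"
| "avg t (Suc m) B = t * (\<integral>z. avg t m (insert z B) \<partial>\<mu>) + (1 - t) * avg t m B"

lemma avg_insert_outside: "z \<notin> T \<Longrightarrow> avg t m (insert z B) = avg t m B"
  by (induction m arbitrary: B) (simp_all add: maxlen_cchain_insert_outside insert_commute[of _ z])

text \<open>On \<open>T\<close> the law of \<open>f\<close> is \<open>t\<close> times \<mu>; the
  remaining mass \<open>1 - t\<close> sits outside \<open>T\<close>, where \<open>F\<close> has the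
  constant value \<open>k\<close>.\<close>

lemma integral_scaling:
  fixes F :: "real \<times> real \<Rightarrow> real"
  assumes f: "scaling t f" and t: "0 \<le> t" "t \<le> 1"
    and F [measurable]: "F \<in> borel_measurable borel" and F0: "\<And>z. 0 \<le> F z" "\<And>z. F z \<le> c"
    and k: "\<And>z. z \<notin> T \<Longrightarrow> F z = k" "0 \<le> k"
  shows "(\<integral>z. F z \<partial>distr \<mu> borel f) = t * (\<integral>z. F z \<partial>\<mu>) + (1 - t) * k"
proof -
  define \<nu> where "\<nu> = distr \<mu> borel f"
  have fm [measurable]: "f \<in> borel_measurable \<mu>"
    using scaling_measurable[OF f] by simp
  interpret \<nu>: prob_space \<nu> unfolding \<nu>_def by (rule \<mu>.prob_space_distr[OF fm])
  have sets [simp, measurable_cong]: "sets \<nu> = sets borel" and space [simp]: "space \<nu> = UNIV"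
    by (simp_all add: \<nu>_def)
  have em: "emeasure \<nu> E = ennreal t * emeasure \<mu> E" if "E \<in> sets borel" "E \<subseteq> T" for E
    using f that by (simp add: \<nu>_def emeasure_distr scaling_def)
  have eq: "density \<nu> (indicator T) = scale_measure t (density \<mu> (indicator T))"
  proof (rule measure_eqI)
    fix E assume "E \<in> sets (density \<nu> (indicator T))"
    then have E [measurable]: "E \<in> sets borel" by simp
    have "emeasure (density \<nu> (indicator T)) E = emeasure \<nu> (T \<inter> E)"
      by (simp add: emeasure_density flip: indicator_inter_arith)
    also have "\<dots> = ennreal t * emeasure \<mu> (T \<inter> E)"
      by (intro em) auto
    also have "\<dots> = emeasure (scale_measure t (density \<mu> (indicator T))) E"
      by (simp add: emeasure_density flip: indicator_inter_arith)
    finally show "emeasure (density \<nu> (indicator T)) E = emeasure (scale_measure t (density \<mu> (indicator T))) E" .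
  qed simp
  have aeT: "AE z in \<mu>. z \<in> T"
    using emeasure_\<mu>_T by (intro \<mu>.AE_prob_1) (simp add: measure_def)
  have "(\<integral>\<^sup>+z. indicator T z * ennreal (F z) \<partial>\<nu>) = (\<integral>\<^sup>+z. ennreal (F z) \<partial>density \<nu> (indicator T))"
    by (intro nn_integral_density[symmetric]) measurable
  also have "\<dots> = ennreal t * (\<integral>\<^sup>+z. ennreal (F z) \<partial>density \<mu> (indicator T))"
    unfolding eq by (intro nn_integral_scale_measure) measurable
  also have "(\<integral>\<^sup>+z. ennreal (F z) \<partial>density \<mu> (indicator T)) = (\<integral>\<^sup>+z. indicator T z * ennreal (F z) \<partial>\<mu>)"
    by (intro nn_integral_density) measurable
  also have "\<dots> = (\<integral>\<^sup>+z. ennreal (F z) \<partial>\<mu>)"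
    using aeT by (intro nn_integral_cong_AE) (auto simp: indicator_def)
  finally have 1: "(\<integral>\<^sup>+z. indicator T z * ennreal (F z) \<partial>\<nu>) = ennreal t * (\<integral>\<^sup>+z. ennreal (F z) \<partial>\<mu>)" .
  have "emeasure \<nu> (- T) = 1 - emeasure \<nu> T"
    using emeasure_compl[of T \<nu>] \<nu>.emeasure_space_1 by (simp add: Compl_eq_Diff_UNIV)
  then have nuT: "emeasure \<nu> (- T) = ennreal (1 - t)"
    using t ennreal_minus[of t 1] by (simp add: em emeasure_\<mu>_T)
  have "(\<integral>\<^sup>+z. ennreal (F z) \<partial>\<nu>) = (\<integral>\<^sup>+z. indicator T z * ennreal (F z) + ennreal k * indicator (- T) z \<partial>\<nu>)"
    using k by (intro nn_integral_cong) (auto simp: indicator_def)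
  also have "\<dots> = ennreal t * (\<integral>\<^sup>+z. ennreal (F z) \<partial>\<mu>) + ennreal k * ennreal (1 - t)"
    by (subst nn_integral_add) (auto simp: 1 nuT nn_integral_cmult_indicator)
  finally have 2: "(\<integral>\<^sup>+z. ennreal (F z) \<partial>\<nu>) = ennreal t * (\<integral>\<^sup>+z. ennreal (F z) \<partial>\<mu>) + ennreal k * ennreal (1 - t)" .
  have i: "integrable \<nu> F" "integrable \<mu> F"
    using F0 by (auto intro!: \<nu>.integrable_const_bound[where B=c] \<mu>.integrable_const_bound[where B=c])
  have "ennreal (\<integral>z. F z \<partial>\<nu>) = ennreal (t * (\<integral>z. F z \<partial>\<mu>) + k * (1 - t))"
  proof -
    have "0 \<le> (\<integral>z. F z \<partial>\<mu>)" "0 \<le> t * (\<integral>z. F z \<partial>\<mu>)" "0 \<le> k * (1 - t)"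
      using F0 t k by (auto intro!: Bochner_Integration.integral_nonneg)
    then show ?thesis
      using 2 i F0 t k by (simp add: nn_integral_eq_integral ennreal_mult)
  qed
  then show ?thesis
    using F0 t k by (subst (asm) ennreal_inj) (auto simp: \<nu>_def Bochner_Integration.integral_nonneg mult.commute)
qed

lemma hereditary_sample_distr:
  assumes "scaling t f"
  shows "hereditary_sample cchain (distr \<mu> borel f)"
  using prob_space.prob_space_distr[OF prob_space_\<mu>, of f borel] scaling_measurable[OF assms]
  by (intro hereditary_sample_cchain) (auto simp: measurable_cong_sets[OF sets_\<mu> refl])

text \<open>Hence the mean length in a triangle depends on its area only and not on its shape:
  \<open>t\<close> is the probability that a sample point falls into the triangle.\<close>

lemma mean_eq_avg:
  assumes f: "scaling t f" and t: "0 \<le> t" "t \<le> 1" and "finite J" "finite B"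
  shows "hereditary_sample.mean cchain (distr \<mu> borel f) B J = avg t (card J) B"
  using assms(4,5)
proof (induction J arbitrary: B rule: finite_induct)
  case empty
  interpret H: hereditary_sample cchain "distr \<mu> borel f" by (rule hereditary_sample_distr[OF f])
  interpret P: prob_space "PiM ({} :: nat set) (\<lambda>_. distr \<mu> borel f)" by (rule H.prob_space_PiM_nat)
  show ?case using P.prob_space by (simp add: H.mean_def)
next
  case (insert j J)
  interpret H: hereditary_sample cchain "distr \<mu> borel f" by (rule hereditary_sample_distr[OF f])
  let ?F = "\<lambda>z. avg t (card J) (insert z B)"
  have IH: "H.mean (insert z B) J = ?F z" "H.mean B J = avg t (card J) B" for z
    using insert by auto
  have "H.mean B (insert j J) = (\<integral>z. ?F z \<partial>distr \<mu> borel f)"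
    using insert by (simp add: H.mean_insert IH)
  also have "\<dots> = t * (\<integral>z. ?F z \<partial>\<mu>) + (1 - t) * avg t (card J) B"
  proof (rule integral_scaling[OF f t])
    show "?F \<in> borel_measurable borel"
      using borel_measurable_integrable[OF H.integrable_mean_insert[of B J j]] insert by (simp add: IH)
    show "0 \<le> ?F z" for z using H.mean_nonneg[of "insert z B" J] by (simp add: IH)
    show "?F z \<le> avg t (card J) B + 1" for z
      using H.mean_insert_point_bounds(2)[of B J z] insert by (simp add: IH)
    show "0 \<le> avg t (card J) B" using H.mean_nonneg[of B J] by (simp add: IH)
  qed (rule avg_insert_outside)
  finally show ?case using insert by simp
qed

text \<open>The triangle \<open>p0\<close>, \<open>p1\<close>, \<open>(t, 0)\<close> has relative
  area \<open>t\<close>. So every \<open>avg t\<close> is a \<open>mean\<close> and inherits its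
  properties.\<close>

lemma scaling_exists: "0 \<le> t \<Longrightarrow> t \<le> 1 \<Longrightarrow> scaling t (lower 0 (t, 0))"
  using scaling_lower[of "(t, 0)" 0] by (simp add: T_iff)

lemma
  assumes t: "0 \<le> t" "t \<le> 1" and B: "finite B"
  shows avg_nonneg: "0 \<le> avg t m B"
    and avg_insert_ge: "avg t m B \<le> avg t m (insert z B)"
    and integrable_avg_insert: "integrable \<mu> (\<lambda>z. avg t m (insert z B))"
proof -
  let ?f = "lower 0 (t, 0)"
  note f = scaling_exists[OF t]
  interpret H: hereditary_sample cchain "distr \<mu> borel ?f" by (rule hereditary_sample_distr[OF f])
  have eq: "avg t m B = H.mean B {..<m}" if "finite B" for B
    using mean_eq_avg[OF f t, of "{..<m}" B] that by simp
  show "0 \<le> avg t m B" "avg t m B \<le> avg t m (insert z B)"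
    using H.mean_nonneg[of B] H.mean_insert_point_bounds(1)[of B "{..<m}" z] B by (simp_all add: eq)
  have le: "avg t m (insert z B) \<le> avg t m B + 1" for z
    using H.mean_insert_point_bounds(2)[of B "{..<m}" z] B by (simp add: eq)
  have "(\<lambda>z. avg t m (insert z B)) \<in> borel_measurable borel"
    using borel_measurable_integrable[OF H.integrable_mean_insert[of B "{..<m}" m]] B by (simp add: eq)
  moreover have "0 \<le> avg t m (insert z B)" for z
    using H.mean_nonneg[of "insert z B"] B by (simp add: eq)
  ultimately show "integrable \<mu> (\<lambda>z. avg t m (insert z B))"
    using le by (intro \<mu>.integrable_const_bound[where B="avg t m B + 1"]) auto
qed

lemma integral_avg_insert_ge:
  assumes "0 \<le> t" "t \<le> 1" "finite B"
  shows "avg t m B \<le> (\<integral>z. avg t m (insert z B) \<partial>\<mu>)"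
proof -
  have "(\<integral>z. avg t m B \<partial>\<mu>) \<le> (\<integral>z. avg t m (insert z B) \<partial>\<mu>)"
    using assms by (intro integral_mono integrable_avg_insert avg_insert_ge) auto
  then show ?thesis using \<mu>.prob_space by simp
qed

lemma avg_Suc_ge:
  assumes "0 \<le> t" "t \<le> 1" "finite B"
  shows "avg t m B \<le> avg t (Suc m) B"
  using mult_left_mono[OF integral_avg_insert_ge[OF assms, of m] assms(1)] by (simp add: algebra_simps)

lemma avg_mono_points:
  assumes "0 \<le> t" "t \<le> 1" "finite B" "k \<le> m"
  shows "avg t k B \<le> avg t m B"
  using lift_Suc_mono_le[of "\<lambda>m. avg t m B"] avg_Suc_ge[OF assms(1-3)] assms(4) by blast

text \<open>All triangles are realised on one probability space, with the same sample mapped into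
  their coordinates, so that pointwise inequalities between lengths can be integrated.\<close>

lemma integral_maxlen_scaling:
  fixes J :: "nat set"
  assumes f: "scaling t f" and t: "0 \<le> t" "t \<le> 1" and J: "finite J"
  shows "(\<integral>x. real (maxlen cchain (f ` x ` J)) \<partial>PiM J (\<lambda>_. \<mu>)) = avg t (card J) {}"
    and "integrable (PiM J (\<lambda>_. \<mu>)) (\<lambda>x. real (maxlen cchain (f ` x ` J)))"
proof -
  let ?\<nu> = "distr \<mu> borel f"
  interpret H: hereditary_sample cchain ?\<nu> by (rule hereditary_sample_distr[OF f])
  have fm [measurable]: "f \<in> borel_measurable \<mu>" using scaling_measurable[OF f] by simp
  interpret M: product_prob_space "\<lambda>_ :: nat. \<mu>" by standard
  have eq: "PiM J (\<lambda>_. ?\<nu>) = distr (PiM J (\<lambda>_. \<mu>)) (PiM J (\<lambda>_. ?\<nu>)) (compose J f)"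
  proof -
    have "product_prob_space (\<lambda>_ :: nat. ?\<nu>)" by standard
    have m: "f \<in> measurable \<mu> ?\<nu>" by simp
    have "distr (PiM J (\<lambda>_. \<mu>)) (PiM J (\<lambda>_. ?\<nu>)) (compose J f) = PiM J (\<lambda>i. distr \<mu> ?\<nu> f)"
      by (rule distr_PiM_finite_prob_space[OF J M.product_prob_space_axioms \<open>product_prob_space (\<lambda>_ :: nat. ?\<nu>)\<close> m])
    moreover have "distr \<mu> ?\<nu> f = ?\<nu>" by (intro distr_cong) auto
    ultimately show ?thesis by simp
  qed
  have m: "compose J f \<in> measurable (PiM J (\<lambda>_. \<mu>)) (PiM J (\<lambda>_. ?\<nu>))"
    unfolding compose_def by (intro measurable_restrict measurable_compose[OF measurable_component_singleton]) auto
  have im: "compose J f x ` J = f ` x ` J" for x by (auto simp: compose_def)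
  have i: "integrable (distr (PiM J (\<lambda>_. \<mu>)) (PiM J (\<lambda>_. ?\<nu>)) (compose J f)) (\<lambda>x. real (maxlen cchain (x ` J)))"
    using H.integrable_maxlen[of "{}" J J] J by (simp flip: eq)
  from integrable_distr[OF m i]
  show "integrable (PiM J (\<lambda>_. \<mu>)) (\<lambda>x. real (maxlen cchain (f ` x ` J)))" by (simp add: im)
  have "avg t (card J) {} = H.mean {} J" using mean_eq_avg[OF f t J, of "{}"] by simp
  also have "\<dots> = (\<integral>x. real (maxlen cchain (x ` J)) \<partial>distr (PiM J (\<lambda>_. \<mu>)) (PiM J (\<lambda>_. ?\<nu>)) (compose J f))"
    by (simp add: H.mean_def flip: eq)
  also have "\<dots> = (\<integral>x. real (maxlen cchain (f ` x ` J)) \<partial>PiM J (\<lambda>_. \<mu>))"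
    using borel_measurable_integrable[OF i] by (subst integral_distr[OF m]) (auto simp: im)
  finally show "(\<integral>x. real (maxlen cchain (f ` x ` J)) \<partial>PiM J (\<lambda>_. \<mu>)) = avg t (card J) {}" by simp
qed

text \<open>Optimal sets of the two images lift injectively to subsets of \<open>X\<close>; by
  \<open>join\<close> these are disjoint and their union is a chain.\<close>

lemma maxlen_superadditive:
  assumes s: "0 < s" "s < 1" and X: "finite X"
  shows "maxlen cchain (lower (1 - s) (s\<^sup>2, (1 - s)\<^sup>2) ` X) + maxlen cchain (upper s (s\<^sup>2, (1 - s)\<^sup>2) ` X)
    \<le> maxlen cchain X"
proof -
  interpret hereditary cchain by (rule hereditary_cchain)
  let ?L = "lower (1 - s) (s\<^sup>2, (1 - s)\<^sup>2)" and ?U = "upper s (s\<^sup>2, (1 - s)\<^sup>2)"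
  obtain R1 where R1: "R1 \<subseteq> ?L ` X" "cchain R1" "card R1 = maxlen cchain (?L ` X)"
    using maxlen_attained[of "?L ` X"] X by blast
  obtain R2 where R2: "R2 \<subseteq> ?U ` X" "cchain R2" "card R2 = maxlen cchain (?U ` X)"
    using maxlen_attained[of "?U ` X"] X by blast
  obtain S1 where S1: "S1 \<subseteq> X" "inj_on ?L S1" "R1 = ?L ` S1"
    using R1(1) subset_image_inj[of R1 ?L X] by blast
  obtain S2 where S2: "S2 \<subseteq> X" "inj_on ?U S2" "R2 = ?U ` S2"
    using R2(1) subset_image_inj[of R2 ?U X] by blast
  have j: "cchain (S1 \<union> S2)" "S1 \<inter> S2 = {}"
    using join[OF s, of S1 S2] R1 R2 S1 S2 by simp_all
  have "card S1 + card S2 = card (S1 \<union> S2)"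
    using j S1 S2 X by (intro card_Un_disjoint[symmetric]) (auto intro: finite_subset)
  also have "\<dots> \<le> maxlen cchain X"
    using j S1 S2 by (intro maxlen_ge[OF X]) auto
  finally show ?thesis using R1 R2 S1 S2 by (simp add: card_image)
qed

text \<open>The two triangles at the tangent have relative areas \<open>s^2 * s\<close> and
  \<open>(1 - s)^2 * (1 - s)\<close>, which is why cube roots of areas add up. Composition with a
  map of factor \<open>t\<close> places the configuration inside a smaller triangle.\<close>

lemma avg_superadditive:
  assumes t: "0 \<le> t" "t \<le> 1" and s: "0 < s" "s < 1"
  shows "avg (t * s ^ 3) m {} + avg (t * (1 - s) ^ 3) m {} \<le> avg t m {}"
proof -
  let ?r = "(s\<^sup>2, (1 - s)\<^sup>2)"
  let ?f = "lower 0 (t, 0)" and ?L = "lower (1 - s) ?r" and ?U = "upper s ?r"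
  note f = scaling_exists[OF t]
  have "?r \<in> T"
  proof -
    have "s\<^sup>2 + (1 - s)\<^sup>2 = 1 - 2 * (s * (1 - s))" by (simp add: power2_eq_square algebra_simps)
    moreover have "0 \<le> s * (1 - s)" using s by simp
    ultimately show ?thesis by (simp add: T_iff)
  qed
  then have LU: "scaling (s ^ 3) ?L" "scaling ((1 - s) ^ 3) ?U"
    using scaling_lower[of ?r "1 - s"] scaling_upper[of ?r s] s
    by (simp_all add: power3_eq_cube power2_eq_square mult.assoc)
  have f1: "scaling (t * s ^ 3) (\<lambda>z. ?L (?f z))" "scaling (t * (1 - s) ^ 3) (\<lambda>z. ?U (?f z))"
    using LU s t by (auto intro!: scaling_comp[OF f])
  have b: "0 \<le> t * s ^ 3" "t * s ^ 3 \<le> 1" "0 \<le> t * (1 - s) ^ 3" "t * (1 - s) ^ 3 \<le> 1"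
    using s t by (auto intro!: mult_le_one power_le_one)
  let ?P = "PiM {..<m} (\<lambda>_. \<mu>)"
  note a1 = integral_maxlen_scaling[OF f1(1) b(1,2), of "{..<m}"]
  note a2 = integral_maxlen_scaling[OF f1(2) b(3,4), of "{..<m}"]
  note a3 = integral_maxlen_scaling[OF f t, of "{..<m}"]
  have "avg (t * s ^ 3) m {} + avg (t * (1 - s) ^ 3) m {} =
      (\<integral>x. real (maxlen cchain ((\<lambda>z. ?L (?f z)) ` x ` {..<m})) + real (maxlen cchain ((\<lambda>z. ?U (?f z)) ` x ` {..<m})) \<partial>?P)"
    using a1 a2 by (subst Bochner_Integration.integral_add) auto
  also have "\<dots> \<le> (\<integral>x. real (maxlen cchain (?f ` x ` {..<m})) \<partial>?P)"
  proof (intro integral_mono Bochner_Integration.integrable_add a1 a2 a3)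
    fix x
    have "maxlen cchain (?L ` ?f ` x ` {..<m}) + maxlen cchain (?U ` ?f ` x ` {..<m}) \<le> maxlen cchain (?f ` x ` {..<m})"
      by (rule maxlen_superadditive[OF s]) simp
    then show "real (maxlen cchain ((\<lambda>z. ?L (?f z)) ` x ` {..<m})) + real (maxlen cchain ((\<lambda>z. ?U (?f z)) ` x ` {..<m}))
        \<le> real (maxlen cchain (?f ` x ` {..<m}))"
      by (simp add: image_image flip: of_nat_add)
  qed simp_all
  also have "\<dots> = avg t m {}" using a3 by simp
  finally show ?thesis .
qed

text \<open>The probability that a binomial variable with parameters \<open>m\<close> and
  \<open>t\<close> is at least \<open>j\<close>, conditioned on one trial so that the recursion runs
  parallel to that of \<open>avg\<close>.\<close>

fun binomial_tail :: "real \<Rightarrow> nat \<Rightarrow> nat \<Rightarrow> real" where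
  "binomial_tail t m 0 = 1"
| "binomial_tail t 0 (Suc j) = 0"
| "binomial_tail t (Suc m) (Suc j) = t * binomial_tail t m j + (1 - t) * binomial_tail t m (Suc j)"

text \<open>When at least \<open>j\<close> points are present, the length is at least that of
  \<open>j\<close> of them.\<close>

lemma avg_ge_binomial_tail:
  assumes t: "0 \<le> t" "t \<le> 1"
  shows "finite B \<Longrightarrow> binomial_tail t m j * avg 1 j B \<le> avg t m B"
proof (induction m arbitrary: j B)
  case 0
  then show ?case using avg_nonneg[OF t, of B 0] by (cases j) auto
next
  case (Suc m)
  show ?case
  proof (cases j)
    case 0
    then show ?thesis using avg_mono_points[OF t Suc.prems, of 0 "Suc m"] by simp
  next
    case (Suc i)
    have "binomial_tail t m i * (\<integral>z. avg 1 i (insert z B) \<partial>\<mu>) = (\<integral>z. binomial_tail t m i * avg 1 i (insert z B) \<partial>\<mu>)"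
      by simp
    also have "\<dots> \<le> (\<integral>z. avg t m (insert z B) \<partial>\<mu>)"
      using t Suc.prems Suc.IH[of "insert _ B"]
      by (intro integral_mono integrable_mult_right integrable_avg_insert) auto
    finally have "t * (binomial_tail t m i * avg 1 (Suc i) B) \<le> t * (\<integral>z. avg t m (insert z B) \<partial>\<mu>)"
      using t by (intro mult_left_mono) auto
    moreover have "(1 - t) * (binomial_tail t m (Suc i) * avg 1 (Suc i) B) \<le> (1 - t) * avg t m B"
      using t Suc.prems by (intro mult_left_mono Suc.IH) auto
    moreover have "binomial_tail t (Suc m) (Suc i) * avg 1 (Suc i) B =
        t * (binomial_tail t m i * avg 1 (Suc i) B) + (1 - t) * (binomial_tail t m (Suc i) * avg 1 (Suc i) B)"
      by (simp only: binomial_tail.simps distrib_right mult.assoc)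
    ultimately show ?thesis unfolding Suc avg.simps(2)[of t] by linarith
  qed
qed

text \<open>Chernoff's bound for fewer than \<open>j\<close> successes: the base of the power is the
  expectation of \<open>exp (- l * X)\<close> for a single trial \<open>X\<close>.\<close>

lemma one_minus_binomial_tail_le:
  assumes t: "0 \<le> t" "t \<le> 1" and l: "0 \<le> l"
  shows "1 - binomial_tail t m j \<le> exp (l * real j) * (1 - t * (1 - exp (- l))) ^ m"
proof (induction m arbitrary: j)
  case 0
  then show ?case using l by (cases j) auto
next
  case (Suc m)
  define c where "c = 1 - t * (1 - exp (- l))"
  have "t * (1 - exp (- l)) \<le> 1 * 1" using t l by (intro mult_mono) auto
  then have c: "0 \<le> c" by (simp add: c_def)
  show ?case
  proof (cases j)
    case 0
    then show ?thesis using c by (simp flip: c_def)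
  next
    case (Suc i)
    have "1 - binomial_tail t (Suc m) (Suc i) = t * (1 - binomial_tail t m i) + (1 - t) * (1 - binomial_tail t m (Suc i))"
      by (simp add: algebra_simps)
    also have "\<dots> \<le> t * (exp (l * real i) * c ^ m) + (1 - t) * (exp (l * real (Suc i)) * c ^ m)"
      using t Suc.IH[of i] Suc.IH[of "Suc i"] unfolding c_def by (intro add_mono mult_left_mono) auto
    also have "exp (l * real i) = exp (l * real (Suc i)) * exp (- l)"
      by (simp add: algebra_simps flip: exp_add)
    also have "t * (exp (l * real (Suc i)) * exp (- l) * c ^ m) + (1 - t) * (exp (l * real (Suc i)) * c ^ m)
        = exp (l * real (Suc i)) * c ^ Suc m"
      by (simp add: c_def algebra_simps)
    finally show ?thesis unfolding Suc c_def .
  qed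
qed

lemma binomial_tail_one: "binomial_tail t m (Suc 0) = 1 - (1 - t) ^ m"
proof (induction m)
  case (Suc m)
  show ?case by (simp only: binomial_tail.simps Suc.IH) (simp add: algebra_simps)
qed simp

section \<open>First moment of the number of long chains\<close>

text \<open>The line through \<open>q\<close> and \<open>z\<close> meets the axis \<open>y = 0\<close> at \<open>foot q z\<close>. In an ordered chain these
  feet increase, and the points following \<open>z\<close> lie in the triangle \<open>z, (foot q z, 0), p2\<close>.\<close>

definition foot :: "real \<times> real \<Rightarrow> real \<times> real \<Rightarrow> real" where
  "foot q z = fst q + (fst z - fst q) * (snd q / (snd q - snd z))"

primrec ordered_chain :: "real \<times> real \<Rightarrow> real \<Rightarrow> (real \<times> real) list \<Rightarrow> bool" where
  "ordered_chain q \<xi> [] \<longleftrightarrow> True"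
| "ordered_chain q \<xi> (z # zs) \<longleftrightarrow>
     0 \<le> snd z \<and> snd z < snd q \<and> \<xi> \<le> foot q z \<and> foot q z \<le> 1 \<and> ordered_chain z (foot q z) zs"

lemma ex_ordered_chain:
  assumes "finite S"
    and "\<And>z. z \<in> S \<Longrightarrow> 0 \<le> snd z \<and> snd z < snd q \<and> \<xi> \<le> foot q z"
    and "\<And>z. z \<in> S \<Longrightarrow> \<exists>c>0. lin c z < lin c q \<and> lin c z < c \<and> (\<forall>w\<in>S. w \<noteq> z \<longrightarrow> lin c z < lin c w)"
  shows "\<exists>zs. distinct zs \<and> set zs = S \<and> ordered_chain q \<xi> zs"
  using assms
proof (induction "card S" arbitrary: S q \<xi>)
  case 0
  then show ?case by (intro exI[of _ "[]"]) auto
next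
  case (Suc n)
  then have "S \<noteq> {}" by auto
  obtain x y where q: "q = (x, y)" by (cases q)
  \<comment> \<open>The next vertex is the point with the leftmost foot; all other points then lie
    on or to the right of the line through \<open>q\<close> and \<open>v\<close>.\<close>
  define v where "v = (ARG_MIN (foot q) z. z \<in> S)"
  have v: "v \<in> S" and v_min: "\<And>w. w \<in> S \<Longrightarrow> foot q v \<le> foot q w"
    using arg_min_if_finite[OF Suc.prems(1) \<open>S \<noteq> {}\<close>, of "foot q"]
    by (auto simp: v_def arg_min_on_def not_less)
  define f where "f = foot q v"
  define h where "h = snd v"
  have h: "0 \<le> h" "h < y" using Suc.prems(2)[OF v] by (auto simp: h_def q)
  then have y: "0 < y" by simp
  have fst_eq: "fst w = x + (foot q w - x) * ((y - snd w) / y)" if "snd w < y" for w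
    using that y by (simp add: foot_def q)
  \<comment> \<open>The foot lies on the ray from \<open>q\<close> through \<open>v\<close>, not
    before \<open>v\<close>, and \<open>lin c\<close> decreases along this ray; so its value
    \<open>c * f\<close> at the foot is below \<open>c\<close>.\<close>
  have f1: "foot q v \<le> 1"
  proof -
    obtain c where c: "c > 0" "lin c v < lin c q" "lin c v < c" using Suc.prems(3)[OF v] by blast
    define k where "k = y / (y - h)"
    have k: "1 \<le> k" using h by (simp add: k_def field_simps)
    have hk: "(h - y) * k = - y" using h by (simp add: k_def field_simps)
    have f: "f = x + (fst v - x) * k" by (simp add: f_def foot_def q k_def h_def)
    have "c * f = c * x + c * (fst v - x) * k" unfolding f by (simp only: distrib_left mult.assoc)
    moreover have "(lin c v - lin c q) * k = c * (fst v - x) * k + (h - y) * k"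
      by (simp add: lin_def q h_def algebra_simps)
    moreover have "lin c q = c * x + y" by (simp add: lin_def q)
    ultimately have "c * f = lin c q + (lin c v - lin c q) * k" using hk by linarith
    also have "\<dots> \<le> lin c q + (lin c v - lin c q) * 1"
      using c k by (intro add_left_mono mult_left_mono_neg) auto
    also have "\<dots> < c" using c by simp
    finally show ?thesis using c by (simp add: f_def)
  qed
  have IH: "\<exists>zs. distinct zs \<and> set zs = S - {v} \<and> ordered_chain v f zs"
  proof (rule Suc.hyps(1))
    show "n = card (S - {v})" using Suc.hyps(2) v Suc.prems(1) by simp
    show "finite (S - {v})" using Suc.prems(1) by simp
    fix w assume "w \<in> S - {v}"
    then have w: "w \<in> S" "w \<noteq> v" by auto
    obtain d where d: "d > 0" "lin d w < lin d q" "lin d w < d" "\<And>z. z \<in> S \<Longrightarrow> z \<noteq> w \<Longrightarrow> lin d w < lin d z"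
      using Suc.prems(3)[OF w(1)] by blast
    have dv: "lin d w < lin d v" using d(4)[OF v] w by auto
    show "\<exists>c>0. lin c w < lin c v \<and> lin c w < c \<and> (\<forall>z\<in>S - {v}. z \<noteq> w \<longrightarrow> lin c w < lin c z)"
      using d dv by (intro exI[of _ d]) auto
    have w2: "0 \<le> snd w" "snd w < y" using Suc.prems(2)[OF w(1)] by (auto simp: q)
    have "(f - x) * ((y - snd w) / y) \<le> (foot q w - x) * ((y - snd w) / y)"
      using v_min[OF w(1)] w2 y by (intro mult_right_mono) (auto simp: f_def)
    then have w1: "x + (f - x) * ((y - snd w) / y) \<le> fst w" using fst_eq[OF w2(2)] by linarith
    have v1: "fst v = x + (f - x) * ((y - h) / y)" using fst_eq[of v] h by (simp add: f_def h_def)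
    \<comment> \<open>Otherwise the point of the line through \<open>q\<close> and \<open>v\<close>
      at the height of \<open>w\<close> lies between them, where \<open>lin d\<close> exceeds
      \<open>lin d w\<close>; but \<open>w\<close> is not to the left of it and so has at least the
      same value.\<close>
    have lt: "snd w < h"
    proof (rule ccontr)
      assume "\<not> snd w < h"
      define t where "t = (y - snd w) / (y - h)"
      have t: "0 < t" "t \<le> 1" using \<open>\<not> snd w < h\<close> w2 h by (auto simp: t_def field_simps)
      have tw: "t * (y - h) = y - snd w" using h by (simp add: t_def)
      have "lin d w = (1 - t) * lin d w + t * lin d w" by (simp add: algebra_simps)
      also have "\<dots> < (1 - t) * lin d q + t * lin d v"
        using d(2) dv t by (intro add_le_less_mono mult_left_mono mult_strict_left_mono) auto
      also have "\<dots> = d * (x + (f - x) * ((t * (y - h)) / y)) + (y - t * (y - h))"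
        by (simp add: lin_def q v1 h_def[symmetric]) (simp add: algebra_simps)
      also have "\<dots> \<le> d * fst w + snd w"
        using mult_left_mono[OF w1, of d] d(1) unfolding tw by simp
      finally show False by (simp add: lin_def)
    qed
    \<comment> \<open>The foot of the line through \<open>q\<close> and \<open>v\<close>, computed
      from \<open>v\<close> and the point of the line at the height of \<open>w\<close>.\<close>
    have "f = fst v + (x + (f - x) * ((y - snd w) / y) - fst v) * (h / (h - snd w))"
    proof -
      have "x + (f - x) * ((y - snd w) / y) - fst v = (f - x) * (((y - snd w) - (y - h)) / y)"
        unfolding v1 by (simp add: diff_divide_distrib algebra_simps)
      also have "\<dots> = (f - x) / y * (h - snd w)" by simp
      finally have "(x + (f - x) * ((y - snd w) / y) - fst v) * (h / (h - snd w)) = (f - x) / y * h"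
        using lt by simp
      then show ?thesis unfolding v1 using y by (simp add: field_simps)
    qed
    also have "\<dots> \<le> fst v + (fst w - fst v) * (h / (h - snd w))"
      using w1 lt h by (intro add_left_mono mult_right_mono) auto
    also have "\<dots> = foot v w" by (simp add: foot_def h_def)
    finally show "0 \<le> snd w \<and> snd w < snd v \<and> f \<le> foot v w"
      using lt w2 by (simp add: h_def)
  qed
  then obtain zs where "distinct zs" "set zs = S - {v}" "ordered_chain v f zs" by blast
  then show ?case
    using v f1 Suc.prems(2)[OF v] by (intro exI[of _ "v # zs"]) (auto simp: f_def)
qed

lemma cchain_ordered:
  assumes "finite S" "cchain S"
  obtains zs where "distinct zs" "set zs = S" "ordered_chain p0 0 zs"
proof -
  have "\<exists>zs. distinct zs \<and> set zs = S \<and> ordered_chain p0 0 zs"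
  proof (rule ex_ordered_chain[OF assms(1)])
    fix z assume z: "z \<in> S"
    obtain c where c: "c > 0" "lin c z < 1" "lin c z < c" "\<forall>w\<in>S. w \<noteq> z \<longrightarrow> lin c z < lin c w"
      using cchainD(2)[OF assms(2) z] by blast
    then show "\<exists>c>0. lin c z < lin c p0 \<and> lin c z < c \<and> (\<forall>w\<in>S. w \<noteq> z \<longrightarrow> lin c z < lin c w)"
      by (intro exI[of _ c]) (auto simp: lin_def p0_def)
    have T: "0 \<le> fst z" "0 \<le> snd z" "fst z + snd z \<le> 1" using cchainD(1)[OF assms(2) z] by (auto simp: T_iff)
    have "0 \<le> c * fst z" using c T by simp
    then have "snd z < 1" using c(2) by (simp add: lin_def)
    then show "0 \<le> snd z \<and> snd z < snd p0 \<and> 0 \<le> foot p0 z"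
      using T by (simp add: p0_def foot_def)
  qed
  then show ?thesis using that by blast
qed

lemma borel_measurable_fst':
  fixes f :: "'w \<Rightarrow> real \<times> real"
  assumes "f \<in> borel_measurable N"
  shows "(\<lambda>x. fst (f x)) \<in> borel_measurable N"
proof -
  have "(\<lambda>z :: real \<times> real. fst z) \<in> borel_measurable borel"
    by (intro borel_measurable_continuous_onI continuous_intros)
  then show ?thesis using measurable_compose[OF assms] by blast
qed

lemma borel_measurable_snd':
  fixes f :: "'w \<Rightarrow> real \<times> real"
  assumes "f \<in> borel_measurable N"
  shows "(\<lambda>x. snd (f x)) \<in> borel_measurable N"
proof -
  have "(\<lambda>z :: real \<times> real. snd z) \<in> borel_measurable borel"
    by (intro borel_measurable_continuous_onI continuous_intros)
  then show ?thesis using measurable_compose[OF assms] by blast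
qed

lemma pred_ordered_chain:
  fixes N :: "(nat \<Rightarrow> real \<times> real) measure"
  assumes "Q \<in> borel_measurable N" "\<xi> \<in> borel_measurable N"
    "\<And>i. i \<in> set js \<Longrightarrow> (\<lambda>x. x i) \<in> borel_measurable N"
  shows "Measurable.pred N (\<lambda>x. ordered_chain (Q x) (\<xi> x) (map x js))"
  using assms
proof (induction js arbitrary: Q \<xi>)
  case (Cons i js)
  have xi: "(\<lambda>x. x i) \<in> borel_measurable N" using Cons.prems by simp
  note [measurable] = Cons.prems(2) borel_measurable_fst'[OF Cons.prems(1)] borel_measurable_snd'[OF Cons.prems(1)]
    borel_measurable_fst'[OF xi] borel_measurable_snd'[OF xi]
  have foot [measurable]: "(\<lambda>x. foot (Q x) (x i)) \<in> borel_measurable N" unfolding foot_def by measurable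
  have [measurable]: "Measurable.pred N (\<lambda>x. ordered_chain (x i) (foot (Q x) (x i)) (map x js))"
    using Cons.prems by (intro Cons.IH xi foot) auto
  have le: "Measurable.pred N (\<lambda>x. a x \<le> b x)"
    if "a \<in> borel_measurable N" "b \<in> borel_measurable N" for a b :: "_ \<Rightarrow> real"
    unfolding pred_def by (rule borel_measurable_le[OF that])
  show ?case unfolding list.map ordered_chain.simps
    by (intro pred_intros_logic borel_measurable_pred_less le borel_measurable_const
        borel_measurable_snd'[OF Cons.prems(1)] borel_measurable_snd'[OF xi] Cons.prems(2) foot) fact
qed simp

text \<open>With the height \<open>h\<close> and the foot \<open>f\<close> of \<open>z\<close> as
  coordinates the area element is \<open>(1 - h / y) dh df\<close> for \<open>y = snd q\<close>, so
  the integral factors. The base of the power is twice the area of the triangle that is left for the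
  later points.\<close>

lemma nn_integral_foot:
  fixes q :: "real \<times> real"
  assumes q: "0 < snd q" and xi: "\<xi> \<le> 1"
  shows "(\<integral>\<^sup>+z. ennreal ((snd z * (1 - foot q z)) ^ k) *
      indicator {z. 0 \<le> snd z \<and> snd z < snd q \<and> \<xi> \<le> foot q z \<and> foot q z \<le> 1} z \<partial>lborel)
    \<le> ennreal ((snd q * (1 - \<xi>)) ^ Suc k / (real (Suc k) * real (Suc k) * real (Suc (Suc k))))"
proof -
  obtain x y where xy: "q = (x, y)" by (cases q)
  have y: "0 < y" using q by (simp add: xy)
  define G where "G h f = ennreal ((h * (1 - f)) ^ k) * indicator {0..<y} h * indicator {\<xi>..1} f" for h f
  define ft where "ft u h = x + (u - x) * (y / (y - h))" for u h
  have G [measurable]: "(\<lambda>z. G (snd z) (ft (fst z) (snd z))) \<in> borel_measurable (lborel \<Otimes>\<^sub>M lborel)"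
    unfolding G_def ft_def by measurable
  have "(\<integral>\<^sup>+z. ennreal ((snd z * (1 - foot q z)) ^ k) *
      indicator {z. 0 \<le> snd z \<and> snd z < snd q \<and> \<xi> \<le> foot q z \<and> foot q z \<le> 1} z \<partial>lborel)
    = (\<integral>\<^sup>+z. G (snd z) (ft (fst z) (snd z)) \<partial>(lborel \<Otimes>\<^sub>M lborel))"
    unfolding lborel_prod
    by (intro nn_integral_cong) (auto simp: G_def ft_def foot_def xy indicator_def)
  also have "\<dots> = (\<integral>\<^sup>+h. \<integral>\<^sup>+u. G h (ft u h) \<partial>lborel \<partial>lborel)"
    using G by (subst lborel_pair.nn_integral_snd[symmetric]) auto
  also have "\<dots> = (\<integral>\<^sup>+h. ennreal ((y - h) / y * h ^ k * ((1 - \<xi>) ^ Suc k / Suc k)) * indicator {0..<y} h \<partial>lborel)"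
  proof (intro nn_integral_cong)
    fix h :: real
    show "(\<integral>\<^sup>+u. G h (ft u h) \<partial>lborel) =
      ennreal ((y - h) / y * h ^ k * ((1 - \<xi>) ^ Suc k / Suc k)) * indicator {0..<y} h"
    proof (cases "h \<in> {0..<y}")
      case False
      then show ?thesis by (simp add: G_def)
    next
      case True
      then have h: "0 \<le> h" "h < y" by auto
      define c where "c = (y - h) / y"
      have c: "c > 0" using h y by (simp add: c_def)
      have ft: "ft ((x - x * c) + c * f) h = f" for f
      proof -
        define k where "k = y / (y - h)"
        have ck: "c * k = 1" using h y by (simp add: c_def k_def)
        have "ft ((x - x * c) + c * f) h = x + (x - x * c + c * f - x) * k" by (simp only: ft_def k_def)
        also have "\<dots> = x + (f - x) * (c * k)" by (simp add: algebra_simps)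
        finally show ?thesis unfolding ck by simp
      qed
      have "(\<integral>\<^sup>+u. G h (ft u h) \<partial>lborel) = ennreal \<bar>c\<bar> * (\<integral>\<^sup>+f. G h (ft ((x - x * c) + c * f) h) \<partial>lborel)"
        using c by (intro nn_integral_real_affine) (auto simp: G_def ft_def)
      also have "\<dots> = ennreal \<bar>c\<bar> * (\<integral>\<^sup>+f. G h f \<partial>lborel)" by (simp only: ft)
      also have "(\<integral>\<^sup>+f. G h f \<partial>lborel) = (\<integral>\<^sup>+f. ennreal (h ^ k) * (ennreal ((1 - f) ^ k) * indicator {\<xi>..1} f) \<partial>lborel)"
        using h y by (intro nn_integral_cong) (auto simp: G_def indicator_def power_mult_distrib ennreal_mult)
      also have "\<dots> = ennreal (h ^ k) * (\<integral>\<^sup>+f. ennreal ((1 - f) ^ k) * indicator {\<xi>..1} f \<partial>lborel)"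
        by (intro nn_integral_cmult) measurable
      also have "(\<integral>\<^sup>+f. ennreal ((1 - f) ^ k) * indicator {\<xi>..1} f \<partial>lborel)
          = ennreal (- ((1 - 1) ^ Suc k / Suc k) - (- ((1 - \<xi>) ^ Suc k / Suc k)))"
      proof (rule nn_integral_FTC_Icc)
        fix f :: real assume "f \<in> {\<xi>..1}"
        show "((\<lambda>f. - ((1 - f) ^ Suc k / Suc k)) has_real_derivative (1 - f) ^ k) (at f)"
          by (auto intro!: derivative_eq_intros simp del: power_Suc)
      qed (use xi in auto)
      finally show ?thesis
        using h y c xi True by (simp add: c_def ennreal_mult[symmetric] mult.assoc)
    qed
  qed
  also have "\<dots> \<le> (\<integral>\<^sup>+h. ennreal ((y - h) / y * h ^ k * ((1 - \<xi>) ^ Suc k / Suc k)) * indicator {0..y} h \<partial>lborel)"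
    by (intro nn_integral_mono) (auto simp: indicator_def)
  also have "\<dots> = ennreal ((y ^ Suc k / Suc k - y ^ Suc (Suc k) / (Suc (Suc k) * y)) * ((1 - \<xi>) ^ Suc k / Suc k)
      - (0 ^ Suc k / Suc k - 0 ^ Suc (Suc k) / (Suc (Suc k) * y)) * ((1 - \<xi>) ^ Suc k / Suc k))"
  proof (rule nn_integral_FTC_Icc)
    fix h :: real assume h: "h \<in> {0..y}"
    have "((\<lambda>h. (h ^ Suc k / Suc k - h ^ Suc (Suc k) / (Suc (Suc k) * y)) * ((1 - \<xi>) ^ Suc k / Suc k)) has_real_derivative
        (real (Suc k) * h ^ (Suc k - Suc 0) / Suc k - real (Suc (Suc k)) * h ^ (Suc (Suc k) - Suc 0) / (Suc (Suc k) * y))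
          * ((1 - \<xi>) ^ Suc k / Suc k)) (at h)"
      by (intro DERIV_cmult_right DERIV_diff DERIV_cdivide DERIV_pow)
    moreover have "real (Suc k) * h ^ (Suc k - Suc 0) / Suc k - real (Suc (Suc k)) * h ^ (Suc (Suc k) - Suc 0) / (Suc (Suc k) * y)
        = h ^ k - h ^ Suc k / y"
      by (simp del: of_nat_Suc)
    moreover have "h ^ k - h ^ Suc k / y = (y - h) / y * h ^ k" using y by (simp add: field_simps)
    ultimately show "((\<lambda>h. (h ^ Suc k / Suc k - h ^ Suc (Suc k) / (Suc (Suc k) * y)) * ((1 - \<xi>) ^ Suc k / Suc k)) has_real_derivative
        (y - h) / y * h ^ k * ((1 - \<xi>) ^ Suc k / Suc k)) (at h)" by simp
    show "0 \<le> (y - h) / y * h ^ k * ((1 - \<xi>) ^ Suc k / Suc k)"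
      using h y xi by (intro mult_nonneg_nonneg divide_nonneg_nonneg zero_le_power) auto
  qed (use y in auto)
  also have "(y ^ Suc k / Suc k - y ^ Suc (Suc k) / (Suc (Suc k) * y)) * ((1 - \<xi>) ^ Suc k / Suc k)
      - (0 ^ Suc k / Suc k - 0 ^ Suc (Suc k) / (Suc (Suc k) * y)) * ((1 - \<xi>) ^ Suc k / Suc k)
    = (y * (1 - \<xi>)) ^ Suc k / (real (Suc k) * real (Suc k) * real (Suc (Suc k)))"
  proof -
    have "y ^ Suc k / Suc k - y ^ Suc (Suc k) / (Suc (Suc k) * y) = y ^ Suc k / (real (Suc k) * real (Suc (Suc k)))"
      using y by (simp add: divide_simps) (simp add: algebra_simps)
    then show ?thesis by (simp add: power_mult_distrib ac_simps)
  qed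
  finally show ?thesis by (simp add: xy)
qed

definition chain_density :: real where
  "chain_density = 1 / measure lborel T"

text \<open>Equal to \<open>chain_density ^ k / (fact k ^ 2 * fact (k + 1))\<close>; the denominator
  of the recursion is that of \<open>nn_integral_foot\<close>.\<close>

primrec chain_coeff :: "nat \<Rightarrow> real" where
  "chain_coeff 0 = 1"
| "chain_coeff (Suc k) = chain_density * chain_coeff k / (real (Suc k) * real (Suc k) * real (Suc (Suc k)))"

lemma measure_T_pos: "0 < measure lborel T"
  using emeasure_T by (simp add: measure_def enn2real_positive_iff less_top zero_less_iff_neq_zero)

lemma chain_density_pos: "0 < chain_density"
  using measure_T_pos by (simp add: chain_density_def)

lemma chain_coeff_nonneg: "0 \<le> chain_coeff k"
  using chain_density_pos by (induction k) auto

lemma chain_coeff_le: "chain_coeff k \<le> chain_density ^ k / fact k ^ 3"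
proof (induction k)
  case (Suc k)
  have "chain_coeff (Suc k) \<le> chain_density * (chain_density ^ k / fact k ^ 3) / (real (Suc k) * real (Suc k) * real (Suc k))"
    unfolding chain_coeff.simps using chain_density_pos Suc.IH
    by (intro frac_le mult_left_mono mult_nonneg_nonneg) auto
  also have "\<dots> = chain_density ^ Suc k / fact (Suc k) ^ 3"
    by (simp add: power3_eq_cube)
  finally show ?case .
qed simp

lemma nn_integral_\<mu>_le:
  assumes "f \<in> borel_measurable borel"
  shows "(\<integral>\<^sup>+z. f z \<partial>\<mu>) \<le> ennreal chain_density * (\<integral>\<^sup>+z. f z \<partial>lborel)"
proof -
  have eq: "emeasure lborel T = ennreal (measure lborel T)"
    using emeasure_T by (simp add: emeasure_eq_ennreal_measure)
  have "(\<integral>\<^sup>+z. f z \<partial>\<mu>) = (\<integral>\<^sup>+z. f z * indicator T z \<partial>lborel) / emeasure lborel T"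
    unfolding \<mu>_def using assms by (intro nn_integral_uniform_measure) auto
  also have "\<dots> \<le> (\<integral>\<^sup>+z. f z \<partial>lborel) / emeasure lborel T"
    by (intro divide_right_mono_ennreal nn_integral_mono) (auto simp: indicator_def)
  also have "\<dots> = ennreal chain_density * (\<integral>\<^sup>+z. f z \<partial>lborel)"
    unfolding eq chain_density_def using measure_T_pos
    by (simp add: divide_ennreal_def inverse_ennreal inverse_eq_divide mult.commute)
  finally show ?thesis .
qed

text \<open>Once the first point \<open>z\<close> is fixed, the others must form an ordered chain in
  the triangle below \<open>z\<close> and to the right of its foot. Their probability is bounded by
  a power of its area, which \<open>nn_integral_foot\<close> integrates over
  \<open>z\<close>.\<close>

lemma emeasure_ordered_chain_le:
  fixes I :: "nat set"
  assumes "finite I" "distinct js" "set js \<subseteq> I"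
  shows "emeasure (PiM I (\<lambda>_. \<mu>)) {x \<in> space (PiM I (\<lambda>_. \<mu>)). ordered_chain q \<xi> (map x js)}
    \<le> ennreal (chain_coeff (length js) * (snd q * (1 - \<xi>)) ^ length js)"
  using assms
proof (induction js arbitrary: I q \<xi>)
  case Nil
  interpret P: prob_space "PiM I (\<lambda>_. \<mu>)" by (intro prob_space_PiM prob_space_\<mu>)
  show ?case by (simp add: P.emeasure_le_1)
next
  case (Cons i js)
  interpret product_sigma_finite "\<lambda>_ :: nat. \<mu>" by standard
  define J where "J = I - {i}"
  define k where "k = length js"
  have J: "finite J" "i \<notin> J" "I = insert i J" "set js \<subseteq> J" "distinct js" "i \<notin> set js"
    using Cons.prems by (auto simp: J_def)
  let ?A = "\<lambda>(I :: nat set) q \<xi> js. {x \<in> space (PiM I (\<lambda>_. \<mu>)). ordered_chain q \<xi> (map x js)}"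
  have meas: "?A I q \<xi> js \<in> sets (PiM I (\<lambda>_. \<mu>))" if "set js \<subseteq> I" for I :: "nat set" and q \<xi> js
  proof -
    have "(\<lambda>x. x i) \<in> borel_measurable (PiM I (\<lambda>_. \<mu>))" if "i \<in> set js" for i
      using measurable_component_singleton[of i I "\<lambda>_. \<mu>"] that \<open>set js \<subseteq> I\<close> by auto
    then have "Measurable.pred (PiM I (\<lambda>_. \<mu>)) (\<lambda>x. ordered_chain q \<xi> (map x js))"
      using pred_ordered_chain[where Q="\<lambda>_. q" and N="PiM I (\<lambda>_. \<mu>)" and \<xi>="\<lambda>_. \<xi>" and js=js] by simp
    then show ?thesis by (simp add: pred_def)
  qed
  have mI: "?A I q \<xi> (i # js) \<in> sets (PiM (insert i J) (\<lambda>_. \<mu>))"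
    unfolding J(3)[symmetric] by (rule meas) (rule Cons.prems)
  have mJ: "?A J z f js \<in> sets (PiM J (\<lambda>_. \<mu>))" for z f
    by (rule meas) (rule J)
  show ?case
  proof (cases "0 < snd q \<and> \<xi> \<le> 1")
    case False
    \<comment> \<open>Without height or base there is no room for a first point.\<close>
    then have empty: "?A I q \<xi> (i # js) = {}" by auto
    show ?thesis unfolding empty by (simp only: emeasure_empty zero_le)
  next
    case True
    define D where "D = {z. 0 \<le> snd z \<and> snd z < snd q \<and> \<xi> \<le> foot q z \<and> foot q z \<le> 1}"
    have g: "(\<lambda>z. ennreal ((snd z * (1 - foot q z)) ^ k) * indicator D z) \<in> borel_measurable borel"
    proof -
      have s: "(\<lambda>z. snd z) \<in> borel_measurable (borel :: (real \<times> real) measure)"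
        "(\<lambda>z. fst z) \<in> borel_measurable (borel :: (real \<times> real) measure)"
        using borel_measurable_fst'[OF measurable_ident] borel_measurable_snd'[OF measurable_ident] by simp_all
      have foot: "(\<lambda>z. foot q z) \<in> borel_measurable borel"
        unfolding foot_def by (intro borel_measurable_add borel_measurable_times borel_measurable_divide
            borel_measurable_diff borel_measurable_const s)
      have "D \<in> sets borel"
      proof -
        have D: "D = {z \<in> space borel. 0 \<le> snd z} \<inter> {z \<in> space borel. snd z < snd q} \<inter>
            {z \<in> space borel. \<xi> \<le> foot q z} \<inter> {z \<in> space borel. foot q z \<le> 1}"
          by (auto simp: D_def)
        show ?thesis
          unfolding D by (intro sets.Int borel_measurable_le borel_measurable_less borel_measurable_const s foot)
      qed
      moreover have "(\<lambda>z. (snd z * (1 - foot q z)) ^ k) \<in> borel_measurable borel"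
        by (intro borel_measurable_power borel_measurable_times borel_measurable_diff borel_measurable_const s foot)
      ultimately show ?thesis
        by (intro borel_measurable_times_ennreal borel_measurable_indicator measurable_compose[OF _ measurable_ennreal])
    qed
    have "emeasure (PiM I (\<lambda>_. \<mu>)) (?A I q \<xi> (i # js)) =
        (\<integral>\<^sup>+x. indicator (?A I q \<xi> (i # js)) x \<partial>PiM (insert i J) (\<lambda>_. \<mu>))"
      unfolding nn_integral_indicator[OF mI] by (simp only: J(3)[symmetric])
    also have "\<dots> = (\<integral>\<^sup>+z. \<integral>\<^sup>+x. indicator (?A I q \<xi> (i # js)) (x(i := z)) \<partial>PiM J (\<lambda>_. \<mu>) \<partial>\<mu>)"
      by (intro product_nn_integral_insert_rev J borel_measurable_indicator mI)
    also have "\<dots> \<le> (\<integral>\<^sup>+z. ennreal (chain_coeff k) * (ennreal ((snd z * (1 - foot q z)) ^ k) * indicator D z) \<partial>\<mu>)"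
    proof (intro nn_integral_mono)
      fix z
      have map: "map (x(i := z)) js = map x js" for x :: "nat \<Rightarrow> real \<times> real" using J by auto
      have "(\<integral>\<^sup>+x. indicator (?A I q \<xi> (i # js)) (x(i := z)) \<partial>PiM J (\<lambda>_. \<mu>))
          \<le> (\<integral>\<^sup>+x. indicator D z * indicator (?A J z (foot q z) js) x \<partial>PiM J (\<lambda>_. \<mu>))"
      proof (intro nn_integral_mono)
        fix x assume x: "x \<in> space (PiM J (\<lambda>_. \<mu>))"
        show "indicator (?A I q \<xi> (i # js)) (x(i := z)) \<le> (indicator D z * indicator (?A J z (foot q z) js) x :: ennreal)"
          using x by (auto simp: indicator_def D_def map)
      qed
      also have "\<dots> = indicator D z * emeasure (PiM J (\<lambda>_. \<mu>)) (?A J z (foot q z) js)"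
        using mJ by (subst nn_integral_cmult) auto
      also have "\<dots> \<le> indicator D z * ennreal (chain_coeff k * (snd z * (1 - foot q z)) ^ k)"
        unfolding k_def using J by (intro mult_left_mono Cons.IH) auto
      also have "\<dots> = ennreal (chain_coeff k) * (ennreal ((snd z * (1 - foot q z)) ^ k) * indicator D z)"
        using chain_coeff_nonneg[of k] by (auto simp: indicator_def D_def ennreal_mult)
      finally show "(\<integral>\<^sup>+x. indicator (?A I q \<xi> (i # js)) (x(i := z)) \<partial>PiM J (\<lambda>_. \<mu>))
        \<le> ennreal (chain_coeff k) * (ennreal ((snd z * (1 - foot q z)) ^ k) * indicator D z)" .
    qed
    also have "\<dots> \<le> ennreal chain_density *
        (\<integral>\<^sup>+z. ennreal (chain_coeff k) * (ennreal ((snd z * (1 - foot q z)) ^ k) * indicator D z) \<partial>lborel)"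
      by (rule nn_integral_\<mu>_le[OF borel_measurable_times_ennreal[OF borel_measurable_const g]])
    also have "\<dots> = ennreal chain_density * (ennreal (chain_coeff k) *
        (\<integral>\<^sup>+z. ennreal ((snd z * (1 - foot q z)) ^ k) * indicator D z \<partial>lborel))"
      using g by (subst nn_integral_cmult) auto
    also have "\<dots> \<le> ennreal chain_density * (ennreal (chain_coeff k) *
        ennreal ((snd q * (1 - \<xi>)) ^ Suc k / (real (Suc k) * real (Suc k) * real (Suc (Suc k)))))"
      unfolding D_def using True by (intro mult_left_mono nn_integral_foot) auto
    also have "\<dots> = ennreal (chain_coeff (Suc k) * (snd q * (1 - \<xi>)) ^ Suc k)"
    proof -
      define X where "X = (snd q * (1 - \<xi>)) ^ Suc k / (real (Suc k) * real (Suc k) * real (Suc (Suc k)))"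
      have "0 \<le> X" unfolding X_def using True
        by (intro divide_nonneg_nonneg zero_le_power mult_nonneg_nonneg) auto
      then have "ennreal chain_density * (ennreal (chain_coeff k) * ennreal X) = ennreal (chain_density * (chain_coeff k * X))"
        using chain_density_pos chain_coeff_nonneg[of k] by (simp add: ennreal_mult)
      also have "chain_density * (chain_coeff k * X) = chain_coeff (Suc k) * (snd q * (1 - \<xi>)) ^ Suc k"
        unfolding X_def chain_coeff.simps by (simp only: times_divide_eq_right times_divide_eq_left mult.assoc)
      finally show ?thesis unfolding X_def .
    qed
    finally show ?thesis by (simp add: k_def)
  qed
qed

text \<open>A single term of the exponential series, in place of Stirling's formula.\<close>

lemma power_le_exp_fact: "real k ^ k \<le> exp (real k) * fact k"
proof -
  have "real k ^ k / fact k \<le> exp (real k)"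
  proof -
    have s: "(\<lambda>n. real k ^ n / fact n) sums exp (real k)"
      using exp_converges[of "real k"] by (simp add: field_simps)
    have "(\<Sum>n\<in>{k}. real k ^ n / fact n) \<le> exp (real k)"
      using s by (intro sum_le_suminf[of _ "{k}", THEN order_trans]) (auto simp: sums_iff)
    then show ?thesis by simp
  qed
  then show ?thesis by (simp add: field_simps)
qed

text \<open>A union bound over the at most \<open>n ^ k\<close> lists of distinct indices: a longest
  chain contains a chain of exactly \<open>k\<close> points, and its order determines the
  list.\<close>

lemma emeasure_maxlen_ge:
  "emeasure (PiM {..<n} (\<lambda>_. \<mu>)) {x \<in> space (PiM {..<n} (\<lambda>_. \<mu>)). k \<le> maxlen cchain (x ` {..<n})}
    \<le> ennreal (real n ^ k * chain_coeff k)"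
proof -
  let ?P = "PiM {..<n} (\<lambda>_. \<mu>)"
  define L where "L = {js. set js \<subseteq> {..<n} \<and> length js = k \<and> distinct js}"
  let ?A = "\<lambda>js. {x \<in> space ?P. ordered_chain p0 0 (map x js)}"
  have fL: "finite L" "card L \<le> n ^ k"
  proof -
    have sub: "L \<subseteq> {js. set js \<subseteq> {..<n} \<and> length js = k}" by (auto simp: L_def)
    show "finite L" by (rule finite_subset[OF sub]) (simp add: finite_lists_length_eq)
    show "card L \<le> n ^ k"
      using card_mono[OF _ sub] by (simp add: finite_lists_length_eq card_lists_length_eq)
  qed
  have meas: "?A js \<in> sets ?P" if "js \<in> L" for js
  proof -
    have "(\<lambda>x. x i) \<in> borel_measurable ?P" if "i \<in> set js" for i
      using measurable_component_singleton[of i "{..<n}" "\<lambda>_. \<mu>"] that \<open>js \<in> L\<close> by (auto simp: L_def)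
    then have "Measurable.pred ?P (\<lambda>x. ordered_chain p0 0 (map x js))"
      using pred_ordered_chain[where Q="\<lambda>_. p0" and N="?P" and \<xi>="\<lambda>_. 0" and js=js] by simp
    then show ?thesis by (simp add: pred_def)
  qed
  have "{x \<in> space ?P. k \<le> maxlen cchain (x ` {..<n})} \<subseteq> (\<Union>js\<in>L. ?A js)"
  proof
    fix x assume "x \<in> {x \<in> space ?P. k \<le> maxlen cchain (x ` {..<n})}"
    then have x: "x \<in> space ?P" "k \<le> maxlen cchain (x ` {..<n})" by auto
    interpret hereditary cchain by (rule hereditary_cchain)
    obtain S where S: "S \<subseteq> x ` {..<n}" "cchain S" "card S = maxlen cchain (x ` {..<n})"
      using maxlen_attained[of "x ` {..<n}"] by blast
    obtain R where R: "R \<subseteq> S" "card R = k" using x(2) S(3) obtain_subset_with_card_n by metis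
    have "finite R" using R S(1) by (meson finite_imageI finite_lessThan finite_subset)
    then obtain zs where zs: "distinct zs" "set zs = R" "ordered_chain p0 0 zs"
      using cchain_ordered[of R] cchain_subset[OF S(2) R(1)] by blast
    define g where "g = inv_into {..<n} x"
    have "R \<subseteq> x ` {..<n}" using R S by blast
    have gx: "g z \<in> {..<n}" "x (g z) = z" if "z \<in> R" for z
      using that \<open>R \<subseteq> x ` {..<n}\<close> inv_into_into[of z x "{..<n}"] f_inv_into_f[of z x "{..<n}"]
      by (auto simp: g_def simp del: lessThan_iff)
    have "map x (map g zs) = zs" "set (map g zs) \<subseteq> {..<n}"
      using zs gx by (auto intro!: map_idI simp del: lessThan_iff)
    moreover have "inj_on g (set zs)"
      using inj_on_inv_into[OF \<open>R \<subseteq> x ` {..<n}\<close>] zs by (simp add: g_def)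
    ultimately have "map g zs \<in> L" "x \<in> ?A (map g zs)"
      using x zs R by (auto simp: L_def distinct_map distinct_card[symmetric])
    then show "x \<in> (\<Union>js\<in>L. ?A js)" by blast
  qed
  then have "emeasure ?P {x \<in> space ?P. k \<le> maxlen cchain (x ` {..<n})} \<le> emeasure ?P (\<Union>js\<in>L. ?A js)"
    using fL meas by (intro emeasure_mono sets.finite_UN) auto
  also have "\<dots> \<le> (\<Sum>js\<in>L. emeasure ?P (?A js))"
    using fL meas by (intro emeasure_subadditive_finite) auto
  also have "\<dots> \<le> (\<Sum>js\<in>L. ennreal (chain_coeff k))"
    using emeasure_ordered_chain_le[of "{..<n}" _ p0 0]
    by (intro sum_mono) (force simp: L_def p0_def)
  also have "\<dots> = ennreal (real (card L) * chain_coeff k)"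
    using chain_coeff_nonneg[of k] by (simp add: ennreal_of_nat_eq_real_of_nat ennreal_mult)
  also have "\<dots> \<le> ennreal (real n ^ k * chain_coeff k)"
    using fL(2) chain_coeff_nonneg[of k]
    by (intro ennreal_leI mult_right_mono) (simp_all flip: of_nat_power)
  finally show ?thesis .
qed

section \<open>Growth of the mean length\<close>

lemma avg_one_eq: "avg 1 n {} = (\<integral>x. real (maxlen cchain (x ` {..<n})) \<partial>PiM {..<n} (\<lambda>_. \<mu>))"
  and integrable_maxlen_\<mu>: "integrable (PiM {..<n} (\<lambda>_. \<mu>)) (\<lambda>x. real (maxlen cchain (x ` {..<n})))"
proof -
  have "scaling 1 (\<lambda>z. z)" by (simp add: scaling_def)
  from integral_maxlen_scaling[OF this, of "{..<n}"]
  show "avg 1 n {} = (\<integral>x. real (maxlen cchain (x ` {..<n})) \<partial>PiM {..<n} (\<lambda>_. \<mu>))"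
    "integrable (PiM {..<n} (\<lambda>_. \<mu>)) (\<lambda>x. real (maxlen cchain (x ` {..<n})))"
    by simp_all
qed

lemma avg_upper_bound: "\<exists>C>0. \<forall>n>0. avg 1 n {} \<le> C * real n powr (1 / 3)"
proof -
  \<comment> \<open>Three factors \<open>exp 1\<close> pay for replacing \<open>fact k ^ 3\<close>
    by \<open>k ^ (3 * k)\<close>; the fourth leaves the decay \<open>exp (- k)\<close> as soon as
    \<open>k \<ge> c * n^(1/3)\<close>.\<close>
  define c where "c = (chain_density * exp 4) powr (1 / 3)"
  have c0: "c > 0" using chain_density_pos by (simp add: c_def)
  have c3: "c ^ 3 = chain_density * exp 4"
    using chain_density_pos by (simp add: c_def powr_powr flip: powr_numeral)
  have "avg 1 n {} \<le> (c + 1 + 6 / c ^ 3) * real n powr (1 / 3)" if n: "n > 0" for n :: nat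
  proof -
    let ?P = "PiM {..<n} (\<lambda>_. \<mu>)"
    interpret P: prob_space ?P by (intro prob_space_PiM prob_space_\<mu>)
    interpret hereditary cchain by (rule hereditary_cchain)
    define y where "y = c * real n powr (1 / 3)"
    have y0: "y > 0" using n c0 by (simp add: y_def)
    have y3: "y ^ 3 = chain_density * exp 4 * real n"
      using n by (simp add: y_def power_mult_distrib c3 powr_powr flip: powr_numeral)
    define k where "k = nat \<lceil>y\<rceil>"
    have "0 < \<lceil>y\<rceil>" using y0 by simp
    then have k: "y \<le> real k" "real k \<le> y + 1" "k > 0"
      using le_of_int_ceiling[of y] of_int_ceiling_le_add_one[of y] by (simp_all add: k_def)
    let ?A = "{x \<in> space ?P. k \<le> maxlen cchain (x ` {..<n})}"
    have A: "?A \<in> sets ?P"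
    proof -
      have [measurable]: "(\<lambda>x. real (maxlen cchain (x ` {..<n}))) \<in> borel_measurable ?P"
        using borel_measurable_integrable[OF integrable_maxlen_\<mu>] .
      have "{x \<in> space ?P. real k \<le> real (maxlen cchain (x ` {..<n}))} \<in> sets ?P" by measurable
      then show ?thesis by simp
    qed
    have "real n ^ k * chain_coeff k \<le> real n ^ k * (chain_density ^ k / fact k ^ 3)"
      by (intro mult_left_mono chain_coeff_le) auto
    also have "\<dots> = (real n * chain_density) ^ k / fact k ^ 3" by (simp add: power_mult_distrib)
    also have "\<dots> \<le> (real n * chain_density) ^ k / (real k ^ k / exp (real k)) ^ 3"
      using power_le_exp_fact[of k] chain_density_pos k(3)
      by (intro divide_left_mono power_mono mult_pos_pos zero_less_power) (auto simp: field_simps)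
    also have "\<dots> = (real n * chain_density * exp 3 / real k ^ 3) ^ k"
      by (simp add: power_divide power_mult_distrib exp_of_nat_mult[symmetric] mult.commute flip: power_mult)
    also have "\<dots> \<le> exp (- 1) ^ k"
    proof (intro power_mono)
      have "real n * chain_density * exp 3 = y ^ 3 * exp (- 1)"
        unfolding y3 by (simp add: mult.assoc flip: exp_add)
      also have "\<dots> \<le> real k ^ 3 * exp (- 1)"
        using k(1) y0 by (intro mult_right_mono power_mono) auto
      finally show "real n * chain_density * exp 3 / real k ^ 3 \<le> exp (- 1)"
        using k(3) by (simp add: field_simps)
    qed (use chain_density_pos in auto)
    also have "\<dots> = exp (- real k)" by (simp flip: exp_of_nat_mult)
    finally have "emeasure ?P ?A \<le> ennreal (exp (- real k))"
      using order_trans[OF emeasure_maxlen_ge ennreal_leI] by blast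
    then have PA: "P.prob ?A \<le> exp (- real k)"
      by (simp add: P.emeasure_eq_measure)
    have iA: "integrable ?P (indicator ?A :: _ \<Rightarrow> real)"
      using borel_measurable_indicator[OF A]
      by (intro P.integrable_const_bound[where B=1]) (simp_all add: indicator_def)
    have "avg 1 n {} \<le> (\<integral>x. real k + real n * indicator ?A x \<partial>?P)"
      unfolding avg_one_eq
    proof (intro integral_mono integrable_maxlen_\<mu>)
      show "integrable ?P (\<lambda>x. real k + real n * indicator ?A x)"
        using iA by (intro Bochner_Integration.integrable_add integrable_mult_right) auto
      fix x assume x: "x \<in> space ?P"
      have "maxlen cchain (x ` {..<n}) \<le> n"
        using maxlen_le_card[of "x ` {..<n}"] card_image_le[of "{..<n}" x] by simp
      then show "real (maxlen cchain (x ` {..<n})) \<le> real k + real n * indicator ?A x"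
        using x by (auto simp: indicator_def)
    qed
    also have "\<dots> = real k + real n * P.prob ?A"
      using iA A by (subst Bochner_Integration.integral_add) (simp_all add: P.prob_space)
    also have "\<dots> \<le> real k + real n * exp (- real k)" using PA by (intro add_left_mono mult_left_mono) auto
    \<comment> \<open>Again a single term of the series: \<open>k^3 / 6 \<le> exp k\<close>, while
      \<open>k^3\<close> is at least \<open>c^3 * n\<close>.\<close>
    also have "real n * exp (- real k) \<le> 6 / c ^ 3"
    proof -
      have "real k ^ 3 / fact 3 \<le> exp (real k)"
      proof -
        have "(\<lambda>m. real k ^ m / fact m) sums exp (real k)"
          using exp_converges[of "real k"] by (simp add: field_simps)
        then have "(\<Sum>m\<in>{3}. real k ^ m / fact m) \<le> exp (real k)"
          by (intro sum_le_suminf[of _ "{3}", THEN order_trans]) (auto simp: sums_iff)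
        then show ?thesis by simp
      qed
      moreover have "c ^ 3 * real n \<le> real k ^ 3"
      proof -
        have "c ^ 3 * real n = y ^ 3" by (simp add: y3 c3)
        also have "\<dots> \<le> real k ^ 3" using k(1) y0 by (intro power_mono) auto
        finally show ?thesis .
      qed
      ultimately have "c ^ 3 * real n \<le> 6 * exp (real k)" by (simp add: fact_numeral field_simps)
      then show ?thesis using c0 by (simp add: exp_minus field_simps)
    qed
    also have "real k + 6 / c ^ 3 \<le> y + (1 + 6 / c ^ 3) * 1" using k by simp
    also have "\<dots> \<le> y + (1 + 6 / c ^ 3) * real n powr (1 / 3)"
      using n c0 by (intro add_left_mono mult_left_mono) (auto intro!: ge_one_powr_ge_zero add_nonneg_nonneg)
    also have "\<dots> = (c + 1 + 6 / c ^ 3) * real n powr (1 / 3)" by (simp add: y_def algebra_simps)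
    finally show ?thesis by simp
  qed
  then show ?thesis using c0 by (intro exI[of _ "c + 1 + 6 / c ^ 3"]) (auto intro!: add_pos_pos)
qed

lemma avg_zero: "avg 0 m B = real (maxlen cchain B)"
  by (induction m) auto

lemma avg_cube_add:
  assumes "0 \<le> u" "0 \<le> v" "u + v \<le> 1"
  shows "avg (u ^ 3) m {} + avg (v ^ 3) m {} \<le> avg ((u + v) ^ 3) m {}"
proof -
  interpret hereditary cchain by (rule hereditary_cchain)
  show ?thesis
  proof (cases "u = 0 \<or> v = 0")
    case True
    then show ?thesis by (auto simp: avg_zero)
  next
    case False
    then have uv: "u > 0" "v > 0" using assms by auto
    define s where "s = u / (u + v)"
    have s: "0 < s" "s < 1" "1 - s = v / (u + v)" using uv by (auto simp: s_def field_simps)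
    have "(u + v) ^ 3 \<le> 1" using assms by (intro power_le_one) auto
    moreover have "(u + v) ^ 3 * s ^ 3 = u ^ 3" "(u + v) ^ 3 * (1 - s) ^ 3 = v ^ 3"
      using uv unfolding s(3) by (simp_all add: s_def power_divide)
    ultimately show ?thesis
      using avg_superadditive[of "(u + v) ^ 3" s m] s uv by simp
  qed
qed

lemma avg_cube_mono:
  assumes "0 \<le> u" "u \<le> v" "v \<le> 1"
  shows "avg (u ^ 3) m {} \<le> avg (v ^ 3) m {}"
proof -
  have "0 \<le> avg ((v - u) ^ 3) m {}"
    using assms by (intro avg_nonneg) (auto intro: power_le_one)
  then show ?thesis using avg_cube_add[of u "v - u" m] assms by simp
qed

lemma avg_cube_mult:
  assumes "0 \<le> v" "real k * v \<le> 1"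
  shows "real k * avg (v ^ 3) m {} \<le> avg ((real k * v) ^ 3) m {}"
  using assms(2)
proof (induction k)
  case 0
  show ?case using avg_nonneg[of 0 "{}" m] by simp
next
  case (Suc k)
  have le: "real k * v + v \<le> 1" using Suc.prems by (simp add: algebra_simps)
  have "real (Suc k) * avg (v ^ 3) m {} = real k * avg (v ^ 3) m {} + avg (v ^ 3) m {}"
    by (simp add: algebra_simps)
  also have "\<dots> \<le> avg ((real k * v) ^ 3) m {} + avg (v ^ 3) m {}"
    using le assms(1) by (intro add_right_mono Suc.IH) auto
  also have "\<dots> \<le> avg ((real k * v + v) ^ 3) m {}"
    using le assms(1) by (intro avg_cube_add) auto
  finally show ?case by (simp add: algebra_simps)
qed

text \<open>A single point is a chain unless it lies on the side from \<open>p0\<close> to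
  \<open>p2\<close>, a null set.\<close>

lemma avg_one_one: "avg 1 1 {} = 1"
proof -
  interpret hereditary cchain by (rule hereditary_cchain)
  have aeT: "AE z in \<mu>. z \<in> T"
    using emeasure_\<mu>_T by (intro \<mu>.AE_prob_1) (simp add: measure_def)
  have "negligible {z :: real \<times> real. (1, 1) \<bullet> z = 1}"
    by (intro negligible_hyperplane) (simp add: zero_prod_def)
  then have "{z :: real \<times> real. (1, 1) \<bullet> z = 1} \<in> null_sets lborel"
    using closed_hyperplane[of "(1, 1) :: real \<times> real" 1]
    by (auto simp: negligible_iff_null_sets null_sets_def borel_closed)
  from AE_not_in[OF this] have "AE z :: real \<times> real in lborel. (1, 1) \<bullet> z \<noteq> 1" by simp
  then have "AE z in \<mu>. (1, 1) \<bullet> z \<noteq> 1"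
    unfolding \<mu>_def by (intro AE_uniform_measureI) auto
  with aeT have "AE z in \<mu>. real (maxlen cchain {z}) = 1"
  proof eventually_elim
    case (elim z)
    then have "fst z + snd z < 1" by (auto simp: T_iff inner_prod_def)
    then have "cchain {z}" using elim(1) by (auto simp: cchain_def lin_def intro!: exI[of _ "1 :: real"])
    then have "card {z} \<le> maxlen cchain {z}" by (intro maxlen_ge) auto
    moreover have "maxlen cchain {z} \<le> 1" using maxlen_le_card[of "{z}"] by simp
    ultimately show ?case by simp
  qed
  then have "(\<integral>z. real (maxlen cchain {z}) \<partial>\<mu>) = (\<integral>z. 1 \<partial>\<mu>)"
    using borel_measurable_integrable[OF integrable_avg_insert[of 1 "{}" 0]]
    by (intro integral_cong_AE) auto
  then show ?thesis using \<mu>.prob_space by simp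
qed

text \<open>Superadditivity fits about \<open>n^(1/3)\<close> triangles of relative area
  \<open>1 / n\<close> into \<open>T\<close>. Each contains a sample point with probability at least
  \<open>1 - 1 / e\<close>, and \<open>e \<ge> 5 / 2\<close> makes this at least 3/5.\<close>

lemma avg_lower_bound:
  assumes n: "n > 0"
  shows "3 / 5 * (real n powr (1 / 3) - 1) \<le> avg 1 n {}"
proof -
  define y where "y = real n powr (1 / 3)"
  have y: "y \<ge> 1" using n by (auto simp: y_def intro!: ge_one_powr_ge_zero)
  have y3: "y ^ 3 = real n" using n by (simp add: y_def powr_powr flip: powr_numeral)
  define k where "k = nat \<lfloor>y\<rfloor>"
  have "0 \<le> \<lfloor>y\<rfloor>" using y by simp
  then have k: "y - 1 \<le> real k" "real k \<le> y"
    using of_int_floor_le[of y] floor_correct[of y] by (simp_all add: k_def)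
  have "(1 - 1 / real n) ^ n \<le> exp (- 1 / real n) ^ n"
    using n exp_ge_add_one_self[of "- 1 / real n"] by (intro power_mono) auto
  also have "\<dots> = exp (- 1)" using n by (simp flip: exp_of_nat_mult)
  also have "\<dots> \<le> 2 / 5"
    using exp_lower_Taylor_quadratic[of "1 :: real"] by (simp add: exp_minus field_simps)
  finally have "3 / 5 \<le> binomial_tail (1 / real n) n (Suc 0)" by (simp add: binomial_tail_one)
  also have "\<dots> \<le> avg (1 / real n) n {}"
    using avg_ge_binomial_tail[of "1 / real n" "{}" n "Suc 0"] avg_one_one n by simp
  also have "1 / real n = (1 / y) ^ 3" by (simp add: power_divide y3)
  finally have "(y - 1) * (3 / 5) \<le> real k * avg ((1 / y) ^ 3) n {}"
    using k y by (intro mult_mono) auto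
  also have "\<dots> \<le> avg ((real k * (1 / y)) ^ 3) n {}"
    using k y by (intro avg_cube_mult) (auto simp: field_simps)
  also have "\<dots> \<le> avg (1 ^ 3) n {}"
    using k y by (intro avg_cube_mono) (auto simp: field_simps)
  finally show ?thesis by (simp add: y_def mult.commute)
qed

section \<open>The growth constant and lower bounds for every area\<close>

definition \<alpha> :: real where
  "\<alpha> = Inf {c. \<forall>\<^sub>F n in sequentially. avg 1 n {} \<le> c * real n powr (1 / 3)}"

lemma \<alpha>_set:
  defines "A \<equiv> {c. \<forall>\<^sub>F n in sequentially. avg 1 n {} \<le> c * real n powr (1 / 3)}"
  shows "A \<noteq> {}" "\<And>c. c \<in> A \<Longrightarrow> 3 / 5 \<le> c"
proof -
  obtain C where "\<forall>n>0. avg 1 n {} \<le> C * real n powr (1 / 3)" using avg_upper_bound by blast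
  then have "C \<in> A" unfolding A_def by (auto intro!: eventually_mono[OF eventually_gt_at_top[of 0]])
  then show "A \<noteq> {}" by auto
  fix c assume "c \<in> A"
  then have "\<forall>\<^sub>F n in sequentially. avg 1 n {} \<le> c * real n powr (1 / 3)" by (simp add: A_def)
  then have "\<forall>\<^sub>F n in sequentially. 3 / 5 - 3 / 5 * real n powr (- 1 / 3) \<le> c"
    using eventually_gt_at_top[of 0]
  proof eventually_elim
    case (elim n)
    define y where "y = real n powr (1 / 3)"
    define w where "w = real n powr (- 1 / 3)"
    have w: "w \<ge> 0" "y * w = 1"
      using elim by (auto simp: y_def w_def simp flip: powr_add)
    have "3 / 5 * (y - 1) \<le> c * y" using avg_lower_bound[of n] elim by (simp add: y_def)
    from mult_right_mono[OF this w(1)] have "3 / 5 * (y * w) - 3 / 5 * w \<le> c * (y * w)"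
      by (simp add: algebra_simps)
    then have "3 / 5 * 1 - 3 / 5 * w \<le> c * 1" by (simp only: w(2))
    then show ?case by (simp add: w_def)
  qed
  moreover have "(\<lambda>n. 3 / 5 - 3 / 5 * real n powr (- 1 / 3)) \<longlonglongrightarrow> 3 / 5 - 3 / 5 * 0"
    by (intro tendsto_intros tendsto_neg_powr filterlim_real_sequentially) auto
  ultimately show "3 / 5 \<le> c"
    using tendsto_upperbound[of _ "3 / 5" sequentially c] by simp
qed

lemma \<alpha>_ge: "3 / 5 \<le> \<alpha>"
  unfolding \<alpha>_def by (intro cInf_greatest \<alpha>_set)

lemma avg_eventually_le:
  assumes "c > \<alpha>"
  shows "\<forall>\<^sub>F n in sequentially. avg 1 n {} \<le> c * real n powr (1 / 3)"
proof -
  obtain d where d: "\<forall>\<^sub>F n in sequentially. avg 1 n {} \<le> d * real n powr (1 / 3)" "d < c"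
    using cInf_lessD[OF \<alpha>_set(1)] assms unfolding \<alpha>_def by auto
  from d(1) show ?thesis
    by eventually_elim (use d(2) in \<open>auto elim!: order_trans intro!: mult_right_mono\<close>)
qed

lemma avg_frequently_ge:
  assumes "c < \<alpha>"
  shows "\<exists>j\<ge>M. c * real j powr (1 / 3) < avg 1 j {}"
proof (rule ccontr)
  assume "\<not> ?thesis"
  then have "\<forall>\<^sub>F n in sequentially. avg 1 n {} \<le> c * real n powr (1 / 3)"
    unfolding eventually_sequentially by (auto simp: not_less)
  then have "\<alpha> \<le> c"
    unfolding \<alpha>_def by (intro cInf_lower bdd_belowI[of _ "3 / 5"]) (auto intro: \<alpha>_set(2)[simplified])
  then show False using assms by simp
qed

text \<open>One large \<open>j\<close> with mean length near \<open>\<alpha> * j^(1/3)\<close> is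
  enough, which is why a limit superior suffices: a triangle that expects \<open>(1 + d) * j\<close>
  points contains at least \<open>j\<close> of them with probability at least \<open>1 - d\<close>,
  whatever the size \<open>m\<close> of the sample.\<close>

lemma avg_block_lower:
  assumes e: "0 < e" "e < 1"
  shows "\<exists>w>0. \<forall>m. w ^ 3 \<le> real m \<longrightarrow> (1 - e) * \<alpha> * w \<le> avg ((w / real m powr (1 / 3)) ^ 3) m {}"
proof -
  \<comment> \<open>The losses combine to \<open>(1 - d)^2 / (1 + d)\<close>, which is at least
    \<open>1 - 3 * d\<close>.\<close>
  define d where "d = e / 3"
  have d: "0 < d" "d < 1" using e by (auto simp: d_def)
  have "(\<lambda>j. exp (- (d\<^sup>2 / 4) * real j)) \<longlonglongrightarrow> 0"
    using d by (intro filterlim_compose[OF exp_at_bot] filterlim_tendsto_neg_mult_at_bot[OF tendsto_const]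
        filterlim_real_sequentially) auto
  then have "\<forall>\<^sub>F j in sequentially. exp (- (d\<^sup>2 / 4) * real j) < d"
    using d by (intro order_tendstoD) auto
  then obtain M where M: "\<And>j. j \<ge> M \<Longrightarrow> exp (- (d\<^sup>2 / 4) * real j) < d"
    by (auto simp: eventually_sequentially)
  have "(1 - d) * \<alpha> < \<alpha>" using d \<alpha>_ge by simp
  then obtain j where j: "j \<ge> max M 1" "(1 - d) * \<alpha> * real j powr (1 / 3) < avg 1 j {}"
    using avg_frequently_ge by blast
  define w where "w = ((1 + d) * real j) powr (1 / 3)"
  have j0: "j > 0" using j by auto
  have w3: "w ^ 3 = (1 + d) * real j"
    using d j0 by (simp add: w_def powr_powr flip: powr_numeral)
  have w0: "w > 0" using d j0 by (simp add: w_def)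
  have w_le: "w \<le> (1 + d) * real j powr (1 / 3)"
  proof -
    have "(1 + d) powr (1 / 3) \<le> (1 + d) powr 1" using d by (intro powr_mono) auto
    then show ?thesis using d j0 by (simp add: w_def powr_mult mult_right_mono)
  qed
  have "(1 - e) * \<alpha> * w \<le> avg ((w / real m powr (1 / 3)) ^ 3) m {}" if m: "w ^ 3 \<le> real m" for m
  proof -
    define t where "t = w ^ 3 / real m"
    have m0: "real m > 0" using m w0 by (meson less_le_trans zero_less_power)
    have t: "0 \<le> t" "t \<le> 1" using m m0 w0 by (auto simp: t_def)
    have t_eq: "(w / real m powr (1 / 3)) ^ 3 = t"
      using m0 by (simp add: t_def power_divide powr_powr flip: powr_numeral)
    \<comment> \<open>The Chernoff exponent \<open>l * j - (1 + d) * j * (l - l^2 / 2)\<close> is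
      then \<open>- (3 - d) * d^2 / 8 * j\<close>, at most \<open>- d^2 / 4 * j\<close>.\<close>
    define l where "l = d / 2"
    have l: "0 \<le> l" using d by (simp add: l_def)
    have el: "l - l\<^sup>2 / 2 \<le> 1 - exp (- l)" using exp_neg_le_quadratic[OF l] by simp
    have "(1 - t * (1 - exp (- l))) ^ m \<le> exp (- (t * (1 - exp (- l)))) ^ m"
    proof (intro power_mono)
      show "1 - t * (1 - exp (- l)) \<le> exp (- (t * (1 - exp (- l))))"
        using exp_ge_add_one_self[of "- (t * (1 - exp (- l)))"] by simp
      have "t * (1 - exp (- l)) \<le> 1 * 1" using t l by (intro mult_mono) auto
      then show "0 \<le> 1 - t * (1 - exp (- l))" by simp
    qed
    also have "\<dots> = exp (- (w ^ 3 * (1 - exp (- l))))"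
      using m0 by (simp add: t_def flip: exp_of_nat_mult)
    also have "\<dots> \<le> exp (- (w ^ 3 * (l - l\<^sup>2 / 2)))"
      using el w0 by (simp add: mult_left_mono)
    finally have "exp (l * real j) * (1 - t * (1 - exp (- l))) ^ m \<le> exp (l * real j) * exp (- (w ^ 3 * (l - l\<^sup>2 / 2)))"
      by (intro mult_left_mono) auto
    also have "\<dots> = exp (l * real j - w ^ 3 * (l - l\<^sup>2 / 2))" by (simp flip: exp_add)
    also have "\<dots> \<le> exp (- (d\<^sup>2 / 4) * real j)"
    proof -
      have "l * real j - w ^ 3 * (l - l\<^sup>2 / 2) = - (d\<^sup>2 / 4) * real j - d\<^sup>2 * (1 - d) / 8 * real j"
        unfolding w3 l_def by (simp add: power2_eq_square field_simps)
      also have "\<dots> \<le> - (d\<^sup>2 / 4) * real j" using d by simp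
      finally show ?thesis by simp
    qed
    also have "\<dots> < d" using j by (intro M) auto
    finally have "1 - d \<le> binomial_tail t m j"
      using one_minus_binomial_tail_le[OF t l, of m j] by linarith
    then have "(1 - d) * avg 1 j {} \<le> binomial_tail t m j * avg 1 j {}"
      by (intro mult_right_mono avg_nonneg) auto
    also have "\<dots> \<le> avg t m {}" by (intro avg_ge_binomial_tail t) auto
    finally have 1: "(1 - d) * avg 1 j {} \<le> avg t m {}" .
    have "1 - e \<le> (1 - d)\<^sup>2 / (1 + d)"
    proof -
      have "(1 - e) * (1 + d) \<le> (1 - d)\<^sup>2"
        using d by (simp add: d_def power2_eq_square algebra_simps)
      then show ?thesis using d by (simp add: field_simps)
    qed
    then have "(1 - e) * (\<alpha> * w) \<le> (1 - d)\<^sup>2 / (1 + d) * (\<alpha> * w)"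
      using \<alpha>_ge w0 by (intro mult_right_mono) auto
    also have "\<dots> \<le> (1 - d)\<^sup>2 / (1 + d) * (\<alpha> * ((1 + d) * real j powr (1 / 3)))"
      using \<alpha>_ge w_le d by (intro mult_left_mono) auto
    also have "\<dots> = (1 - d) * ((1 - d) * \<alpha> * real j powr (1 / 3))"
      using d by (simp add: power2_eq_square field_simps)
    also have "\<dots> \<le> (1 - d) * avg 1 j {}" using j(2) d by (intro mult_left_mono) auto
    finally show ?thesis using 1 by (simp add: t_eq mult.assoc)
  qed
  then show ?thesis using w0 by blast
qed

text \<open>As many blocks of cube root \<open>w / m^(1/3)\<close> as fit are placed in the
  triangle; the unfilled rest is less than one block, hence \<open>- w\<close>. Uniformity in
  \<open>u\<close> matters because the deficit shrinks with \<open>n\<close>.\<close>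

lemma avg_cube_lower:
  assumes e: "0 < e" "e < 1"
  shows "\<exists>w>0. \<forall>m u. w ^ 3 \<le> real m \<longrightarrow> 0 \<le> u \<longrightarrow> u \<le> 1 \<longrightarrow>
    (1 - e) * \<alpha> * (u * real m powr (1 / 3) - w) \<le> avg (u ^ 3) m {}"
proof -
  obtain w where w: "w > 0" "\<And>m. w ^ 3 \<le> real m \<Longrightarrow> (1 - e) * \<alpha> * w \<le> avg ((w / real m powr (1 / 3)) ^ 3) m {}"
    using avg_block_lower[OF e] by blast
  have "(1 - e) * \<alpha> * (u * real m powr (1 / 3) - w) \<le> avg (u ^ 3) m {}"
    if m: "w ^ 3 \<le> real m" and u: "0 \<le> u" "u \<le> 1" for m u
  proof -
    define y where "y = real m powr (1 / 3)"
    have m0: "real m > 0" using m w(1) by (meson less_le_trans zero_less_power)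
    have y0: "y > 0" using m0 by (simp add: y_def)
    define k where "k = nat \<lfloor>u * y / w\<rfloor>"
    have "0 \<le> u * y / w" using u y0 w by simp
    then have "0 \<le> \<lfloor>u * y / w\<rfloor>" by simp
    then have k: "u * y / w - 1 \<le> real k" "real k \<le> u * y / w"
      using of_int_floor_le[of "u * y / w"] floor_correct[of "u * y / w"] by (simp_all add: k_def)
    have kv: "real k * (w / y) \<le> u" using k(2) w(1) y0 by (simp add: field_simps)
    have "(1 - e) * \<alpha> * (u * y - w) = (u * y / w - 1) * ((1 - e) * \<alpha> * w)"
      using w by (simp add: field_simps)
    also have "\<dots> \<le> real k * ((1 - e) * \<alpha> * w)"
      using k w e \<alpha>_ge by (intro mult_right_mono) auto
    also have "\<dots> \<le> real k * avg ((w / y) ^ 3) m {}"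
      using w(2)[OF m] by (intro mult_left_mono) (auto simp: y_def)
    also have "\<dots> \<le> avg ((real k * (w / y)) ^ 3) m {}"
      using w(1) y0 by (intro avg_cube_mult[OF _ order_trans[OF kv u(2)]]) simp
    also have "\<dots> \<le> avg (u ^ 3) m {}"
      using w(1) y0 by (intro avg_cube_mono[OF _ kv u(2)]) simp
    finally show ?thesis by (simp add: y_def)
  qed
  then show ?thesis using w(1) by blast
qed

text \<open>Telescoping: if \<open>a^3 - b^3 = 1\<close> and \<open>b \<le> a\<close>, then
  \<open>a - b\<close> is at least \<open>1 / (3 * a^2)\<close>.\<close>

lemma sum_powr_le: "(\<Sum>k=1..n. real k powr (1 / 3) / real k) \<le> 3 * real n powr (1 / 3)"
proof (induction n)
  case (Suc n)
  define a where "a = real (Suc n) powr (1 / 3)"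
  define b where "b = real n powr (1 / 3)"
  have ab: "0 < a" "0 \<le> b" "b \<le> a" by (auto simp: a_def b_def intro!: powr_mono2)
  have a3: "a ^ 3 = real (Suc n)" by (simp add: a_def powr_powr flip: powr_numeral)
  have b3: "b ^ 3 = real n"
  proof (cases "n = 0")
    case False
    then show ?thesis by (simp add: b_def powr_powr flip: powr_numeral)
  qed (simp add: b_def)
  have "a / a ^ 3 \<le> 3 * (a - b)"
  proof -
    have "(a - b) * (a * a + a * b + b * b) = 1"
      using a3 b3 by (simp add: power3_eq_cube algebra_simps)
    moreover have "a * b \<le> a * a" "b * b \<le> a * a" using ab by (auto intro: mult_mono)
    then have "a * a + a * b + b * b \<le> 3 * (a * a)" by linarith
    then have "(a - b) * (a * a + a * b + b * b) \<le> (a - b) * (3 * (a * a))"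
      using ab by (intro mult_left_mono) auto
    ultimately have "1 \<le> 3 * (a - b) * (a * a)" by (simp only: ac_simps)
    then have "1 / (a * a) \<le> 3 * (a - b)" using ab by (subst pos_divide_le_eq) auto
    then show ?thesis using ab by (simp add: power3_eq_cube)
  qed
  then have "real (Suc n) powr (1 / 3) / real (Suc n) \<le> 3 * a - 3 * b"
    using a3 by (simp add: a_def)
  then show ?case using Suc.IH by (simp add: a_def b_def)
qed simp

text \<open>The variance of the tail bounds. The early terms, where the asymptotic estimate may
  fail, add a constant that the room between \<open>d\<close> and \<open>c\<close> absorbs.\<close>

lemma sum_avg_le:
  assumes c: "c > \<alpha>"
  shows "\<forall>\<^sub>F n in sequentially. (\<Sum>k=1..n. avg 1 k {} / real k) \<le> 3 * c * real n powr (1 / 3)"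
proof -
  define d where "d = (\<alpha> + c) / 2"
  have d: "\<alpha> < d" "d < c" using c by (auto simp: d_def)
  obtain M where M: "\<And>n. n \<ge> M \<Longrightarrow> avg 1 n {} \<le> d * real n powr (1 / 3)"
    using avg_eventually_le[OF d(1)] by (auto simp: eventually_sequentially)
  define K where "K = (\<Sum>k=1..M. avg 1 k {} / real k)"
  have le: "(\<Sum>k=1..n. avg 1 k {} / real k) \<le> K + d * (3 * real n powr (1 / 3))" for n
  proof -
    have nn: "0 \<le> avg 1 k {} / real k" for k by (intro divide_nonneg_nonneg avg_nonneg) auto
    have "(\<Sum>k=1..n. avg 1 k {} / real k) \<le>
        (\<Sum>k=1..n. (if k \<le> M then avg 1 k {} / real k else 0) + d * (real k powr (1 / 3) / real k))"
    proof (intro sum_mono)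
      fix k assume "k \<in> {1..n}"
      have "0 \<le> d * (real k powr (1 / 3) / real k)" using d \<alpha>_ge by auto
      moreover have "avg 1 k {} / real k \<le> d * (real k powr (1 / 3) / real k)" if "k \<ge> M"
        using divide_right_mono[OF M[OF that], of "real k"] by simp
      ultimately show "avg 1 k {} / real k \<le>
          (if k \<le> M then avg 1 k {} / real k else 0) + d * (real k powr (1 / 3) / real k)"
        using nn[of k] by auto
    qed
    also have "\<dots> = (\<Sum>k\<in>{1..n} \<inter> {..M}. avg 1 k {} / real k) + d * (\<Sum>k=1..n. real k powr (1 / 3) / real k)"
      by (simp only: sum.distrib sum_distrib_left sum.inter_restrict[OF finite_atLeastAtMost] atMost_iff)
    also have "(\<Sum>k\<in>{1..n} \<inter> {..M}. avg 1 k {} / real k) \<le> K"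
      unfolding K_def using nn by (intro sum_mono2) auto
    also have "d * (\<Sum>k=1..n. real k powr (1 / 3) / real k) \<le> d * (3 * real n powr (1 / 3))"
      using sum_powr_le[of n] d \<alpha>_ge by (intro mult_left_mono) auto
    finally show ?thesis by simp
  qed
  have "filterlim (\<lambda>n. 3 * (c - d) * real n powr (1 / 3)) at_top sequentially"
    using d by (intro filterlim_tendsto_pos_mult_at_top[OF tendsto_const] filterlim_compose[OF real_powr_at_top]
        filterlim_real_sequentially) auto
  then have "\<forall>\<^sub>F n in sequentially. K \<le> 3 * (c - d) * real n powr (1 / 3)"
    by (simp add: filterlim_at_top)
  then show ?thesis
  proof eventually_elim
    case (elim n)
    then show ?case using le[of n] by (simp add: algebra_simps)
  qed
qed

section \<open>Distance of boundaries and support functions\<close>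

lemma not_interior_of_min:
  fixes \<theta> :: "'a::euclidean_space"
  assumes "\<theta> \<noteq> 0" "\<And>w. w \<in> K \<Longrightarrow> \<theta> \<bullet> z \<le> \<theta> \<bullet> w"
  shows "z \<notin> interior K"
proof
  assume "z \<in> interior K"
  then obtain e where e: "e > 0" "cball z e \<subseteq> K" using mem_interior_cball by blast
  define w where "w = z - (e / norm \<theta>) *\<^sub>R \<theta>"
  have "w \<in> K" using e assms(1) by (auto simp: w_def dist_norm intro!: subsetD[OF e(2)])
  then have "\<theta> \<bullet> z \<le> \<theta> \<bullet> w" by (rule assms(2))
  moreover have "\<theta> \<bullet> w = \<theta> \<bullet> z - e * norm \<theta>"
    using assms(1) by (simp add: w_def inner_diff_right power2_norm_eq_inner[symmetric] power2_eq_square)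
  moreover have "0 < e * norm \<theta>" using e assms(1) by simp
  ultimately show False by linarith
qed

lemma frontier_of_min:
  fixes \<theta> :: "'a::euclidean_space"
  assumes "\<theta> \<noteq> 0" "z \<in> K" "\<And>w. w \<in> K \<Longrightarrow> \<theta> \<bullet> z \<le> \<theta> \<bullet> w"
  shows "z \<in> frontier K"
  using not_interior_of_min[of \<theta> K z] assms closure_subset[of K] by (auto simp: frontier_def)

text \<open>A convex set without interior lies in a hyperplane, and then the normal of the
  hyperplane serves.\<close>

lemma supporting_direction:
  fixes c :: "'a::euclidean_space"
  assumes "convex K" "closed K" "c \<in> frontier K"
  shows "\<exists>\<theta>. norm \<theta> = 1 \<and> (\<forall>w\<in>K. \<theta> \<bullet> c \<le> \<theta> \<bullet> w)"
proof -
  have c: "c \<in> K" "c \<notin> interior K" using assms by (auto simp: frontier_def)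
  have "\<exists>a. a \<noteq> 0 \<and> (\<forall>w\<in>K. a \<bullet> c \<le> a \<bullet> w)"
  proof (cases "interior K = {}")
    case True
    then obtain a b where "a \<noteq> 0" "K \<subseteq> {x. a \<bullet> x = b}"
      using empty_interior_subset_hyperplane[OF assms(1)] by blast
    then show ?thesis using c(1) by (intro exI[of _ a]) (metis (mono_tags) mem_Collect_eq order_refl subsetD)
  next
    case False
    then have "rel_interior K = interior K" by (rule rel_interior_nonempty_interior)
    then show ?thesis
      using supporting_hyperplane_rel_boundary[OF assms(1) c(1)] c(2) by metis
  qed
  then obtain a where a: "a \<noteq> 0" "\<And>w. w \<in> K \<Longrightarrow> a \<bullet> c \<le> a \<bullet> w" by blast
  then show ?thesis
    by (intro exI[of _ "a /\<^sub>R norm a"]) (auto simp: divide_right_mono)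
qed

text \<open>The weak form of \<open>separating_positive\<close>. On the line
  \<open>x + y = 1\<close> it fails for \<open>u = v < 0\<close>, hence the strict last
  assumption.\<close>

lemma supporting_nonneg:
  fixes u v x y :: real
  assumes "u * x + v * y \<le> v" "u * x + v * y \<le> u" "0 \<le> x" "0 \<le> y" "x + y < 1"
  shows "0 \<le> u" "0 \<le> v"
proof -
  have 1: "u * x \<le> v * (1 - y)" "v * y \<le> u * (1 - x)" using assms by (auto simp: algebra_simps)
  show u: "0 \<le> u"
  proof (rule ccontr)
    assume "\<not> 0 \<le> u"
    then have "u * (1 - x) < 0" using assms by (intro mult_neg_pos) auto
    then have "v * y < 0" using 1 by linarith
    then have v: "v < 0" using assms by (meson mult_nonneg_nonneg not_le)
    have "v * (1 - y) < v * x" "u * (1 - x) < u * y"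
      using v \<open>\<not> 0 \<le> u\<close> assms by (auto intro!: mult_strict_left_mono_neg)
    then have "u * x < v * x" "v * y < u * y" using 1 by linarith+
    then show False using assms by (auto simp: mult_less_cancel_right)
  qed
  show "0 \<le> v"
  proof (rule ccontr)
    assume "\<not> 0 \<le> v"
    then have "v * (1 - y) < 0" using assms by (intro mult_neg_pos) auto
    moreover have "0 \<le> u * x" using u assms by simp
    ultimately show False using 1 by linarith
  qed
qed

lemma norm_pair_eq_1_iff: "norm (u, v) = 1 \<longleftrightarrow> u\<^sup>2 + v\<^sup>2 = (1 :: real)"
  by (simp add: norm_Pair)

lemma p02_T: "p0 \<in> T" "p2 \<in> T" by (auto simp: T_iff p0_def p2_def)

lemma segment_iff_sum:
  assumes "z \<in> T" "z \<noteq> p0" "z \<noteq> p2" "fst z + snd z = 1"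
  shows "z \<in> open_segment p0 p2"
proof -
  have "z = (1 - fst z) *\<^sub>R p0 + fst z *\<^sub>R p2"
    using assms(4) by (simp add: p0_def p2_def prod_eq_iff)
  then have "z \<in> closed_segment p0 p2"
    using assms by (auto simp: closed_segment_def T_iff intro!: exI[of _ "fst z"])
  then show ?thesis using assms by (simp add: open_segment_def)
qed

lemma open_segment_sum:
  assumes "z \<in> open_segment p0 p2"
  obtains s where "0 < s" "s < 1" "z = (s, 1 - s)"
  using assms by (auto simp: in_segment p0_def p2_def)

lemma p0_frontier:
  assumes "K \<subseteq> T" "p0 \<in> K"
  shows "p0 \<in> frontier K"
proof (rule frontier_of_min[of "(0, -1)"])
  fix w assume "w \<in> K"
  then have "w \<in> T" using assms by blast
  then show "(0, -1) \<bullet> p0 \<le> (0, -1) \<bullet> w" by (simp add: p0_def T_iff inner_prod_def)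
qed (simp_all add: zero_prod_def assms)

lemma p2_frontier:
  assumes "K \<subseteq> T" "p2 \<in> K"
  shows "p2 \<in> frontier K"
proof (rule frontier_of_min[of "(-1, 0)"])
  fix w assume "w \<in> K"
  then have "w \<in> T" using assms by blast
  then show "(-1, 0) \<bullet> p2 \<le> (-1, 0) \<bullet> w" by (simp add: p2_def T_iff inner_prod_def)
qed (simp_all add: zero_prod_def assms)

text \<open>If the support functions of two convex sets differ by at most \<open>\<epsilon>\<close>, then so does the distance of
  their boundaries: from a boundary point of one set walk to the boundary of the other, against
  a supporting direction if the point lies inside, straight to the nearest point if outside.\<close>

lemma frontier_close:
  fixes K1 K2 :: "(real \<times> real) set"
  assumes K1: "compact K1" "convex K1" "K1 \<subseteq> T" "p0 \<in> K1" "p2 \<in> K1"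
    and K2: "compact K2" "convex K2" "K2 \<subseteq> T" "p0 \<in> K2" "p2 \<in> K2"
    and w0: "w0 \<in> K2" "fst w0 + snd w0 < 1"
    and 12: "\<And>u v z. 0 \<le> u \<Longrightarrow> 0 \<le> v \<Longrightarrow> u\<^sup>2 + v\<^sup>2 = 1 \<Longrightarrow> z \<in> K2 \<Longrightarrow>
      \<exists>w\<in>K1. (u, v) \<bullet> w \<le> (u, v) \<bullet> z + \<epsilon>"
    and 21: "\<And>u v z. 0 \<le> u \<Longrightarrow> 0 \<le> v \<Longrightarrow> u\<^sup>2 + v\<^sup>2 = 1 \<Longrightarrow> z \<in> K1 \<Longrightarrow>
      \<exists>w\<in>K2. (u, v) \<bullet> w \<le> (u, v) \<bullet> z + \<epsilon>"
    and e: "0 \<le> \<epsilon>" and c: "c \<in> frontier K1 - open_segment p0 p2"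
  shows "\<exists>d\<in>frontier K2 - open_segment p0 p2. dist c d \<le> \<epsilon>"
proof -
  have cK1: "c \<in> K1" using c compact_imp_closed[OF K1(1)] by (auto simp: frontier_def)
  then have cT: "c \<in> T" using K1 by auto
  have closed: "closed K1" "closed K2" using K1 K2 compact_imp_closed by auto
  show ?thesis
  proof (cases "c = p0 \<or> c = p2")
    case True
    then have "c \<in> frontier K2" using p0_frontier[OF K2(3,4)] p2_frontier[OF K2(3,5)] by blast
    then show ?thesis using c e by (intro bexI[of _ c]) auto
  next
    case False
    then have "fst c + snd c \<noteq> 1" using c segment_iff_sum[OF cT] by auto
    then have c1: "fst c + snd c < 1" "0 \<le> fst c" "0 \<le> snd c" using cT by (auto simp: T_iff)
    show ?thesis
    proof (cases "c \<in> K2")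
      case True
      obtain \<theta> where \<theta>: "norm \<theta> = 1" "\<And>w. w \<in> K1 \<Longrightarrow> \<theta> \<bullet> c \<le> \<theta> \<bullet> w"
        using supporting_direction[OF K1(2) closed(1)] c by blast
      obtain u v where uv: "\<theta> = (u, v)" by (cases \<theta>)
      have "u * fst c + v * snd c \<le> v" "u * fst c + v * snd c \<le> u"
        using \<theta>(2)[OF K1(4)] \<theta>(2)[OF K1(5)] by (auto simp: uv inner_prod_def p0_def p2_def)
      from supporting_nonneg[OF this c1(2,3,1)] have uv0: "0 \<le> u" "0 \<le> v" by auto
      have uv1: "u\<^sup>2 + v\<^sup>2 = 1" using \<theta>(1) by (simp add: uv norm_pair_eq_1_iff)
      have \<theta>\<theta>: "\<theta> \<bullet> \<theta> = 1" using \<theta>(1) by (simp add: norm_eq_1)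
      let ?g = "\<lambda>t. c - t *\<^sub>R \<theta>"
      have g: "\<theta> \<bullet> ?g t = \<theta> \<bullet> c - t" for t by (simp add: inner_diff_right \<theta>\<theta>)
      \<comment> \<open>No point of \<open>K1\<close> has a smaller value than \<open>c\<close> in
        the direction \<theta>, so \<open>K2\<close> reaches at most \<epsilon> below that
        value.\<close>
      have le_eps: "t \<le> \<epsilon>" if tK: "?g t \<in> K2" for t
      proof -
        obtain w where w: "w \<in> K1" "(u, v) \<bullet> w \<le> (u, v) \<bullet> ?g t + \<epsilon>"
          using 12[OF uv0 uv1 tK] by blast
        then show ?thesis using \<theta>(2)[OF w(1)] g[of t] by (simp add: uv)
      qed
      define A where "A = {0..\<epsilon>} \<inter> ?g -` K2"
      have "closed (?g -` K2)"
        by (intro continuous_closed_vimage closed) (intro continuous_intros)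
      then have "compact A" unfolding A_def by (intro compact_Int_closed) auto
      moreover have "0 \<in> A" using True e by (simp add: A_def)
      ultimately obtain t where t: "t \<in> A" "\<And>s. s \<in> A \<Longrightarrow> s \<le> t"
        using compact_attains_sup[of A] by blast
      have d: "?g t \<in> K2" "0 \<le> t" "t \<le> \<epsilon>" using t by (auto simp: A_def)
      have "?g t \<notin> interior K2"
      proof
        assume "?g t \<in> interior K2"
        then obtain h where h: "h > 0" "cball (?g t) h \<subseteq> K2" using mem_interior_cball by blast
        have "dist (?g t) (?g (t + h)) = h" using h \<theta>(1) by (simp add: dist_norm algebra_simps)
        then have "?g (t + h) \<in> K2" using h by (intro subsetD[OF h(2)]) simp
        then have "t + h \<in> A" using le_eps[of "t + h"] d h by (simp add: A_def)
        then show False using t(2) h by force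
      qed
      then have "?g t \<in> frontier K2" using d closure_subset[of K2] by (auto simp: frontier_def)
      \<comment> \<open>The walk increases neither coordinate, so it stays strictly below the line
        \<open>x + y = 1\<close>.\<close>
      moreover have "?g t \<notin> open_segment p0 p2"
      proof
        assume "?g t \<in> open_segment p0 p2"
        then have "fst (?g t) + snd (?g t) = 1" by (elim open_segment_sum) simp
        moreover have "0 \<le> t * u" "0 \<le> t * v" using d uv0 by auto
        ultimately show False using c1 by (simp add: uv)
      qed
      ultimately show ?thesis
        using d \<theta>(1) by (intro bexI[of _ "?g t"]) (auto simp: dist_norm)
    next
      case False
      define z where "z = closest_point K2 c"
      have zK: "z \<in> K2" unfolding z_def using K2(4) by (intro closest_point_in_set closed) blast
      define \<theta> where "\<theta> = (z - c) /\<^sub>R dist c z"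
      have cz: "dist c z > 0" using zK False by auto
      have \<theta>1: "norm \<theta> = 1" using cz by (simp add: \<theta>_def dist_norm norm_minus_commute)
      have zc: "z = c + dist c z *\<^sub>R \<theta>" using cz by (simp add: \<theta>_def)
      have \<theta>z: "\<theta> \<bullet> z = \<theta> \<bullet> c + dist c z"
        using \<theta>1 by (subst zc) (simp add: inner_add_right norm_eq_1)
      have min: "\<theta> \<bullet> z \<le> \<theta> \<bullet> w" if "w \<in> K2" for w
      proof -
        have "(c - z) \<bullet> (w - z) \<le> 0"
          unfolding z_def using that K2 closed by (intro closest_point_dot) auto
        then have "0 \<le> (z - c) \<bullet> (w - z)" by (simp add: inner_diff_left)
        then have "0 \<le> \<theta> \<bullet> (w - z)" using cz by (simp add: \<theta>_def)
        then show ?thesis by (simp add: inner_diff_right)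
      qed
      obtain u v where uv: "\<theta> = (u, v)" by (cases \<theta>)
      have "u * fst c + v * snd c < v" "u * fst c + v * snd c < u"
      proof -
        have "\<theta> \<bullet> c < \<theta> \<bullet> p0" "\<theta> \<bullet> c < \<theta> \<bullet> p2"
          using min[OF K2(4)] min[OF K2(5)] \<theta>z cz by linarith+
        then show "u * fst c + v * snd c < v" "u * fst c + v * snd c < u"
          by (simp_all add: uv inner_prod_def p0_def p2_def)
      qed
      from separating_positive[OF this] have uv0: "0 < u" "0 < v" using c1 by auto
      have uv1: "u\<^sup>2 + v\<^sup>2 = 1" using \<theta>1 by (simp add: uv norm_pair_eq_1_iff)
      obtain w where w: "w \<in> K2" "(u, v) \<bullet> w \<le> (u, v) \<bullet> c + \<epsilon>"
        using 21[of u v c] uv0 uv1 cK1 by auto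
      have "dist c z \<le> \<epsilon>" using min[OF w(1)] w(2) \<theta>z by (simp add: uv)
      moreover have "z \<in> frontier K2"
        using \<theta>1 zK min by (intro frontier_of_min[of \<theta>]) auto
      \<comment> \<open>A minimum at an inner point of the segment forces equal values at
        \<open>p0\<close> and \<open>p2\<close>, so \<open>u = v\<close>; but then \<open>w0\<close>
        has a smaller value.\<close>
      moreover have "z \<notin> open_segment p0 p2"
      proof
        assume "z \<in> open_segment p0 p2"
        then obtain s where s: "0 < s" "s < 1" "z = (s, 1 - s)" by (elim open_segment_sum)
        have "u * s + v * (1 - s) \<le> v" "u * s + v * (1 - s) \<le> u"
          using min[OF K2(4)] min[OF K2(5)] by (auto simp: uv s p0_def p2_def inner_prod_def)
        then have "s * (u - v) \<le> 0" "(1 - s) * (v - u) \<le> 0" by (auto simp: algebra_simps)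
        then have "u = v" using s by (auto simp: mult_le_0_iff)
        then have "u * 1 \<le> u * (fst w0 + snd w0)"
          using min[OF w0(1)] by (simp add: uv s inner_prod_def algebra_simps)
        then show False using uv0 w0(2) by simp
      qed
      ultimately show ?thesis by blast
    qed
  qed
qed

section \<open>The convex region between the parabola and the segment\<close>

definition parabola_hull :: "(real \<times> real) set" where
  "parabola_hull = {z \<in> T. 1 \<le> sqrt (fst z) + sqrt (snd z)}"

lemma compact_T: "compact T"
  unfolding T_def by (intro finite_imp_compact_convex_hull) simp

lemma convex_T: "convex T"
  unfolding T_def by (rule convex_convex_hull)

lemma compact_parabola_hull: "compact parabola_hull"
proof -
  have eq: "parabola_hull = T \<inter> {z. 1 \<le> sqrt (fst z) + sqrt (snd z)}" by (auto simp: parabola_hull_def)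
  show ?thesis
    unfolding eq by (intro compact_Int_closed compact_T closed_Collect_le continuous_intros)
qed

lemma convex_parabola_hull: "convex parabola_hull"
proof (rule convexI)
  fix a b :: "real \<times> real" and u v :: real
  assume ab: "a \<in> parabola_hull" "b \<in> parabola_hull" and uv: "0 \<le> u" "0 \<le> v" "u + v = 1"
  have T: "u *\<^sub>R a + v *\<^sub>R b \<in> T"
    using ab uv convexD[OF convex_T] by (auto simp: parabola_hull_def)
  have c: "u * sqrt s + v * sqrt t \<le> sqrt (u * s + v * t)" if "0 \<le> s" "0 \<le> t" for s t
  proof (rule real_le_rsqrt)
    have "(u * sqrt s + v * sqrt t)\<^sup>2 = u * s * (u + v) + v * t * (u + v) - u * v * (sqrt s - sqrt t)\<^sup>2"
      using that by (simp add: power2_eq_square algebra_simps)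
    also have "\<dots> = u * s + v * t - u * v * (sqrt s - sqrt t)\<^sup>2" using uv(3) by simp
    also have "\<dots> \<le> u * s + v * t" using uv by simp
    finally show "(u * sqrt s + v * sqrt t)\<^sup>2 \<le> u * s + v * t" .
  qed
  have "u * 1 + v * 1 \<le> u * (sqrt (fst a) + sqrt (snd a)) + v * (sqrt (fst b) + sqrt (snd b))"
    using ab uv by (intro add_mono mult_left_mono) (auto simp: parabola_hull_def)
  also have "\<dots> \<le> sqrt (u * fst a + v * fst b) + sqrt (u * snd a + v * snd b)"
    using c[of "fst a" "fst b"] c[of "snd a" "snd b"] ab by (auto simp: parabola_hull_def T_iff algebra_simps)
  finally show "u *\<^sub>R a + v *\<^sub>R b \<in> parabola_hull"
    using T uv(3) by (simp add: parabola_hull_def)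
qed

text \<open>The identity in the proof is Cauchy-Schwarz with explicit remainder. Together with
  \<open>parabola_hull_attained\<close> it identifies \<open>u * v / (u + v)\<close> as the support
  function of the region.\<close>

lemma parabola_hull_ge:
  assumes "z \<in> parabola_hull" "0 < u" "0 < v"
  shows "u * v / (u + v) \<le> (u, v) \<bullet> z"
proof -
  define a b where "a = sqrt (fst z)" and "b = sqrt (snd z)"
  have z: "fst z = a\<^sup>2" "snd z = b\<^sup>2" "1 \<le> a + b"
    using assms(1) by (auto simp: a_def b_def parabola_hull_def T_iff)
  have "(u * a\<^sup>2 + v * b\<^sup>2) * (u + v) = u * v * (a + b)\<^sup>2 + (u * a - v * b)\<^sup>2"
    by (simp add: power2_eq_square algebra_simps)
  moreover have "1\<^sup>2 \<le> (a + b)\<^sup>2" using z(3) by (intro power_mono) auto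
  then have "u * v * 1 \<le> u * v * (a + b)\<^sup>2" using assms by (intro mult_left_mono) auto
  moreover have "0 \<le> (u * a - v * b)\<^sup>2" by simp
  ultimately have "u * v \<le> (u * a\<^sup>2 + v * b\<^sup>2) * (u + v)" by linarith
  then show ?thesis using assms by (simp add: z inner_prod_def pos_divide_le_eq)
qed

lemma parabola_hull_attained:
  assumes "0 < u" "0 < v"
  shows "\<exists>z\<in>parabola_hull. (u, v) \<bullet> z = u * v / (u + v)"
\<comment> \<open>The case of equality: square roots of the coordinates that add up to 1 and are in
  the ratio \<open>v : u\<close>.\<close>
proof (intro bexI[of _ "((v / (u + v))\<^sup>2, (u / (u + v))\<^sup>2)"])
  have s: "v / (u + v) + u / (u + v) = 1"
    using assms by (simp add: add.commute flip: add_divide_distrib)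
  have "(v / (u + v))\<^sup>2 \<le> v / (u + v)" "(u / (u + v))\<^sup>2 \<le> u / (u + v)"
  proof -
    have *: "r\<^sup>2 \<le> r" if "0 \<le> r" "r \<le> 1" for r :: real
      using that by (simp add: power2_eq_square mult_left_le)
    show "(v / (u + v))\<^sup>2 \<le> v / (u + v)" "(u / (u + v))\<^sup>2 \<le> u / (u + v)"
      using assms by (intro *; simp)+
  qed
  then have "(v / (u + v))\<^sup>2 + (u / (u + v))\<^sup>2 \<le> 1" using s by linarith
  then show "((v / (u + v))\<^sup>2, (u / (u + v))\<^sup>2) \<in> parabola_hull"
    using assms s by (simp add: parabola_hull_def T_iff)
  have "u * v\<^sup>2 + v * u\<^sup>2 = u * v * (u + v)" by (simp add: power2_eq_square algebra_simps)
  then have "u * (v / (u + v))\<^sup>2 + v * (u / (u + v))\<^sup>2 = u * v * (u + v) / (u + v)\<^sup>2"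
    by (simp add: power_divide add_divide_distrib[symmetric])
  also have "\<dots> = u * v / (u + v)"
    using assms by (simp add: power2_eq_square del: distrib_left distrib_right)
  finally show "(u, v) \<bullet> ((v / (u + v))\<^sup>2, (u / (u + v))\<^sup>2) = u * v / (u + v)"
    by (simp only: inner_Pair inner_real_def)
qed

lemma p02_parabola_hull: "p0 \<in> parabola_hull" "p2 \<in> parabola_hull"
  by (auto simp: parabola_hull_def p02_T) (auto simp: p0_def p2_def)

lemma frontier_parabola_hull: "frontier parabola_hull - open_segment p0 p2 = special_parabola"
proof
  show "special_parabola \<subseteq> frontier parabola_hull - open_segment p0 p2"
  proof
    fix z assume "z \<in> special_parabola"
    then have z: "0 \<le> fst z" "0 \<le> snd z" "sqrt (fst z) + sqrt (snd z) = 1"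
      by (auto simp: special_parabola_def)
    have eq: "(sqrt (fst z))\<^sup>2 = fst z" "(sqrt (snd z))\<^sup>2 = snd z" using z by auto
    have "(sqrt (fst z) + sqrt (snd z))\<^sup>2 = 1" using z by simp
    then have sum: "fst z + snd z + 2 * (sqrt (fst z) * sqrt (snd z)) = 1"
      using eq by (simp add: power2_sum)
    have zT: "z \<in> T" using z sum by (auto simp: T_iff) (smt (verit) mult_nonneg_nonneg real_sqrt_ge_zero)
    then have zG: "z \<in> parabola_hull" using z by (simp add: parabola_hull_def)
    have "z \<notin> interior parabola_hull"
    proof
      assume "z \<in> interior parabola_hull"
      then obtain e where e: "e > 0" "cball z e \<subseteq> parabola_hull" using mem_interior_cball by blast
      \<comment> \<open>A shift along the diagonal decreases both square roots and so leaves the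
        region.\<close>
      define w where "w = z - (e / 2) *\<^sub>R (1, 1)"
      have "dist z w \<le> e"
        using e by (simp add: w_def dist_norm norm_Pair real_sqrt_mult power2_eq_square real_le_lsqrt)
      then have "w \<in> parabola_hull" using e by auto
      then have w: "1 \<le> sqrt (fst w) + sqrt (snd w)" by (simp add: parabola_hull_def)
      have "sqrt (fst w) < sqrt (fst z)" "sqrt (snd w) < sqrt (snd z)"
        using e by (auto simp: w_def)
      then show False using w z(3) by linarith
    qed
    moreover have "z \<notin> open_segment p0 p2"
    proof
      assume "z \<in> open_segment p0 p2"
      then obtain s where "0 < s" "s < 1" "z = (s, 1 - s)" by (elim open_segment_sum)
      then show False using sum by simp
    qed
    ultimately show "z \<in> frontier parabola_hull - open_segment p0 p2"
      using zG closure_subset[of parabola_hull] by (auto simp: frontier_def)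
  qed
  show "frontier parabola_hull - open_segment p0 p2 \<subseteq> special_parabola"
  proof
    fix z assume z: "z \<in> frontier parabola_hull - open_segment p0 p2"
    then have zG: "z \<in> parabola_hull" and zi: "z \<notin> interior parabola_hull"
      using compact_imp_closed[OF compact_parabola_hull] by (auto simp: frontier_def)
    then have zT: "z \<in> T" and s1: "1 \<le> sqrt (fst z) + sqrt (snd z)" by (auto simp: parabola_hull_def)
    show "z \<in> special_parabola"
    proof (rule ccontr)
      assume "z \<notin> special_parabola"
      then have s: "1 < sqrt (fst z) + sqrt (snd z)"
        using s1 zT by (cases z) (auto simp: special_parabola_def T_iff)
      then have "z \<noteq> p0" "z \<noteq> p2" by (auto simp: p0_def p2_def)
      then have "fst z + snd z \<noteq> 1" using z segment_iff_sum[OF zT] by auto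
      then have sum: "fst z + snd z < 1" using zT by (auto simp: T_iff)
      have pos: "0 < fst z" "0 < snd z"
      proof -
        have "sqrt (snd z) \<le> sqrt 1" "sqrt (fst z) \<le> sqrt 1" using sum zT by (auto simp: T_iff simp del: real_sqrt_one)
        then show "0 < fst z" "0 < snd z" using s zT by (auto simp: T_iff less_le)
      qed
      \<comment> \<open>All conditions at \<open>z\<close> are strict: a zero coordinate would leave
        the sum of the roots at most 1.\<close>
      define U where "U = {w :: real \<times> real. 0 < fst w} \<inter> {w. 0 < snd w} \<inter> {w. fst w + snd w < 1} \<inter>
        {w. 1 < sqrt (fst w) + sqrt (snd w)}"
      have "open U" unfolding U_def by (intro open_Int open_Collect_less continuous_intros)
      moreover have "z \<in> U" using pos sum s by (simp add: U_def)
      moreover have "U \<subseteq> parabola_hull" by (auto simp: U_def parabola_hull_def T_iff)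
      ultimately show False using zi interior_maximal by blast
    qed
  qed
qed

lemma hausdorff_dist_le:
  fixes A B :: "'a::metric_space set"
  assumes "A \<noteq> {}" "B \<noteq> {}" "\<And>a. a \<in> A \<Longrightarrow> \<exists>b\<in>B. dist a b \<le> e" "\<And>b. b \<in> B \<Longrightarrow> \<exists>a\<in>A. dist b a \<le> e"
  shows "hausdorff_dist A B \<le> e"
  unfolding hausdorff_dist_def
  using assms by (intro max.boundedI cSUP_least) (blast intro: infdist_le2)+

lemma hausdorff_dist_parabola_le:
  assumes K: "compact K" "convex K" "K \<subseteq> T" "p0 \<in> K" "p2 \<in> K"
    and w0: "w0 \<in> K" "fst w0 + snd w0 < 1" and e: "0 \<le> \<epsilon>"
    and upper: "\<And>u v. 0 < u \<Longrightarrow> 0 < v \<Longrightarrow> u\<^sup>2 + v\<^sup>2 = 1 \<Longrightarrow> \<exists>w\<in>K. (u, v) \<bullet> w \<le> u * v / (u + v) + \<epsilon>"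
    and lower: "\<And>u v w. 0 < u \<Longrightarrow> 0 < v \<Longrightarrow> u\<^sup>2 + v\<^sup>2 = 1 \<Longrightarrow> w \<in> K \<Longrightarrow> u * v / (u + v) \<le> (u, v) \<bullet> w + \<epsilon>"
  shows "hausdorff_dist (frontier K - open_segment p0 p2) special_parabola \<le> \<epsilon>"
proof -
  have GT: "parabola_hull \<subseteq> T" by (auto simp: parabola_hull_def)
  note G = compact_parabola_hull convex_parabola_hull GT p02_parabola_hull
  have w1: "(1/4 :: real, 1/4 :: real) \<in> parabola_hull" "fst (1/4 :: real, 1/4 :: real) + snd (1/4 :: real, 1/4 :: real) < (1 :: real)"
    by (auto simp: parabola_hull_def T_iff real_sqrt_divide)
  have KG: "\<exists>w\<in>K. (u, v) \<bullet> w \<le> (u, v) \<bullet> z + \<epsilon>"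
    if "0 \<le> u" "0 \<le> v" "u\<^sup>2 + v\<^sup>2 = 1" "z \<in> parabola_hull" for u v z
  proof -
    have z: "0 \<le> (u, v) \<bullet> z" using that by (auto simp: parabola_hull_def T_iff inner_prod_def)
    \<comment> \<open>In the axis directions both support functions vanish, at \<open>p2\<close> and
      at \<open>p0\<close> respectively, so only positive \<open>u\<close> and \<open>v\<close> need
      the hypotheses.\<close>
    consider "u = 0" | "v = 0" | "0 < u" "0 < v" using \<open>0 \<le> u\<close> \<open>0 \<le> v\<close> by force
    then show ?thesis
    proof cases
      case 1
      then show ?thesis using K z e by (intro bexI[of _ p2]) (auto simp: p2_def)
    next
      case 2
      then show ?thesis using K z e by (intro bexI[of _ p0]) (auto simp: p0_def)
    next
      case 3
      then show ?thesis using upper[of u v] parabola_hull_ge[of z u v] that by force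
    qed
  qed
  have GK: "\<exists>w\<in>parabola_hull. (u, v) \<bullet> w \<le> (u, v) \<bullet> z + \<epsilon>"
    if "0 \<le> u" "0 \<le> v" "u\<^sup>2 + v\<^sup>2 = 1" "z \<in> K" for u v z
  proof -
    have "z \<in> T" using that K by auto
    then have z: "0 \<le> (u, v) \<bullet> z" using that by (auto simp: T_iff inner_prod_def)
    consider "u = 0" | "v = 0" | "0 < u" "0 < v" using \<open>0 \<le> u\<close> \<open>0 \<le> v\<close> by force
    then show ?thesis
    proof cases
      case 1
      then show ?thesis using p02_parabola_hull z e by (intro bexI[of _ p2]) (auto simp: p2_def)
    next
      case 2
      then show ?thesis using p02_parabola_hull z e by (intro bexI[of _ p0]) (auto simp: p0_def)
    next
      case 3
      then show ?thesis using lower[of u v z] parabola_hull_attained[of u v] that by force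
    qed
  qed
  have p0: "p0 \<in> frontier K - open_segment p0 p2" "p0 \<in> special_parabola"
  proof -
    have "p0 \<in> frontier K" by (rule p0_frontier[OF K(3,4)])
    then show "p0 \<in> frontier K - open_segment p0 p2" by (simp add: open_segment_def)
    show "p0 \<in> special_parabola" by (simp add: special_parabola_def p0_def)
  qed
  show ?thesis
  proof (rule hausdorff_dist_le)
    fix a assume a: "a \<in> frontier K - open_segment p0 p2"
    have "\<exists>b\<in>frontier parabola_hull - open_segment p0 p2. dist a b \<le> \<epsilon>"
    proof (rule frontier_close[OF K G w1 _ _ e a])
      fix u v :: real and z
      assume uv: "0 \<le> u" "0 \<le> v" "u\<^sup>2 + v\<^sup>2 = 1"
      show "\<exists>w\<in>K. (u, v) \<bullet> w \<le> (u, v) \<bullet> z + \<epsilon>" if "z \<in> parabola_hull" by (rule KG[OF uv that])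
      show "\<exists>w\<in>parabola_hull. (u, v) \<bullet> w \<le> (u, v) \<bullet> z + \<epsilon>" if "z \<in> K" by (rule GK[OF uv that])
    qed
    then show "\<exists>b\<in>special_parabola. dist a b \<le> \<epsilon>" by (simp only: frontier_parabola_hull)
  next
    fix b assume b: "b \<in> special_parabola"
    have "\<exists>a\<in>frontier K - open_segment p0 p2. dist b a \<le> \<epsilon>"
    proof (rule frontier_close[OF G K w0 _ _ e])
      show "b \<in> frontier parabola_hull - open_segment p0 p2" using b by (simp only: frontier_parabola_hull)
      fix u v :: real and z
      assume uv: "0 \<le> u" "0 \<le> v" "u\<^sup>2 + v\<^sup>2 = 1"
      show "\<exists>w\<in>K. (u, v) \<bullet> w \<le> (u, v) \<bullet> z + \<epsilon>" if "z \<in> parabola_hull" by (rule KG[OF uv that])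
      show "\<exists>w\<in>parabola_hull. (u, v) \<bullet> w \<le> (u, v) \<bullet> z + \<epsilon>" if "z \<in> K" by (rule GK[OF uv that])
    qed
    then show "\<exists>a\<in>frontier K - open_segment p0 p2. dist b a \<le> \<epsilon>" .
  qed (use p0 in auto)
qed

section \<open>Chains far from the parabola\<close>

lemma cchain_sum_less_1:
  assumes "cchain Y" "z \<in> Y"
  shows "fst z + snd z < 1"
proof (rule ccontr)
  assume "\<not> ?thesis"
  then have s: "fst z + snd z = 1" using cchainD(1)[OF assms] by (simp add: T_iff)
  obtain q where q: "q > 0" "lin q z < 1" "lin q z < q" using cchainD(2)[OF assms] by blast
  have z: "0 \<le> fst z" "0 \<le> snd z" "snd z = 1 - fst z" using s cchainD(1)[OF assms] by (auto simp: T_iff)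
  have f: "fst z = 1 - snd z" using s by simp
  have "lin q z = 1 + (q - 1) * fst z" unfolding lin_def z(3) by (simp add: algebra_simps)
  moreover have "lin q z = q + (1 - q) * snd z" unfolding lin_def f by (simp add: algebra_simps)
  ultimately have "(q - 1) * fst z < 0" "(1 - q) * snd z < 0" using q by linarith+
  then show False using z by (auto simp: mult_less_0_iff)
qed

text \<open>If the support functions differed by at most \<epsilon> in every direction, so would the
  boundaries. A linear functional attains its minimum over the hull at one of the finitely many
  generators, which provides \<open>r\<close>.\<close>

lemma bad_direction:
  assumes Y: "finite Y" "cchain Y" "Y \<noteq> {}" and e: "0 \<le> \<epsilon>"
    and bad: "hausdorff_dist (chain_path Y) special_parabola > \<epsilon>"
  obtains u v r m where "0 < u" "0 < v" "u\<^sup>2 + v\<^sup>2 = 1" "r \<in> Y \<union> {p0, p2}" "m = u * fst r + v * snd r"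
    "\<And>z. z \<in> Y \<Longrightarrow> m \<le> u * fst z + v * snd z" "0 \<le> m" "m \<le> u" "m \<le> v" "\<epsilon> < \<bar>m - u * v / (u + v)\<bar>"
proof -
  let ?K = "chain_hull Y" and ?S = "Y \<union> {p0, p2}"
  have YT: "Y \<subseteq> T" using Y(2) by (simp add: cchain_def)
  have ST: "?S \<subseteq> T" using YT p02_T by auto
  have SK: "?S \<subseteq> ?K" by (simp add: chain_hull_def hull_subset)
  have K: "compact ?K" "convex ?K" "?K \<subseteq> T" "p0 \<in> ?K" "p2 \<in> ?K"
  proof -
    show "compact ?K" unfolding chain_hull_def using Y(1) by (intro finite_imp_compact_convex_hull) simp
    show "convex ?K" unfolding chain_hull_def by (rule convex_convex_hull)
    show "?K \<subseteq> T" unfolding chain_hull_def by (rule hull_minimal[where S=convex, OF ST convex_T])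
    show "p0 \<in> ?K" "p2 \<in> ?K" using SK by blast+
  qed
  obtain w0 where w0: "w0 \<in> Y" using Y(3) by blast
  have w: "w0 \<in> ?K" "fst w0 + snd w0 < 1" using w0 SK cchain_sum_less_1[OF Y(2)] by auto
  have min: "\<exists>r\<in>?S. \<forall>z\<in>?K. (u, v) \<bullet> r \<le> (u, v) \<bullet> z" for u v :: real
  proof -
    have "finite ((\<bullet>) (u, v) ` ?S)" using Y(1) by simp
    then have "Min ((\<bullet>) (u, v) ` ?S) \<in> (\<bullet>) (u, v) ` ?S" by (intro Min_in) auto
    then obtain r where r: "r \<in> ?S" "(u, v) \<bullet> r = Min ((\<bullet>) (u, v) ` ?S)" by (metis imageE)
    have "(u, v) \<bullet> r \<le> (u, v) \<bullet> z" if "z \<in> ?S" for z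
      unfolding r(2) using Y(1) that by (intro Min_le) auto
    then have "?S \<subseteq> {z. (u, v) \<bullet> z \<ge> (u, v) \<bullet> r}" by blast
    then have "?K \<subseteq> {z. (u, v) \<bullet> z \<ge> (u, v) \<bullet> r}"
      unfolding chain_hull_def by (rule hull_minimal[where S=convex]) (rule convex_halfspace_ge)
    then show ?thesis using r(1) by blast
  qed
  have "\<exists>u v. 0 < u \<and> 0 < v \<and> u\<^sup>2 + v\<^sup>2 = 1 \<and>
    \<not> ((\<exists>w\<in>?K. (u, v) \<bullet> w \<le> u * v / (u + v) + \<epsilon>) \<and> (\<forall>w\<in>?K. u * v / (u + v) \<le> (u, v) \<bullet> w + \<epsilon>))"
  proof (rule ccontr)
    assume no: "\<not> ?thesis"
    have "hausdorff_dist (frontier ?K - open_segment p0 p2) special_parabola \<le> \<epsilon>"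
    proof (rule hausdorff_dist_parabola_le[OF K w e])
      fix u v :: real assume "0 < u" "0 < v" "u\<^sup>2 + v\<^sup>2 = 1"
      then have *: "(\<exists>w\<in>?K. (u, v) \<bullet> w \<le> u * v / (u + v) + \<epsilon>) \<and> (\<forall>w\<in>?K. u * v / (u + v) \<le> (u, v) \<bullet> w + \<epsilon>)"
        using no by blast
      show "\<exists>w\<in>?K. (u, v) \<bullet> w \<le> u * v / (u + v) + \<epsilon>" using * by blast
      show "u * v / (u + v) \<le> (u, v) \<bullet> w + \<epsilon>" if "w \<in> ?K" for w using * that by blast
    qed
    then show False using bad by (simp add: chain_path_def)
  qed
  then obtain u v where uv: "0 < u" "0 < v" "u\<^sup>2 + v\<^sup>2 = 1"
    and no: "\<not> ((\<exists>w\<in>?K. (u, v) \<bullet> w \<le> u * v / (u + v) + \<epsilon>) \<and> (\<forall>w\<in>?K. u * v / (u + v) \<le> (u, v) \<bullet> w + \<epsilon>))"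
    by blast
  obtain r where r: "r \<in> ?S" "\<And>z. z \<in> ?K \<Longrightarrow> (u, v) \<bullet> r \<le> (u, v) \<bullet> z" using min[of u v] by blast
  define m where "m = (u, v) \<bullet> r"
  have m: "m = u * fst r + v * snd r" by (simp add: m_def inner_prod_def)
  have "r \<in> ?K" "r \<in> T" using r(1) SK ST by auto
  have "\<epsilon> < \<bar>m - u * v / (u + v)\<bar>"
  proof (rule ccontr)
    assume "\<not> ?thesis"
    then have "m \<le> u * v / (u + v) + \<epsilon>" "u * v / (u + v) \<le> m + \<epsilon>" by linarith+
    then show False using no r(2) \<open>r \<in> ?K\<close> unfolding m_def by (smt (verit, best))
  qed
  moreover have "m \<le> u * fst z + v * snd z" if "z \<in> ?S" for z
    using r(2)[of z] SK that by (auto simp: m_def inner_prod_def)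
  moreover from this[of p0] this[of p2] have "m \<le> v" "m \<le> u" by (auto simp: p0_def p2_def)
  moreover have "0 \<le> m" using uv \<open>r \<in> T\<close> by (auto simp: m T_iff)
  ultimately show ?thesis using that[of u v r m] uv r(1) m by blast
qed

section \<open>Areas of the triangles cut off by a line\<close>

lemma am_gm3:
  fixes x y :: real
  assumes "0 \<le> x" "0 \<le> y"
  shows "(x * y\<^sup>2) powr (1 / 3) \<le> (x + 2 * y) / 3"
proof -
  \<comment> \<open>The arithmetic-geometric mean inequality for \<open>x\<close>, \<open>y\<close>,
    \<open>y\<close>, with explicit remainder.\<close>
  have "27 * (x * y\<^sup>2) = (x + 2 * y) ^ 3 - (x - y)\<^sup>2 * (x + 8 * y)"
    by (simp add: power2_eq_square power3_eq_cube algebra_simps)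
  also have "\<dots> \<le> (x + 2 * y) ^ 3" using assms by simp
  finally have "x * y\<^sup>2 \<le> ((x + 2 * y) / 3) ^ 3" by (simp add: power_divide)
  then have "(x * y\<^sup>2) powr (1 / 3) \<le> (((x + 2 * y) / 3) ^ 3) powr (1 / 3)"
    using assms by (intro powr_mono2) auto
  also have "\<dots> = (x + 2 * y) / 3"
  proof (cases "x + 2 * y = 0")
    case False
    then have "0 < (x + 2 * y) / 3" using assms by auto
    then show ?thesis by (simp add: powr_powr del: power_divide flip: powr_numeral)
  qed simp
  finally show ?thesis .
qed

lemma powr_third_cube: "0 \<le> z \<Longrightarrow> (z powr (1 / 3)) ^ 3 = (z :: real)"
  by (cases "z = 0") (auto simp: powr_powr simp flip: powr_numeral)

lemma powr_third_add_le:
  assumes "0 \<le> x" "0 \<le> y"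
  shows "(x + y) powr (1 / 3) \<le> x powr (1 / 3) + y powr (1 / 3 :: real)"
proof -
  define a b where "a = x powr (1 / 3)" and "b = y powr (1 / 3)"
  have ab: "0 \<le> a" "0 \<le> b" "x = a ^ 3" "y = b ^ 3" using assms powr_third_cube by (auto simp: a_def b_def)
  have "a ^ 3 + b ^ 3 \<le> (a + b) ^ 3"
  proof -
    have "(a + b) ^ 3 = a ^ 3 + b ^ 3 + 3 * a * b * (a + b)" by (simp add: power3_eq_cube algebra_simps)
    then show ?thesis using ab by simp
  qed
  then have "(x + y) powr (1 / 3) \<le> ((a + b) ^ 3) powr (1 / 3)"
    using assms ab by (intro powr_mono2) auto
  also have "\<dots> = a + b"
    using ab by (cases "a + b = 0") (auto simp: powr_powr simp flip: powr_numeral)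
  finally show ?thesis by (simp add: a_def b_def)
qed

text \<open>Hoelder's inequality bounds the sum of the cube roots of the two areas cut off by the line
  through \<open>(0, a)\<close> and \<open>(b, 0)\<close>; the loss is measured by \<open>a + b - 1\<close>, which vanishes for the
  tangents of the parabola.\<close>

lemma cube_roots_le:
  fixes a b s :: real
  assumes a: "0 \<le> a" "a \<le> 1" and b: "0 \<le> b" "b \<le> 1" and s: "0 \<le> s" "s \<le> 1"
  shows "((1 - a) * (s * b)) powr (1 / 3) + ((1 - b) * ((1 - s) * a)) powr (1 / 3) \<le> 1 - (a + b - 1)\<^sup>2 / 3"
proof -
  \<comment> \<open>The areas become \<open>s * A^2\<close> and \<open>(1 - s) * B^2\<close>.
    Hoelder bounds the sum of their cube roots by \<open>(A + B)^(2/3)\<close>; it follows from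
    \<open>am_gm3\<close> applied to each term divided by \<open>(A + B)^2\<close>.\<close>
  define A where "A = sqrt (b * (1 - a))"
  define B where "B = sqrt (a * (1 - b))"
  define w where "w = a + b - 1"
  have AB: "0 \<le> A" "0 \<le> B" "A\<^sup>2 = b * (1 - a)" "B\<^sup>2 = a * (1 - b)" using a b by (auto simp: A_def B_def)
  have w: "w\<^sup>2 \<le> 1" using a b by (auto simp: w_def power2_le_iff_abs_le abs_le_iff intro!: abs_square_le_1[THEN iffD2])
  have "2 * (A * B) \<le> a * (1 - a) + b * (1 - b)"
  proof -
    have "A * B = sqrt (a * (1 - a)) * sqrt (b * (1 - b))"
      unfolding A_def B_def by (simp add: ac_simps flip: real_sqrt_mult)
    moreover have "2 * (sqrt (a * (1 - a)) * sqrt (b * (1 - b))) \<le> (sqrt (a * (1 - a)))\<^sup>2 + (sqrt (b * (1 - b)))\<^sup>2"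
      using sum_squares_bound[of "sqrt (a * (1 - a))" "sqrt (b * (1 - b))"] by simp
    ultimately show ?thesis using a b by simp
  qed
  \<comment> \<open>The bound for \<open>2 * (A * B)\<close> leaves
    \<open>(a + b) * (2 - a - b)\<close>, which is \<open>1 - w^2\<close>.\<close>
  then have S: "(A + B)\<^sup>2 \<le> 1 - w\<^sup>2"
    unfolding power2_sum AB by (simp add: w_def power2_eq_square algebra_simps)
  have "(s * A\<^sup>2) powr (1 / 3) + ((1 - s) * B\<^sup>2) powr (1 / 3) \<le> ((A + B)\<^sup>2) powr (1 / 3)"
  proof (cases "A + B = 0")
    case True
    then have "A = 0" "B = 0" using AB by auto
    then show ?thesis by simp
  next
    case False
    then have C: "A + B > 0" using AB by linarith
    have part: "(r * X\<^sup>2) powr (1 / 3) \<le> ((A + B)\<^sup>2) powr (1 / 3) * ((r + 2 * (X / (A + B))) / 3)"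
      if "0 \<le> r" "0 \<le> X" for r X
    proof -
      define Q where "Q = r * (X / (A + B))\<^sup>2"
      have "0 \<le> Q" "r * X\<^sup>2 = (A + B)\<^sup>2 * Q" using C that by (auto simp: Q_def power_divide)
      then have "(r * X\<^sup>2) powr (1 / 3) = ((A + B)\<^sup>2) powr (1 / 3) * (r * (X / (A + B))\<^sup>2) powr (1 / 3)"
        by (simp add: powr_mult flip: Q_def)
      also have "\<dots> \<le> ((A + B)\<^sup>2) powr (1 / 3) * ((r + 2 * (X / (A + B))) / 3)"
        using that C by (intro mult_left_mono am_gm3) auto
      finally show ?thesis .
    qed
    have "A / (A + B) + B / (A + B) = 1" using C by (simp flip: add_divide_distrib)
    then have "(s + 2 * (A / (A + B))) / 3 + (1 - s + 2 * (B / (A + B))) / 3 = 1" by argo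
    then have "((A + B)\<^sup>2) powr (1 / 3) * ((s + 2 * (A / (A + B))) / 3) +
        ((A + B)\<^sup>2) powr (1 / 3) * ((1 - s + 2 * (B / (A + B))) / 3) = ((A + B)\<^sup>2) powr (1 / 3)"
      by (simp only: distrib_left[symmetric] mult_1_right)
    then show ?thesis using part[of s A] part[of "1 - s" B] s AB by linarith
  qed
  also have "\<dots> \<le> (1 - w\<^sup>2) powr (1 / 3)" using S by (intro powr_mono2) auto
  also have "\<dots> \<le> 1 - w\<^sup>2 / 3"
    using am_gm3[of "1 - w\<^sup>2" 1] w by (simp add: field_simps)
  finally show ?thesis
    unfolding AB w_def by (simp add: ac_simps)
qed

text \<open>\<open>m / v\<close> and \<open>m / u\<close> are the intercepts \<open>a\<close> and
  \<open>b\<close> of the supporting line, and \<open>r\<close> divides the segment between the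
  axes. Then \<open>a + b - 1\<close> is \<open>k * (m - u * v / (u + v))\<close> with
  \<open>k = (u + v) / (u * v)\<close>. For unit vectors \<open>k^2\<close> is at least 8, with
  equality on the diagonal, whence the constant 8/3.\<close>

lemma cube_roots_le_direction:
  fixes u v x y m \<epsilon> :: real
  assumes uv: "0 < u" "0 < v" "u\<^sup>2 + v\<^sup>2 = 1" and r: "0 \<le> x" "0 \<le> y"
    and m: "m = u * x + v * y" "m \<le> u" "m \<le> v" and e: "0 \<le> \<epsilon>" "\<epsilon> < \<bar>m - u * v / (u + v)\<bar>"
  shows "((1 - m / v) * x) powr (1 / 3) + ((1 - m / u) * y) powr (1 / 3) \<le> 1 - 8 / 3 * \<epsilon>\<^sup>2"
proof -
  have m0: "0 \<le> m" using uv r by (simp add: m(1))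
  define a b where "a = m / v" and "b = m / u"
  have ab: "0 \<le> a" "a \<le> 1" "0 \<le> b" "b \<le> 1" using m0 m uv by (auto simp: a_def b_def)
  have "\<exists>s. 0 \<le> s \<and> s \<le> 1 \<and> x = s * b \<and> y = (1 - s) * a"
  proof (cases "m = 0")
    case True
    then have "u * x + v * y = 0" "0 \<le> u * x" "0 \<le> v * y" using m uv r by auto
    then have "u * x = 0" "v * y = 0" by linarith+
    then have "x = 0" "y = 0" using uv by auto
    then show ?thesis using True by (intro exI[of _ 0]) (simp add: a_def b_def)
  next
    case False
    then have mp: "0 < m" using m0 by simp
    have "0 \<le> v * y" using uv r by simp
    then have "u * x \<le> m" using m by simp
    moreover have "1 - u * x / m = v * y / m"
      using mp m(1) by (simp add: diff_divide_eq_iff)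
    ultimately show ?thesis using mp uv r
      by (intro exI[of _ "u * x / m"]) (auto simp: a_def b_def)
  qed
  then obtain s where s: "0 \<le> s" "s \<le> 1" "x = s * b" "y = (1 - s) * a" by blast
  have "8 * \<epsilon>\<^sup>2 \<le> (a + b - 1)\<^sup>2"
  proof -
    define k where "k = (u + v) / (u * v)"
    have "a + b - 1 = k * (m - u * v / (u + v))"
    proof -
      have "k * (u * v / (u + v)) = 1" using uv by (simp add: k_def)
      moreover have "a + b = k * m" using uv by (simp add: k_def a_def b_def field_simps)
      ultimately show ?thesis by (simp only: right_diff_distrib)
    qed
    then have "(a + b - 1)\<^sup>2 = k\<^sup>2 * (m - u * v / (u + v))\<^sup>2" by (simp add: power_mult_distrib)
    moreover have "\<epsilon>\<^sup>2 \<le> (m - u * v / (u + v))\<^sup>2"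
      using e power_mono[of \<epsilon> "\<bar>m - u * v / (u + v)\<bar>" 2] by simp
    moreover have "8 \<le> k\<^sup>2"
    proof -
      have uvp: "0 < u * v" using uv by simp
      have "0 \<le> (u - v)\<^sup>2" by simp
      then have "2 * (u * v) \<le> 1" using uv(3) by (simp add: power2_diff)
      have "8 * (u * v)\<^sup>2 = (2 * (u * v)) * (4 * (u * v))" by (simp add: power2_eq_square)
      also have "\<dots> \<le> 1 * (4 * (u * v))" using \<open>2 * (u * v) \<le> 1\<close> uvp by (intro mult_right_mono) auto
      also have "\<dots> \<le> (u + v)\<^sup>2" using \<open>0 \<le> (u - v)\<^sup>2\<close> by (simp add: power2_sum power2_diff)
      finally have "8 * (u * v)\<^sup>2 \<le> (u + v)\<^sup>2" .
      moreover have "0 < (u * v)\<^sup>2" using uvp by (rule zero_less_power)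
      ultimately show ?thesis unfolding k_def power_divide by (simp only: pos_le_divide_eq)
    qed
    ultimately show ?thesis by (simp add: mult_mono)
  qed
  then show ?thesis
    using cube_roots_le[OF ab s(1,2)] unfolding s a_def[symmetric] b_def[symmetric] by linarith
qed

lemma grid_below:
  fixes a :: real
  assumes "0 \<le> a" "a \<le> 1" "0 < N"
  obtains i where "i < N" "real i / real N \<le> a" "a \<le> real i / real N + 1 / real N"
proof -
  \<comment> \<open>The cap at \<open>N - 1\<close> matters for \<open>a = 1\<close>: a rounded
    intercept must stay below 1, since \<open>lower\<close> divides by \<open>1 - a\<close>.\<close>
  define i where "i = min (nat \<lfloor>a * real N\<rfloor>) (N - 1)"
  have f: "real (nat \<lfloor>a * real N\<rfloor>) \<le> a * real N" "a * real N < real (nat \<lfloor>a * real N\<rfloor>) + 1"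
    using assms floor_correct[of "a * real N"] by (auto simp: of_nat_nat)
  have "a * real N \<le> real N" using assms by (simp add: mult_left_le_one_le)
  then have "real i \<le> a * real N" "a * real N \<le> real i + 1"
    using f assms(3) by (auto simp: i_def min_def of_nat_diff)
  then show ?thesis
    using that[of i] assms by (auto simp: i_def field_simps)
qed

text \<open>The points of a chain to the left and to the right of its point of contact \<open>r\<close> with a line below it,
  each in the coordinates of its triangle.\<close>

definition parts :: "real \<times> real \<Rightarrow> real \<Rightarrow> real \<Rightarrow> (real \<times> real) set \<Rightarrow> bool" where
  "parts r a b S \<longleftrightarrow> cchain (lower a r ` {z \<in> S. fst z \<le> fst r}) \<and> cchain (upper b r ` {z \<in> S. \<not> fst z \<le> fst r})"

lemma hereditary_parts: "hereditary (parts r a b)"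
  using hereditary_cchain_parts by (simp add: parts_def[abs_def])

definition parts_deficit :: "real \<times> real \<Rightarrow> real \<Rightarrow> real \<Rightarrow> real" where
  "parts_deficit r a b = 1 - (fst r * (1 - a)) powr (1 / 3) - (snd r * (1 - b)) powr (1 / 3)"

text \<open>The intercepts range over a continuum. Rounding them down to a grid enlarges the
  triangles, so the partial chains survive, and costs at most \<open>(1 / N) powr (1 / 3)\<close> in
  each cube root. \<open>Suc\<close> accounts for \<open>r\<close> itself.\<close>

lemma bad_chain_covered:
  fixes N :: nat
  assumes Y: "finite X" "Y \<subseteq> X" "cchain Y" "Y \<noteq> {}" and e: "0 \<le> \<epsilon>" and N: "0 < N"
    and bad: "hausdorff_dist (chain_path Y) special_parabola > \<epsilon>"
  obtains r i j where "r \<in> Y \<union> {p0, p2}" "i < N" "j < N"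
    "card Y \<le> Suc (maxlen (parts r (real i / N) (real j / N)) (X - {r}))"
    "8 / 3 * \<epsilon>\<^sup>2 - 2 * (1 / N) powr (1 / 3) \<le> parts_deficit r (real i / N) (real j / N)"
proof -
  have finY: "finite Y" using Y finite_subset by blast
  obtain u v r m where uv: "0 < u" "0 < v" "u\<^sup>2 + v\<^sup>2 = 1" and r: "r \<in> Y \<union> {p0, p2}" "m = u * fst r + v * snd r"
    and m: "\<And>z. z \<in> Y \<Longrightarrow> m \<le> u * fst z + v * snd z" "0 \<le> m" "m \<le> u" "m \<le> v" "\<epsilon> < \<bar>m - u * v / (u + v)\<bar>"
    using bad_direction[OF finY Y(3,4) e bad] by blast
  have rT: "r \<in> T" using r(1) p02_T cchainD(1)[OF Y(3)] by blast
  obtain i where i: "i < N" "real i / N \<le> m / v" "m / v \<le> real i / N + 1 / N"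
    using grid_below[of "m / v" N] m uv N by auto
  obtain j where j: "j < N" "real j / N \<le> m / u" "m / u \<le> real j / N + 1 / N"
    using grid_below[of "m / u" N] m uv N by auto
  define a b where "a = real i / N" and "b = real j / N"
  have ab: "a < 1" "b < 1" using i j by (auto simp: a_def b_def)
  interpret hereditary "parts r a b" by (rule hereditary_parts)
  have "parts r a b (Y - {r})"
    unfolding parts_def
    using cchain_lower_part[OF Y(3) uv(1,2) r m(1), of a] cchain_upper_part[OF Y(3) uv(1,2) r m(1), of b] i j ab
    by (simp add: a_def b_def)
  then have "card (Y - {r}) \<le> maxlen (parts r a b) (X - {r})"
    using Y by (intro maxlen_ge) auto
  moreover have "card Y \<le> Suc (card (Y - {r}))"
    using finY card_Suc_Diff1[of Y r] by (cases "r \<in> Y") auto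
  ultimately have 1: "card Y \<le> Suc (maxlen (parts r a b) (X - {r}))" by linarith
  have xy: "0 \<le> fst r" "fst r \<le> 1" "0 \<le> snd r" "snd r \<le> 1" using rT by (auto simp: T_iff)
  have part: "(t * (1 - c)) powr (1 / 3) \<le> ((1 - d) * t) powr (1 / 3) + (1 / real N) powr (1 / 3)"
    if "0 \<le> t" "t \<le> 1" "d \<le> 1" "c \<le> d" "d \<le> c + 1 / N" for t c d :: real
  proof -
    have "t * (d - c) \<le> 1 * (1 / N)" using that by (intro mult_mono) auto
    then have "t * (1 - c) \<le> (1 - d) * t + 1 / N" by (simp add: algebra_simps)
    then have "(t * (1 - c)) powr (1 / 3) \<le> ((1 - d) * t + 1 / N) powr (1 / 3)"
      using that by (intro powr_mono2) auto
    also have "\<dots> \<le> ((1 - d) * t) powr (1 / 3) + (1 / real N) powr (1 / 3)"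
      using that by (intro powr_third_add_le) auto
    finally show ?thesis .
  qed
  have "m / v \<le> 1" "m / u \<le> 1" using m uv by auto
  then have "parts_deficit r a b \<ge> 8 / 3 * \<epsilon>\<^sup>2 - 2 * (1 / N) powr (1 / 3)"
    using part[of "fst r" "m / v" a] part[of "snd r" "m / u" b] xy i j
      cube_roots_le_direction[OF uv xy(1,3) r(2) m(3,4) e m(5)]
    unfolding parts_deficit_def a_def b_def by linarith
  then show ?thesis using that[OF r(1) i(1) j(1)] 1 by (simp add: a_def b_def)
qed

section \<open>The union bound\<close>

lemma lower_param_measurable:
  fixes f R :: "'w \<Rightarrow> real \<times> real"
  assumes "f \<in> borel_measurable N" "R \<in> borel_measurable N"
  shows "(\<lambda>\<omega>. lower a (R \<omega>) (f \<omega>)) \<in> borel_measurable N"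
proof -
  note m = borel_measurable_fst'[OF assms(1)] borel_measurable_snd'[OF assms(1)]
    borel_measurable_fst'[OF assms(2)] borel_measurable_snd'[OF assms(2)]
  have [measurable]: "Measurable.pred N (\<lambda>\<omega>. fst (R \<omega>) = 0)"
    unfolding pred_def using borel_measurable_eq[OF m(3) borel_measurable_const[of 0]] by simp
  show ?thesis
    unfolding lower_def
    by (intro measurable_If borel_measurable_const borel_measurable_Pair borel_measurable_divide
        borel_measurable_diff borel_measurable_times m) measurable
qed

lemma upper_param_measurable:
  fixes f R :: "'w \<Rightarrow> real \<times> real"
  assumes "f \<in> borel_measurable N" "R \<in> borel_measurable N"
  shows "(\<lambda>\<omega>. upper a (R \<omega>) (f \<omega>)) \<in> borel_measurable N"
  unfolding upper_def
  by (intro measurable_compose[OF _ swap_measurable] lower_param_measurable assms)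

lemma pred_parts:
  fixes f :: "'i \<Rightarrow> 'w \<Rightarrow> real \<times> real"
  assumes K: "finite K" and f: "\<And>i. i \<in> K \<Longrightarrow> f i \<in> borel_measurable N" and R: "R \<in> borel_measurable N"
  shows "Measurable.pred N (\<lambda>\<omega>. parts (R \<omega>) a b ((\<lambda>i. f i \<omega>) ` K))"
proof -
  have eq: "parts (R \<omega>) a b ((\<lambda>i. f i \<omega>) ` K) \<longleftrightarrow>
      cchain ((\<lambda>i. lower a (R \<omega>) (f i \<omega>)) ` {i \<in> K. fst (f i \<omega>) \<le> fst (R \<omega>)}) \<and>
      cchain ((\<lambda>i. upper b (R \<omega>) (f i \<omega>)) ` {i \<in> K. \<not> fst (f i \<omega>) \<le> fst (R \<omega>)})" for \<omega>
  proof -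
    have "g ` {z \<in> (\<lambda>i. f i \<omega>) ` K. P z} = (\<lambda>i. g (f i \<omega>)) ` {i \<in> K. P (f i \<omega>)}"
      for g :: "real \<times> real \<Rightarrow> real \<times> real" and P by auto
    then show ?thesis by (simp only: parts_def)
  qed
  have le: "Measurable.pred N (\<lambda>\<omega>. fst (f i \<omega>) \<le> fst (R \<omega>))" if "i \<in> K" for i
    unfolding pred_def by (intro borel_measurable_le borel_measurable_fst' f R that)
  show ?thesis
    unfolding eq
    by (intro pred_intros_logic pred_cchain K lower_param_measurable upper_param_measurable f R le)
qed

lemma hereditary_sample_parts: "hereditary_sample (parts r a b) \<mu>"
  by (intro hereditary_sampleI prob_space_\<mu> sets_\<mu> hereditary_parts pred_parts borel_measurable_const)

text \<open>The coordinate maps are injective unless a triangle degenerates; in that case their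
  value outside \<open>T\<close> leaves the part empty.\<close>

lemma maxlen_parts_le:
  assumes X: "finite X" and ab: "a < 1" "b < 1"
  shows "maxlen (parts r a b) X \<le> maxlen cchain (lower a r ` X) + maxlen cchain (upper b r ` X)"
proof -
  interpret P: hereditary "parts r a b" by (rule hereditary_parts)
  interpret hereditary cchain by (rule hereditary_cchain)
  obtain S where S: "S \<subseteq> X" "parts r a b S" "card S = maxlen (parts r a b) X"
    using P.maxlen_attained[OF X] by blast
  define S1 S2 where "S1 = {z \<in> S. fst z \<le> fst r}" and "S2 = {z \<in> S. \<not> fst z \<le> fst r}"
  have fin: "finite S" using S(1) X finite_subset by blast
  have c: "cchain (lower a r ` S1)" "cchain (upper b r ` S2)" using S(2) by (auto simp: parts_def S1_def S2_def)
  have "(2, 2) \<notin> T" by (simp add: T_iff)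
  have inj1: "inj_on (lower a r) S1"
  proof (cases "fst r = 0")
    case True
    then have "S1 = {}" using cchainD(1)[OF c(1)] \<open>(2, 2) \<notin> T\<close> by (auto simp: lower_def)
    then show ?thesis by simp
  qed (use ab inj_lower[of r a] in \<open>auto intro: inj_on_subset\<close>)
  have inj2: "inj_on (upper b r) S2"
  proof (cases "snd r = 0")
    case True
    then have "S2 = {}" using cchainD(1)[OF c(2)] \<open>(2, 2) \<notin> T\<close> by (auto simp: lower_def upper_def)
    then show ?thesis by simp
  next
    case False
    then have "inj (lower b (prod.swap r))" using ab by (intro inj_lower) auto
    then show ?thesis by (intro inj_onI) (metis upper_def swap_swap injD)
  qed
  have "card S = card S1 + card S2"
    using fin by (subst card_Un_disjoint[symmetric]) (auto simp: S1_def S2_def intro!: arg_cong[where f=card])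
  also have "card S1 \<le> maxlen cchain (lower a r ` X)"
    using maxlen_ge[of "lower a r ` X" "lower a r ` S1"] c(1) S(1) X inj1
    by (auto simp: card_image S1_def)
  also have "card S2 \<le> maxlen cchain (upper b r ` X)"
    using maxlen_ge[of "upper b r ` X" "upper b r ` S2"] c(2) S(1) X inj2
    by (auto simp: card_image S2_def)
  finally show ?thesis using S(3) by simp
qed

text \<open>The cube roots of the two areas and \<open>d\<close> add up to at most 1, so
  superadditivity fits three triangles into \<open>T\<close>, and the third one measures the
  loss.\<close>

lemma parts_mean_le:
  assumes r: "r \<in> T" and ab: "0 \<le> a" "a < 1" "0 \<le> b" "b < 1" and J: "finite J"
    and d: "0 \<le> d" "d \<le> 1" "d \<le> parts_deficit r a b"
  shows "hereditary_sample.mean (parts r a b) \<mu> {} J \<le> avg 1 (card J) {} - avg (d ^ 3) (card J) {}"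
proof -
  interpret H: hereditary_sample "parts r a b" \<mu> by (rule hereditary_sample_parts)
  let ?P = "PiM J (\<lambda>_. \<mu>)"
  define t1 t2 where "t1 = fst r * (1 - a)" and "t2 = snd r * (1 - b)"
  have rr: "0 \<le> fst r" "fst r \<le> 1" "0 \<le> snd r" "snd r \<le> 1" using r by (auto simp: T_iff)
  have t: "0 \<le> t1" "t1 \<le> 1" "0 \<le> t2" "t2 \<le> 1" using rr ab by (auto simp: t1_def t2_def intro!: mult_le_one)
  note L = integral_maxlen_scaling[OF scaling_lower[OF r ab(1,2), folded t1_def] t(1,2) J]
  note U = integral_maxlen_scaling[OF scaling_upper[OF r ab(3,4), folded t2_def] t(3,4) J]
  have "H.mean {} J \<le> (\<integral>x. real (maxlen cchain (lower a r ` x ` J)) + real (maxlen cchain (upper b r ` x ` J)) \<partial>?P)"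
    unfolding H.mean_def
  proof (intro integral_mono Bochner_Integration.integrable_add L U)
    show "integrable ?P (\<lambda>x. real (maxlen (parts r a b) ({} \<union> x ` J)))"
      using J by (intro H.integrable_maxlen) auto
    fix x
    show "real (maxlen (parts r a b) ({} \<union> x ` J)) \<le> real (maxlen cchain (lower a r ` x ` J)) + real (maxlen cchain (upper b r ` x ` J))"
      using maxlen_parts_le[of "x ` J" a b r] J ab by (simp flip: of_nat_add)
  qed
  also have "\<dots> = avg t1 (card J) {} + avg t2 (card J) {}"
    using L U by (subst Bochner_Integration.integral_add) auto
  also have "\<dots> \<le> avg 1 (card J) {} - avg (d ^ 3) (card J) {}"
  proof -
    define u1 u2 where "u1 = t1 powr (1 / 3)" and "u2 = t2 powr (1 / 3)"
    have u: "0 \<le> u1" "0 \<le> u2" "u1 ^ 3 = t1" "u2 ^ 3 = t2" using t powr_third_cube by (auto simp: u1_def u2_def)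
    have sum: "u1 + u2 \<le> 1 - d" using d(3) by (simp add: parts_deficit_def u1_def u2_def t1_def t2_def)
    have "avg (u1 ^ 3) (card J) {} + avg (u2 ^ 3) (card J) {} \<le> avg ((u1 + u2) ^ 3) (card J) {}"
      using u sum d by (intro avg_cube_add) auto
    also have "\<dots> \<le> avg ((1 - d) ^ 3) (card J) {}"
      using u sum d by (intro avg_cube_mono) auto
    finally show ?thesis using avg_cube_add[of "1 - d" d "card J"] d u by simp
  qed
  finally show ?thesis .
qed

lemma mean_\<mu>_cchain: "finite J \<Longrightarrow> hereditary_sample.mean cchain \<mu> {} J = avg 1 (card J) {}"
proof -
  assume J: "finite J"
  have s: "scaling 1 (\<lambda>z. z)" by (simp add: scaling_def)
  have "distr \<mu> borel (\<lambda>z. z) = \<mu>" by (intro distr_id2) simp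
  then show ?thesis using mean_eq_avg[OF s _ _ J, of "{}"] by simp
qed

lemma parts_tail:
  fixes J :: "nat set"
  assumes r: "r \<in> T" and ab: "0 \<le> a" "a < 1" "0 \<le> b" "b < 1" and J: "finite J"
    and d: "0 \<le> d" "d \<le> 1" "d \<le> parts_deficit r a b"
    and V: "(\<Sum>k=1..card J. avg 1 k {} / real k) \<le> V" and t: "0 \<le> t" "t \<le> V" "0 < V"
    and c: "avg 1 (card J) {} - avg (d ^ 3) (card J) {} + t \<le> c"
  shows "emeasure (PiM J (\<lambda>_. \<mu>)) {x \<in> space (PiM J (\<lambda>_. \<mu>)). c \<le> real (maxlen (parts r a b) (x ` J))}
    \<le> ennreal (exp (- t\<^sup>2 / (2 * V) * (1 - t / V)))"
proof -
  interpret H: hereditary_sample "parts r a b" \<mu> by (rule hereditary_sample_parts)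
  \<comment> \<open>On average the partial chains are no longer than the chains in all of
    \<open>T\<close>, so both tails can share the variance \<open>V\<close>.\<close>
  have e: "H.mean {} {..<m} \<le> avg 1 m {}" for m
    using parts_mean_le[OF r ab, of "{..<m}" d] d avg_nonneg[of "d ^ 3" "{}" m]
    by (simp add: power_le_one)
  show ?thesis
    using parts_mean_le[OF r ab J d] c by (intro H.upper_tail[OF e J V t]) auto
qed

lemma cchain_lower_tail:
  assumes V: "(\<Sum>k=1..n. avg 1 k {} / real k) \<le> V" and t: "0 \<le> t" "0 < V"
  shows "emeasure (PiM {..<n} (\<lambda>_. \<mu>)) {x \<in> space (PiM {..<n} (\<lambda>_. \<mu>)). real (maxlen cchain (x ` {..<n})) \<le> avg 1 n {} - t}
    \<le> ennreal (exp (- t\<^sup>2 / (2 * V)))"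
proof -
  interpret H: hereditary_sample cchain \<mu> by (intro hereditary_sample_cchain prob_space_\<mu>) simp
  show ?thesis
    using V t mean_\<mu>_cchain[of "{..<n}"] mean_\<mu>_cchain
    by (intro H.lower_tail[where e="\<lambda>m. avg 1 m {}"]) auto
qed

text \<open>Either the longest chain is short (event \<open>A\<close>), or a far chain makes the
  partial chains in some pair of triangles too long, with \<open>r\<close> one of \<open>p0\<close>,
  \<open>p2\<close> (events \<open>E\<close>) or a sample point (events \<open>F\<close>). This
  gives \<open>n + 2\<close> choices of \<open>r\<close> and \<open>N^2\<close> pairs of intercepts.
  The gap is taken for \<open>n - 1\<close> points, the number left when \<open>r\<close> is a
  sample point.\<close>

lemma union_bound:
  fixes n N :: nat and \<epsilon> d V t1 t2 :: real
  defines "P \<equiv> PiM {..<n} (\<lambda>_. \<mu>)"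
  assumes n: "0 < n" and N: "0 < N" and e: "0 \<le> \<epsilon>"
    and d: "0 \<le> d" "d \<le> 1" "d \<le> 8 / 3 * \<epsilon>\<^sup>2 - 2 * (1 / N) powr (1 / 3)"
    and V: "(\<Sum>k=1..n. avg 1 k {} / real k) \<le> V" "0 < V"
    and t1: "0 \<le> t1" "t1 < avg 1 n {}" and t2: "0 \<le> t2" "t2 \<le> V"
    and gap: "t1 + t2 + 1 \<le> avg (d ^ 3) (n - 1) {}"
  shows "emeasure P {x \<in> space P. \<exists>Y\<in>longest_chains (x ` {..<n}). \<epsilon> < hausdorff_dist (chain_path Y) special_parabola}
    \<le> ennreal (exp (- t1\<^sup>2 / (2 * V)) + real ((n + 2) * N\<^sup>2) * exp (- t2\<^sup>2 / (2 * V) * (1 - t2 / V)))"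
proof -
  \<comment> \<open>The 1 stands for the contact point, which belongs to neither part.\<close>
  define c where "c = avg 1 n {} - t1 - 1"
  define \<tau> where "\<tau> = exp (- t2\<^sup>2 / (2 * V) * (1 - t2 / V))"
  define g where "g i = real i / real N" for i
  \<comment> \<open>In \<open>F\<close> this condition concerns the point \<open>x k\<close> alone,
    so it is decided once that point is fixed.\<close>
  define Good where "Good r i j \<longleftrightarrow> r \<in> T \<and> d \<le> parts_deficit r (g i) (g j)" for r i j
  define A where "A = {x \<in> space P. real (maxlen cchain (x ` {..<n})) \<le> avg 1 n {} - t1}"
  define E where "E r i j = {x \<in> space P. Good r i j \<and> c \<le> real (maxlen (parts r (g i) (g j)) (x ` {..<n}))}" for r i j
  define F where "F k i j = {x \<in> space P. Good (x k) i j \<and>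
      c \<le> real (maxlen (parts (x k) (g i) (g j)) (x ` ({..<n} - {k})))}" for k i j
  define G where "G i j = E p0 i j \<union> E p2 i j \<union> (\<Union>k<n. F k i j)" for i j
  have g: "0 \<le> g i" "g i < 1" if "i < N" for i using that by (auto simp: g_def)
  have nn: "0 \<le> avg (d ^ 3) m {}" for m using d by (intro avg_nonneg) (auto intro: power_le_one)
  have gap_m: "avg 1 (card J) {} - avg (d ^ 3) (card J) {} + t2 \<le> c"
    if "card J = n \<or> card J = n - 1" for J :: "nat set"
  proof -
    have "avg 1 (n - 1) {} \<le> avg 1 n {}" "avg (d ^ 3) (n - 1) {} \<le> avg (d ^ 3) n {}"
      using d by (auto intro!: avg_mono_points power_le_one)
    then show ?thesis using that gap by (auto simp: c_def)
  qed
  have V_m: "(\<Sum>k=1..card J. avg 1 k {} / real k) \<le> V" if "card J \<le> n" for J :: "nat set"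
  proof -
    have "(\<Sum>k=1..card J. avg 1 k {} / real k) \<le> (\<Sum>k=1..n. avg 1 k {} / real k)"
      using that by (intro sum_mono2) (auto intro!: divide_nonneg_nonneg avg_nonneg)
    then show ?thesis using V by simp
  qed
  have cover: "{x \<in> space P. \<exists>Y\<in>longest_chains (x ` {..<n}). \<epsilon> < hausdorff_dist (chain_path Y) special_parabola}
      \<subseteq> A \<union> (\<Union>i<N. \<Union>j<N. G i j)"
  proof
    fix x assume "x \<in> {x \<in> space P. \<exists>Y\<in>longest_chains (x ` {..<n}). \<epsilon> < hausdorff_dist (chain_path Y) special_parabola}"
    then obtain Y where x: "x \<in> space P" and Y: "Y \<in> longest_chains (x ` {..<n})"
      and bad: "\<epsilon> < hausdorff_dist (chain_path Y) special_parabola" by blast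
    let ?X = "x ` {..<n}"
    interpret hereditary cchain by (rule hereditary_cchain)
    have Y': "Y \<subseteq> ?X" "cchain Y" "\<And>Z. Z \<subseteq> ?X \<Longrightarrow> cchain Z \<Longrightarrow> card Z \<le> card Y"
      using Y finite_subset[of _ ?X] by (auto simp: longest_chains_def convex_chain_iff)
    have cardY: "maxlen cchain ?X \<le> card Y"
      using Y' by (subst maxlen_le_iff) auto
    show "x \<in> A \<union> (\<Union>i<N. \<Union>j<N. G i j)"
    proof (cases "x \<in> A")
      case False
      then have large: "avg 1 n {} - t1 < real (maxlen cchain ?X)" using x by (auto simp: A_def)
      then have Yne: "Y \<noteq> {}" using t1 cardY by auto
      obtain r i j where r: "r \<in> Y \<union> {p0, p2}" and ij: "i < N" "j < N"
        and le: "card Y \<le> Suc (maxlen (parts r (real i / N) (real j / N)) (?X - {r}))"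
        and def: "8 / 3 * \<epsilon>\<^sup>2 - 2 * (1 / N) powr (1 / 3) \<le> parts_deficit r (real i / N) (real j / N)"
        using bad_chain_covered[OF finite_imageI[OF finite_lessThan] Y'(1,2) Yne e N bad] by blast
      have "r \<in> T" using r p02_T cchainD(1)[OF Y'(2)] by blast
      then have Good: "Good r i j" using def d by (simp add: Good_def g_def)
      have cle: "c \<le> real (maxlen (parts r (g i) (g j)) (?X - {r}))"
        using le cardY large by (simp add: c_def g_def)
      interpret P: hereditary "parts r (g i) (g j)" by (rule hereditary_parts)
      show ?thesis
      proof (cases "r \<in> Y")
        case True
        then obtain k where k: "k < n" "r = x k" using Y' by auto
        have "maxlen (parts r (g i) (g j)) (?X - {r}) \<le> maxlen (parts r (g i) (g j)) (x ` ({..<n} - {k}))"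
          using k by (intro P.maxlen_mono) auto
        then have "x \<in> F k i j" using x Good cle k by (simp add: F_def)
        then have "x \<in> G i j" using k by (auto simp: G_def)
        then show ?thesis using ij by blast
      next
        case False
        have "maxlen (parts r (g i) (g j)) (?X - {r}) \<le> maxlen (parts r (g i) (g j)) ?X"
          by (intro P.maxlen_mono) auto
        then have "x \<in> E r i j" using x Good cle by (simp add: E_def)
        then have "x \<in> G i j" using False r by (auto simp: G_def)
        then show ?thesis using ij by blast
      qed
    qed simp
  qed
  have comp: "(\<lambda>x. x k) \<in> borel_measurable P" if "k < n" for k
    using measurable_component_singleton[of k "{..<n}" "\<lambda>_. \<mu>"] that by (simp add: P_def)
  have A_sets: "A \<in> sets P"
  proof -
    have "(\<lambda>x. real (maxlen cchain (x ` {..<n}))) \<in> borel_measurable P"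
      using borel_measurable_integrable[OF integrable_maxlen_\<mu>] by (simp add: P_def)
    then show ?thesis unfolding A_def by (intro borel_measurable_le borel_measurable_const)
  qed
  have meas_parts: "(\<lambda>x. real (maxlen (parts (R x) a b) (x ` J))) \<in> borel_measurable P"
    if R: "R \<in> borel_measurable P" and J: "J \<subseteq> {..<n}" for R a b J
  proof -
    have fJ: "finite J" using J finite_subset by blast
    have "(\<lambda>x. real (maxlen (parts (R x) a b) ((\<lambda>i. x i) ` J))) \<in> borel_measurable P"
    proof (rule measurable_maxlen_general[where C="\<lambda>x. parts (R x) a b", OF hereditary_parts fJ])
      show "(\<lambda>x. x i) \<in> borel_measurable P" if "i \<in> J" for i using that J by (intro comp) auto
      show "Measurable.pred P (\<lambda>x. parts (R x) a b ((\<lambda>i. x i) ` K))" if "K \<subseteq> J" for K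
        using that J fJ by (intro pred_parts R comp) (auto intro: finite_subset)
    qed
    then show ?thesis by simp
  qed
  have E_sets: "E r i j \<in> sets P" for r i j
  proof (cases "Good r i j")
    case True
    then have "E r i j = {x \<in> space P. c \<le> real (maxlen (parts r (g i) (g j)) (x ` {..<n}))}" by (simp add: E_def)
    then show ?thesis using meas_parts[of "\<lambda>_. r" "{..<n}"] by (simp add: borel_measurable_le)
  qed (simp add: E_def)
  have F_sets: "F k i j \<in> sets P" if k: "k < n" for k i j
  proof -
    note fs = borel_measurable_fst'[OF comp[OF k]] borel_measurable_snd'[OF comp[OF k]]
    have "{x \<in> space P. d \<le> parts_deficit (x k) (g i) (g j)} \<in> sets P"
      unfolding parts_deficit_def
      by (intro borel_measurable_le borel_measurable_const borel_measurable_diff powr_real_measurable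
          borel_measurable_times fs)
    moreover have "{x \<in> space P. x k \<in> T} \<in> sets P"
      using measurable_sets[OF comp[OF k] T_borel] by (simp add: vimage_def Int_def conj_commute)
    moreover have "{x \<in> space P. c \<le> real (maxlen (parts (x k) (g i) (g j)) (x ` ({..<n} - {k})))} \<in> sets P"
      by (intro borel_measurable_le borel_measurable_const meas_parts comp[OF k]) auto
    moreover have "F k i j = {x \<in> space P. d \<le> parts_deficit (x k) (g i) (g j)} \<inter> {x \<in> space P. x k \<in> T} \<inter>
        {x \<in> space P. c \<le> real (maxlen (parts (x k) (g i) (g j)) (x ` ({..<n} - {k})))}"
      by (auto simp: F_def Good_def)
    ultimately show ?thesis by (simp only: sets.Int)
  qed
  have tail: "emeasure (PiM J (\<lambda>_. \<mu>)) {x \<in> space (PiM J (\<lambda>_. \<mu>)). c \<le> real (maxlen (parts r (g i) (g j)) (x ` J))} \<le> ennreal \<tau>"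
    if "Good r i j" "i < N" "j < N" "finite J" "card J = n \<or> card J = n - 1" for r i j and J :: "nat set"
    unfolding \<tau>_def using that d V t2 g
    by (intro parts_tail[where d=d] V_m gap_m) (auto simp: Good_def)
  have E_le: "emeasure P (E r i j) \<le> ennreal \<tau>" if "i < N" "j < N" for r i j
  proof (cases "Good r i j")
    case True
    then show ?thesis using tail[of r i j "{..<n}"] that by (simp add: E_def P_def)
  qed (simp add: E_def)
  have F_le: "emeasure P (F k i j) \<le> ennreal \<tau>" if ij: "i < N" "j < N" and k: "k < n" for k i j
  proof -
    define J where "J = {..<n} - {k}"
    have J: "finite J" "k \<notin> J" "insert k J = {..<n}" "card J = n - 1" using k by (auto simp: J_def)
    interpret product_sigma_finite "\<lambda>_ :: nat. \<mu>" by standard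
    have P: "P = PiM (insert k J) (\<lambda>_. \<mu>)" by (simp add: P_def J)
    have "emeasure P (F k i j) = (\<integral>\<^sup>+x. indicator (F k i j) x \<partial>P)" using F_sets[OF k] by simp
    \<comment> \<open>The contact point is fixed first; the other \<open>n - 1\<close> points stay
      independent and uniform.\<close>
    also have "\<dots> = (\<integral>\<^sup>+z. \<integral>\<^sup>+x. indicator (F k i j) (x(k := z)) \<partial>PiM J (\<lambda>_. \<mu>) \<partial>\<mu>)"
      unfolding P using F_sets[OF k, of i j] J by (intro product_nn_integral_insert_rev) (auto simp: P)
    also have "\<dots> \<le> (\<integral>\<^sup>+z. ennreal \<tau> \<partial>\<mu>)"
    proof (intro nn_integral_mono)
      fix z
      let ?S = "{x \<in> space (PiM J (\<lambda>_. \<mu>)). c \<le> real (maxlen (parts z (g i) (g j)) (x ` J))}"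
      have im: "(x(k := z)) ` J = x ` J" for x :: "nat \<Rightarrow> real \<times> real" using J(2) by (auto simp: image_def)
      show "(\<integral>\<^sup>+x. indicator (F k i j) (x(k := z)) \<partial>PiM J (\<lambda>_. \<mu>)) \<le> ennreal \<tau>"
      proof (cases "Good z i j")
        case False
        then show ?thesis by (simp add: F_def)
      next
        case True
        interpret H: hereditary_sample "parts z (g i) (g j)" \<mu> by (rule hereditary_sample_parts)
        have S: "?S \<in> sets (PiM J (\<lambda>_. \<mu>))"
          using H.measurable_maxlen[of "{}" J] J by (simp add: borel_measurable_le)
        have "(\<integral>\<^sup>+x. indicator (F k i j) (x(k := z)) \<partial>PiM J (\<lambda>_. \<mu>)) \<le> (\<integral>\<^sup>+x. indicator ?S x \<partial>PiM J (\<lambda>_. \<mu>))"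
        proof (intro nn_integral_mono)
          fix x assume "x \<in> space (PiM J (\<lambda>_. \<mu>))"
          then show "indicator (F k i j) (x(k := z)) \<le> (indicator ?S x :: ennreal)"
            unfolding indicator_def F_def J_def[symmetric] mem_Collect_eq im by simp
        qed
        also have "\<dots> = emeasure (PiM J (\<lambda>_. \<mu>)) ?S" using S by simp
        also have "\<dots> \<le> ennreal \<tau>" using tail[OF True ij J(1)] J(4) by simp
        finally show ?thesis .
      qed
    qed
    also have "\<dots> = ennreal \<tau>" using \<mu>.emeasure_space_1 by simp
    finally show ?thesis .
  qed
  have block: "emeasure P (G i j) \<le> ennreal (real (n + 2) * \<tau>)"
    if ij: "i < N" "j < N" for i j
  proof -
    have \<tau>0: "0 \<le> \<tau>" by (simp add: \<tau>_def)
    have "emeasure P (\<Union>k<n. F k i j) \<le> (\<Sum>k<n. emeasure P (F k i j))"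
      using F_sets by (intro emeasure_subadditive_finite) auto
    also have "\<dots> \<le> (\<Sum>k<n. ennreal \<tau>)" using ij by (intro sum_mono F_le) auto
    also have "\<dots> = ennreal (real n * \<tau>)" using \<tau>0 by (simp add: ennreal_of_nat_eq_real_of_nat ennreal_mult)
    finally have F: "emeasure P (\<Union>k<n. F k i j) \<le> ennreal (real n * \<tau>)" .
    have "emeasure P (G i j) \<le>
        emeasure P (E p0 i j \<union> E p2 i j) + emeasure P (\<Union>k<n. F k i j)"
      unfolding G_def using E_sets F_sets by (intro emeasure_subadditive) auto
    also have "\<dots> \<le> (emeasure P (E p0 i j) + emeasure P (E p2 i j)) + emeasure P (\<Union>k<n. F k i j)"
      using E_sets by (intro add_right_mono emeasure_subadditive) auto
    also have "\<dots> \<le> (ennreal \<tau> + ennreal \<tau>) + ennreal (real n * \<tau>)"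
      using ij by (intro add_mono E_le F)
    also have "\<dots> = ennreal (real (n + 2) * \<tau>)"
      using \<tau>0 by (simp add: algebra_simps flip: ennreal_plus)
    finally show ?thesis .
  qed
  have G_sets: "G i j \<in> sets P" "(\<Union>j<N. G i j) \<in> sets P" for i j
    unfolding G_def by (intro sets.finite_UN sets.Un E_sets F_sets; simp)+
  have "emeasure P {x \<in> space P. \<exists>Y\<in>longest_chains (x ` {..<n}). \<epsilon> < hausdorff_dist (chain_path Y) special_parabola}
      \<le> emeasure P (A \<union> (\<Union>i<N. \<Union>j<N. G i j))"
    using cover A_sets G_sets by (intro emeasure_mono) auto
  also have "\<dots> \<le> emeasure P A + emeasure P (\<Union>i<N. \<Union>j<N. G i j)"
    using A_sets G_sets by (intro emeasure_subadditive) auto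
  also have "\<dots> \<le> ennreal (exp (- t1\<^sup>2 / (2 * V))) + ennreal (real ((n + 2) * N\<^sup>2) * \<tau>)"
  proof (intro add_mono)
    show "emeasure P A \<le> ennreal (exp (- t1\<^sup>2 / (2 * V)))"
      unfolding A_def P_def by (intro cchain_lower_tail V t1)
    have \<tau>0: "0 \<le> \<tau>" by (simp add: \<tau>_def)
    have "emeasure P (\<Union>i<N. \<Union>j<N. G i j) \<le>
        (\<Sum>i<N. emeasure P (\<Union>j<N. G i j))"
      using G_sets by (intro emeasure_subadditive_finite) auto
    also have "\<dots> \<le> (\<Sum>i<N. \<Sum>j<N. emeasure P (G i j))"
      using G_sets by (intro sum_mono emeasure_subadditive_finite) auto
    also have "\<dots> \<le> (\<Sum>i<N. \<Sum>j<N. ennreal (real (n + 2) * \<tau>))"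
      by (intro sum_mono block) auto
    also have "\<dots> = ennreal (real ((n + 2) * N\<^sup>2) * \<tau>)"
      using \<tau>0 by (simp add: ennreal_of_nat_eq_real_of_nat power2_eq_square algebra_simps flip: ennreal_mult ennreal_plus)
    finally show "emeasure P (\<Union>i<N. \<Union>j<N. G i j) \<le> ennreal (real ((n + 2) * N\<^sup>2) * \<tau>)" .
  qed
  also have "\<dots> = ennreal (exp (- t1\<^sup>2 / (2 * V)) + real ((n + 2) * N\<^sup>2) * \<tau>)"
    by (intro ennreal_plus[symmetric]) (auto simp: \<tau>_def)
  finally show ?thesis by (simp only: \<tau>_def)
qed

section \<open>Choice of the parameters\<close>

theorem theorem1p3:
  fixes \<gamma> :: real
  assumes "\<gamma> \<ge> 1"
  shows "\<exists>N::nat. N > 0 \<and> (\<forall>n::nat. n > N \<longrightarrow>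
    (let \<epsilon> = 3 / 2 * \<gamma> powr (1 / 2) * real n powr (- 1 / 12) * (ln (real n)) powr (1 / 4)
     in \<P>(x in sample_space n. \<exists>Y \<in> longest_chains (x ` {..<n}).
            hausdorff_dist (chain_path Y) special_parabola > \<epsilon>)
          < 2 * real n powr (- (\<gamma>\<^sup>2) / 14)))"
proof -
  \<comment> \<open>The unit of all deviations, the square root of
    \<open>n^(1/3) * ln n\<close>.\<close>
  define q where "q n = real n powr (1 / 6) * ln (real n) powr (1 / 2)" for n :: nat
  \<comment> \<open>\<open>8 / 3 * \<epsilon>^2\<close> is \<gamma> times the first term; \<gamma>
    times the second bounds the loss from rounding on a grid with
    \<open>N \<ge> sqrt n\<close>.\<close>
  define h where "h n = 6 * real n powr (- 1 / 6) * ln (real n) powr (1 / 2) - 2 * real n powr (- 1 / 6)" for n :: nat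
  define sa where "sa = sqrt \<alpha>"
  have \<alpha>0: "0 < \<alpha>" using \<alpha>_ge by simp
  have sa: "sa * sa = \<alpha>" "0 < sa" using \<alpha>0 by (auto simp: sa_def)
  have sa_ge: "77 / 100 \<le> sa"
    unfolding sa_def using \<alpha>_ge by (intro real_le_rsqrt) (simp add: power2_eq_square)
  obtain w where w: "0 < w" "\<And>m u. w ^ 3 \<le> real m \<Longrightarrow> 0 \<le> u \<Longrightarrow> u \<le> 1 \<Longrightarrow>
      (1 - 1 / 100) * \<alpha> * (u * real m powr (1 / 3) - w) \<le> avg (u ^ 3) m {}"
    using avg_cube_lower[of "1 / 100"] by auto
  \<comment> \<open>For \<open>q n\<close> above this value the constants
    \<open>1 + \<alpha> * w\<close> fit into \<open>2 / 100 * sa * q n\<close>.\<close>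
  define M1 where "M1 = (1 + \<alpha> * w) / (2 / 100 * sa)"
  have "\<forall>\<^sub>F n in sequentially. (\<Sum>k=1..n. avg 1 k {} / real k) \<le> 3 * (51 / 50 * \<alpha>) * real n powr (1 / 3)"
    using \<alpha>0 by (intro sum_avg_le) simp
  moreover have "\<forall>\<^sub>F n in sequentially. w ^ 3 \<le> real (n - 1)"
    by real_asymp
  \<comment> \<open>Slightly less than 6, to absorb the rounding term and the passage from
    \<open>n\<close> to \<open>n - 1\<close>.\<close>
  moreover have "\<forall>\<^sub>F n in sequentially. 599 / 100 * q n \<le> h n * real (n - 1) powr (1 / 3)"
    unfolding q_def h_def by real_asymp
  moreover have "\<forall>\<^sub>F n in sequentially. 0 \<le> h n"
    unfolding h_def by real_asymp
  moreover have "\<forall>\<^sub>F n in sequentially. M1 \<le> q n"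
    unfolding q_def by real_asymp
  moreover have "\<forall>\<^sub>F n in sequentially. h n < 1 / \<gamma>"
  proof (rule order_tendstoD)
    show "h \<longlonglongrightarrow> 0" unfolding h_def by real_asymp
  qed (use assms in simp)
  moreover have "\<forall>\<^sub>F n in sequentially. q n / real n powr (1 / 3) < sa / (125 * \<gamma>)"
  proof (rule order_tendstoD)
    show "(\<lambda>n. q n / real n powr (1 / 3)) \<longlonglongrightarrow> 0" unfolding q_def by real_asymp
  qed (use assms sa in simp)
  moreover have "\<forall>\<^sub>F n in sequentially. q n / (3 / 5 * (real n powr (1 / 3) - 1)) < 1 / (sa * \<gamma>)"
  proof (rule order_tendstoD)
    show "(\<lambda>n. q n / (3 / 5 * (real n powr (1 / 3) - 1))) \<longlonglongrightarrow> 0" unfolding q_def by real_asymp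
  qed (use assms sa in simp)
  \<comment> \<open>The union bound has about \<open>n^2\<close> terms, so any exponent above 2
    works.\<close>
  moreover have "\<forall>\<^sub>F n in sequentially. (real n + 2) * (sqrt (real n) + 1)\<^sup>2 * real n powr (- 208 / 100) < 1"
    by real_asymp
  moreover have "\<forall>\<^sub>F n in sequentially. (3 :: nat) \<le> n"
    by (rule eventually_ge_at_top)
  ultimately have "\<forall>\<^sub>F n in sequentially.
    (let \<epsilon> = 3 / 2 * \<gamma> powr (1 / 2) * real n powr (- 1 / 12) * (ln (real n)) powr (1 / 4)
     in \<P>(x in sample_space n. \<exists>Y \<in> longest_chains (x ` {..<n}).
            hausdorff_dist (chain_path Y) special_parabola > \<epsilon>)
          < 2 * real n powr (- (\<gamma>\<^sup>2) / 14))"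
  proof eventually_elim
    case (elim n)
    define \<epsilon> where "\<epsilon> = 3 / 2 * \<gamma> powr (1 / 2) * real n powr (- 1 / 12) * (ln (real n)) powr (1 / 4)"
    \<comment> \<open>Fine enough for the rounding loss to be smaller than the deficit by a factor
      of order \<open>sqrt (ln n)\<close>, coarse enough for only about \<open>n\<close> pairs of
      intercepts.\<close>
    define N where "N = nat \<lceil>sqrt (real n)\<rceil>"
    define y where "y = real n powr (1 / 3)"
    define V where "V = 3 * (51 / 50 * \<alpha>) * y"
    (* Any factors a, b with a^2 > 6/14, b^2 > 6 (2 + 1/14) and a + b < 6 sqrt \<alpha> would do for
       t1 and t2; the gap between the two means is 6 \<alpha> \<gamma> q n. *)
    define t1 where "t1 = 68 / 100 * sa * (\<gamma> * q n)"
    define t2 where "t2 = 365 / 100 * sa * (\<gamma> * q n)"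
    define d where "d = \<gamma> * h n"
    let ?P = "PiM {..<n} (\<lambda>_. \<mu>)"
    let ?S = "{x \<in> space ?P. \<exists>Y\<in>longest_chains (x ` {..<n}). \<epsilon> < hausdorff_dist (chain_path Y) special_parabola}"
    interpret prob_space ?P by (intro prob_space_PiM prob_space_\<mu>)
    have n: "3 \<le> n" using elim by simp
    have ln0: "0 < ln (real n)" using n by simp
    have q0: "0 < q n" using n ln0 by (simp add: q_def)
    have q2: "(q n)\<^sup>2 = y * ln (real n)"
      using n ln0 by (simp add: q_def y_def power_mult_distrib powr_powr flip: powr_numeral)
    have y0: "0 < y" using n by (simp add: y_def)
    have y1: "1 < y" using n by (simp add: y_def)
    have V0: "0 < V" using y0 \<alpha>0 by (simp add: V_def)
    have e2: "\<epsilon>\<^sup>2 = 9 / 4 * (\<gamma> * (real n powr (- 1 / 6) * ln (real n) powr (1 / 2)))"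
      using n ln0 assms by (simp add: \<epsilon>_def power_mult_distrib powr_powr power2_eq_square flip: powr_add)
    have N: "0 < N" "sqrt (real n) \<le> real N" "real N \<le> sqrt (real n) + 1"
    proof -
      have "0 < \<lceil>sqrt (real n)\<rceil>" using n by simp
      then show "0 < N" "sqrt (real n) \<le> real N" "real N \<le> sqrt (real n) + 1"
        using le_of_int_ceiling[of "sqrt (real n)"] of_int_ceiling_le_add_one[of "sqrt (real n)"]
        by (simp_all add: N_def)
    qed
    have d_le: "d \<le> 8 / 3 * \<epsilon>\<^sup>2 - 2 * (1 / real N) powr (1 / 3)"
    proof -
      have "(1 / real N) powr (1 / 3) \<le> (1 / sqrt (real n)) powr (1 / 3)"
        using N n by (intro powr_mono2) (auto intro!: divide_left_mono)
      also have "\<dots> = real n powr (- 1 / 6)"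
        using n by (simp add: powr_divide powr_half_sqrt[symmetric] powr_powr powr_minus_divide)
      also have "\<dots> \<le> \<gamma> * real n powr (- 1 / 6)"
        using mult_right_mono[OF assms, of "real n powr (- 1 / 6)"] by simp
      finally show ?thesis by (simp add: d_def h_def e2 algebra_simps)
    qed
    have d: "0 \<le> d" "d \<le> 1"
      using elim assms by (auto simp: d_def field_simps)
    have gap: "t1 + t2 + 1 \<le> avg (d ^ 3) (n - 1) {}"
    proof -
      have "M1 \<le> \<gamma> * q n" using elim(5) assms q0 mult_right_mono[of 1 \<gamma> "q n"] by linarith
      then have "1 + \<alpha> * w \<le> 2 / 100 * sa * (\<gamma> * q n)"
        using sa(2) by (simp add: M1_def field_simps)
      moreover have "t1 + t2 = 433 / 100 * sa * (\<gamma> * q n)" by (simp add: t1_def t2_def)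
      ultimately have "t1 + t2 + 1 + \<alpha> * w \<le> 435 / 100 * sa * (\<gamma> * q n)"
        by (simp only: mult.assoc)
      \<comment> \<open>Here the lower bound for \<alpha> enters: one factor \<open>sa\<close> is at
        least 0.77, and \<open>0.99 * 5.99 * 0.77\<close> exceeds 4.35.\<close>
      also have "\<dots> \<le> 99 / 100 * (599 / 100) * sa * sa * (\<gamma> * q n)"
        using sa_ge sa(2) q0 assms by (intro mult_right_mono) auto
      also have "\<dots> = 99 / 100 * \<alpha> * (\<gamma> * (599 / 100 * q n))" by (simp add: sa(1)[symmetric])
      also have "\<dots> \<le> 99 / 100 * \<alpha> * (\<gamma> * (h n * real (n - 1) powr (1 / 3)))"
        using elim \<alpha>0 assms by (intro mult_left_mono) auto
      also have "\<dots> \<le> avg (d ^ 3) (n - 1) {} + 99 / 100 * \<alpha> * w"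
        using w(2)[of "n - 1" d] elim d by (simp add: d_def algebra_simps)
      finally have "t1 + t2 + 1 + \<alpha> * w \<le> avg (d ^ 3) (n - 1) {} + 99 / 100 * \<alpha> * w" .
      moreover have "99 / 100 * \<alpha> * w \<le> \<alpha> * w" using \<alpha>0 w(1) by simp
      ultimately show ?thesis by linarith
    qed
    have t1: "0 \<le> t1" "t1 < avg 1 n {}"
    proof -
      show "0 \<le> t1" using sa q0 assms by (simp add: t1_def)
      have "sa * \<gamma> * q n < 3 / 5 * (y - 1)"
        using elim(8) y1 sa assms by (simp add: y_def[symmetric] field_simps)
      moreover have "t1 \<le> sa * \<gamma> * q n" using sa q0 assms by (simp add: t1_def)
      moreover have "3 / 5 * (y - 1) \<le> avg 1 n {}" using avg_lower_bound[of n] n by (simp add: y_def)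
      ultimately show "t1 < avg 1 n {}" by linarith
    qed
    \<comment> \<open>Since \<open>q n\<close> is of smaller order than \<open>n^(1/3)\<close>, the
      factor \<open>1 - t2 / V\<close> of the upper tail is eventually at least 0.99.\<close>
    have t2V: "t2 \<le> V / 100"
    proof -
      have "125 * \<gamma> * q n \<le> sa * y"
        using elim(7) y0 assms by (simp add: y_def[symmetric] field_simps)
      then have "sa * (125 * \<gamma> * q n) \<le> sa * (sa * y)" using sa by (intro mult_left_mono) auto
      moreover have "sa * (sa * y) = \<alpha> * y" by (simp add: sa(1)[symmetric])
      moreover have "0 \<le> \<alpha> * y" using \<alpha>0 y0 by simp
      moreover have "t2 = 365 / 12500 * (sa * (125 * \<gamma> * q n))" "V / 100 = 306 / 10000 * (\<alpha> * y)"
        by (simp_all add: t2_def V_def)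
      ultimately show ?thesis by linarith
    qed
    have t2: "0 \<le> t2" "t2 \<le> V"
    proof -
      show "0 \<le> t2" using sa q0 assms by (simp add: t2_def)
      show "t2 \<le> V" using t2V V0 by linarith
    qed
    have sq: "(r * sa * (\<gamma> * q n))\<^sup>2 = r\<^sup>2 * \<gamma>\<^sup>2 * ln (real n) * (\<alpha> * y)" for r
    proof -
      have "(r * sa * (\<gamma> * q n))\<^sup>2 = r\<^sup>2 * \<gamma>\<^sup>2 * (q n)\<^sup>2 * (sa * sa)"
        by (simp only: power2_eq_square mult.assoc mult.commute mult.left_commute)
      then show ?thesis by (simp only: q2 sa(1) mult.assoc mult.commute mult.left_commute)
    qed
    have exp1: "exp (- t1\<^sup>2 / (2 * V)) \<le> real n powr (- (\<gamma>\<^sup>2) / 14)"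
    proof -
      have "t1\<^sup>2 = (68 / 100)\<^sup>2 * \<gamma>\<^sup>2 * ln (real n) * (\<alpha> * y)"
        unfolding t1_def by (rule sq)
      then have "t1\<^sup>2 / (2 * V) = (68 / 100)\<^sup>2 / (6 * (51 / 50)) * \<gamma>\<^sup>2 * ln (real n)"
        using \<alpha>0 y0 by (simp add: V_def)
      \<comment> \<open>\<open>0.68^2 / 6.12\<close> is about 0.0756, and 1/14 about 0.0714.\<close>
      moreover have "1 / 14 * (\<gamma>\<^sup>2 * ln (real n)) \<le> (68 / 100)\<^sup>2 / (6 * (51 / 50)) * (\<gamma>\<^sup>2 * ln (real n))"
        using ln0 by (intro mult_right_mono) (auto simp: power2_eq_square)
      ultimately show ?thesis using n by (simp add: powr_def)
    qed
    have exp2: "real ((n + 2) * N\<^sup>2) * exp (- t2\<^sup>2 / (2 * V) * (1 - t2 / V)) < real n powr (- (\<gamma>\<^sup>2) / 14)"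
    proof -
      have "t2\<^sup>2 = (365 / 100)\<^sup>2 * \<gamma>\<^sup>2 * ln (real n) * (\<alpha> * y)"
        unfolding t2_def by (rule sq)
      then have eq: "t2\<^sup>2 / (2 * V) = (365 / 100)\<^sup>2 / (6 * (51 / 50)) * (\<gamma>\<^sup>2 * ln (real n))"
        using \<alpha>0 y0 by (simp add: V_def)
      have "t2 / V \<le> 1 / 100" using t2V V0 by (simp add: field_simps)
      then have "t2\<^sup>2 / (2 * V) * (99 / 100) \<le> t2\<^sup>2 / (2 * V) * (1 - t2 / V)"
        using V0 by (intro mult_left_mono) auto
      moreover have "(208 / 100 + 1 / 14) * (\<gamma>\<^sup>2 * ln (real n)) \<le> t2\<^sup>2 / (2 * V) * (99 / 100)"
      proof -
        \<comment> \<open>\<open>3.65^2 / 6.12 * 0.99\<close> is about 2.155, just above the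
          required 2.151.\<close>
        have "(208 / 100 + 1 / 14) * (\<gamma>\<^sup>2 * ln (real n)) \<le> (365 / 100)\<^sup>2 / (6 * (51 / 50)) * (99 / 100) * (\<gamma>\<^sup>2 * ln (real n))"
          using ln0 by (intro mult_right_mono) (auto simp: power2_eq_square)
        then show ?thesis unfolding eq by (simp only: mult.commute mult.left_commute mult.assoc)
      qed
      \<comment> \<open>By \<open>\<gamma> \<ge> 1\<close> the surplus
        \<open>2.08 * \<gamma>^2\<close> in the exponent is at least 2.08, which pays for the number
        of events.\<close>
      moreover have "1 * ln (real n) \<le> \<gamma>\<^sup>2 * ln (real n)"
        using ln0 assms by (intro mult_right_mono) auto
      moreover have "- t2\<^sup>2 / (2 * V) * (1 - t2 / V) = - (t2\<^sup>2 / (2 * V) * (1 - t2 / V))"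
        "- (\<gamma>\<^sup>2) / 14 * ln (real n) = - (1 / 14 * (\<gamma>\<^sup>2 * ln (real n)))" by simp_all
      moreover have "- W \<le> - 208 / 100 * L + - (1 / 14 * G)"
        if "A \<le> W" "(208 / 100 + 1 / 14) * G \<le> A" "1 * L \<le> G" for A G L W :: real
      proof -
        have "208 / 100 * G + 1 / 14 * G \<le> A" using that(2) by (simp only: distrib_right)
        moreover have "208 / 100 * L \<le> 208 / 100 * G" using that(3) by simp
        moreover have "- 208 / 100 * L = - (208 / 100 * L)" by simp
        ultimately show ?thesis using that(1) by linarith
      qed
      ultimately have "- t2\<^sup>2 / (2 * V) * (1 - t2 / V) \<le> - 208 / 100 * ln (real n) + - (\<gamma>\<^sup>2) / 14 * ln (real n)"
        by (simp only:)
      then have "exp (- t2\<^sup>2 / (2 * V) * (1 - t2 / V)) \<le> real n powr (- 208 / 100) * real n powr (- (\<gamma>\<^sup>2) / 14)"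
        using n by (simp add: powr_def flip: exp_add)
      moreover have "real ((n + 2) * N\<^sup>2) \<le> (real n + 2) * (sqrt (real n) + 1)\<^sup>2"
      proof -
        have "(real n + 2) * (real N)\<^sup>2 \<le> (real n + 2) * (sqrt (real n) + 1)\<^sup>2"
          using N by (intro mult_left_mono power_mono) auto
        then show ?thesis by (simp add: algebra_simps)
      qed
      ultimately have "real ((n + 2) * N\<^sup>2) * exp (- t2\<^sup>2 / (2 * V) * (1 - t2 / V)) \<le>
          ((real n + 2) * (sqrt (real n) + 1)\<^sup>2) * (real n powr (- 208 / 100) * real n powr (- (\<gamma>\<^sup>2) / 14))"
        by (intro mult_mono) auto
      also have "\<dots> = ((real n + 2) * (sqrt (real n) + 1)\<^sup>2 * real n powr (- 208 / 100)) * real n powr (- (\<gamma>\<^sup>2) / 14)"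
        by (simp only: mult.assoc)
      also have "\<dots> < 1 * real n powr (- (\<gamma>\<^sup>2) / 14)"
        using elim n by (intro mult_strict_right_mono) auto
      finally show ?thesis by simp
    qed
    have "emeasure ?P ?S \<le> ennreal (exp (- t1\<^sup>2 / (2 * V)) + real ((n + 2) * N\<^sup>2) * exp (- t2\<^sup>2 / (2 * V) * (1 - t2 / V)))"
    proof (rule union_bound[OF _ N(1) _ d d_le _ V0 t1 t2 gap])
      show "(\<Sum>k=1..n. avg 1 k {} / real k) \<le> V" using elim(1) by (simp add: V_def y_def)
    qed (use n in \<open>auto simp: \<epsilon>_def\<close>)
    then have "prob ?S \<le> exp (- t1\<^sup>2 / (2 * V)) + real ((n + 2) * N\<^sup>2) * exp (- t2\<^sup>2 / (2 * V) * (1 - t2 / V))"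
      unfolding emeasure_eq_measure by (subst (asm) ennreal_le_iff) (auto intro!: add_nonneg_nonneg)
    also have "\<dots> < 2 * real n powr (- (\<gamma>\<^sup>2) / 14)" using exp1 exp2 by linarith
    finally show ?case by (simp add: Let_def \<epsilon>_def sample_space_def \<mu>_def)
  qed
  then obtain N0 where "\<And>n. n \<ge> N0 \<Longrightarrow>
    (let \<epsilon> = 3 / 2 * \<gamma> powr (1 / 2) * real n powr (- 1 / 12) * (ln (real n)) powr (1 / 4)
     in \<P>(x in sample_space n. \<exists>Y \<in> longest_chains (x ` {..<n}).
            hausdorff_dist (chain_path Y) special_parabola > \<epsilon>)
          < 2 * real n powr (- (\<gamma>\<^sup>2) / 14))"
    unfolding eventually_sequentially by blast
  then show ?thesis by (intro exI[of _ "Suc N0"]) auto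
qed

end
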